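(* Let $V$ be a locally linearly compact vector space over a discrete field $\mathbb{K}$ and $\phi:V\to V$ a continuous endomorphism. (a) (Invariance under conjugation) If $\alpha:V\to W$ is a topological isomorphism of locally linearly compact vector spaces, then $\mathrm{ent}^*(\alpha\phi\alpha^{-1})=\mathrm{ent}^*(\phi)$. (b) (Monotonicity) If $W$ is a closed linear subspace of $V$ with $\phi W\leq W$ and $\overline{\phi}:V/W\to V/W$ is the continuous endomorphism induced by $\phi$, then $\mathrm{ent}^*(\phi)\geq\max\{\mathrm{ent}^*(\phi\restriction_W),\mathrm{ent}^*(\overline{\phi})\}$. If moreover $W$ is open, then $\mathrm{ent}^*(\phi)=\mathrm{ent}^*(\phi\restriction_W)$. (c) (Logarithmic law) If $k\in\mathbb{N}$, then $\mathrm{ent}^*(\phi^k)=k\cdot\mathrm{ent}^*(\phi)$. (d) (weak Addition Theorem) If $V=V_1\times V_2$ for some locally linearly compact vector spaces $V_1,V_2$, and $\phi=\phi_1\times\phi_2:V\to V$ for some continuous endomorphisms $\phi_i:V_i\to V_i$, $i=1,2$, then $\mathrm{ent}^*(\phi)=\mathrm{ent}^*(\phi_1)+\mathrm{ent}^*(\phi_2)$. (e) (Continuity on inverse limits) Let $\{W_i\mid i\in I\}$ be a directed system (under inverse inclusion) of closed linear subspaces of $V$ with $\phi W_i\leq W_i$ for all $i\in I$. If $V=\varprojlim V/W_i$, then $\mathrm{ent}^*(\phi)=\sup_{i\in I}\mathrm{ent}^*(\overline{\phi}_{W_i})$, where $\overline{\phi}_{W_i}:V/W_i\to V/W_i$ is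 the continuous endomorphism induced by $\phi$.
   Context: $\mathbb{N}=\{0,1,2,\dots\}$; $\phi^0=\mathrm{id}_V$, and $0\cdot\infty=0$. $\mathbb{K}$ is an arbitrary field with the discrete topology. A Hausdorff topological $\mathbb{K}$-vector space is linearly topologized if it has a neighborhood basis at $0$ consisting of linear subspaces. A linear variety is a coset $v+W$ of a linear subspace $W$; it is closed if $W$ is closed. A linearly topologized vector space is linearly compact if every collection of closed linear varieties with the finite intersection property has non-empty intersection. A topological $\mathbb{K}$-vector space $V$ is locally linearly compact if it has a neighborhood basis at $0$ consisting of linearly compact open linear subspaces; $\mathcal{B}(V)$ denotes the set of all linearly compact open linear subspaces of $V$. Closed linear subspaces and quotients by closed linear subspaces of locally linearly compact vector spaces are locally linearly compact. A continuous endomorphism is a continuous $\mathbb{K}$-linear map $V\to V$; a topological isomorphism is a linear homeomorphism. In (e), $V=\varprojlim V/W_i$ means that the canonical map from $V$ to the inverse limit (with the topology induced by the product of the quotient topologies) is a topological isomorphism. For a continuous endomorphism $\phi:V\to V$, $U\in\mathcal{B}(V)$ and $n\geq 1$, let $C_n(\phi,U)=U\cap\phi^{-1}U\cap\ldots\cap\phi^{-n+1}U$, $H^*(\phi,U)=\lim_{n\to\infty}\frac{1}{n}\dim\frac{U}{C_n(\phi,U)}$ (this limit exists), and $\mathrm{ent}^*(\phi)=\sup\{H^*(\phi,U)\mid U\in\mathcal{B}(V)\}\in\mathbb{N}\cup\{\infty\}$. *)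

theory Defs
  imports "HOL-Analysis.Analysis" "HOL-Algebra.AbelCoset" "Jordan_Normal_Form.Missing_VectorSpace"
begin

text \<open>
  Vector spaces over a field K are the HOL-Algebra modules over K of the AFP entry VectorSpace,
  extended by a topology on the carrier. As for all module records, the inherited ring fields
  mult and one carry no meaning. Maps between spaces are functions whose values
  off the carrier are irrelevant.
\<close>

record ('k, 'v) tvs = "('k, 'v) module" + topo :: "'v topology"

locale topological_vectorspace = vectorspace K V
  for K :: "'k ring" and V :: "('k, 'v) tvs" +
  assumes topspace_eq: "topspace (topo V) = carrier V"
    and continuous_add:
      "continuous_map (prod_topology (topo V) (topo V)) (topo V) (\<lambda>(x, y). x \<oplus>\<^bsub>V\<^esub> y)"
    and continuous_smult:
      "continuous_map (prod_topology (discrete_topology (carrier K)) (topo V)) (topo V)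
        (\<lambda>(a, x). a \<odot>\<^bsub>V\<^esub> x)"

definition zero_nhds :: "('k, 'v) tvs \<Rightarrow> 'v set set" where
  "zero_nhds V = {N. N \<subseteq> carrier V \<and> (\<exists>S. openin (topo V) S \<and> \<zero>\<^bsub>V\<^esub> \<in> S \<and> S \<subseteq> N)}"

definition has_zero_nhds_basis :: "('k, 'v) tvs \<Rightarrow> ('v set \<Rightarrow> bool) \<Rightarrow> bool" where
  "has_zero_nhds_basis V P \<longleftrightarrow> (\<forall>N \<in> zero_nhds V. \<exists>B \<in> zero_nhds V. P B \<and> B \<subseteq> N)"

definition linearly_topologized :: "'k ring \<Rightarrow> ('k, 'v) tvs \<Rightarrow> bool" where
  "linearly_topologized K V \<longleftrightarrow>
    topological_vectorspace K V \<and> Hausdorff_space (topo V) \<and>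
    has_zero_nhds_basis V (\<lambda>W. VectorSpace.subspace K W V)"

definition closed_linear_variety :: "'k ring \<Rightarrow> ('k, 'v) tvs \<Rightarrow> 'v set \<Rightarrow> bool" where
  "closed_linear_variety K V A \<longleftrightarrow>
    (\<exists>W. \<exists>v \<in> carrier V.
      VectorSpace.subspace K W V \<and> closedin (topo V) W \<and> A = W +>\<^bsub>V\<^esub> v)"

definition linearly_compact :: "'k ring \<Rightarrow> ('k, 'v) tvs \<Rightarrow> bool" where
  "linearly_compact K V \<longleftrightarrow>
    linearly_topologized K V \<and>
    (\<forall>\<F>. (\<forall>A \<in> \<F>. closed_linear_variety K V A) \<and>
         (\<forall>\<G> \<subseteq> \<F>. finite \<G> \<longrightarrow> \<Inter>\<G> \<noteq> {}) \<longrightarrow> \<Inter>\<F> \<noteq> {})"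

definition sub_tvs :: "('k, 'v) tvs \<Rightarrow> 'v set \<Rightarrow> ('k, 'v) tvs" where
  "sub_tvs V W = V\<lparr>carrier := W, topo := subtopology (topo V) W\<rparr>"

definition lc_open_subspaces :: "'k ring \<Rightarrow> ('k, 'v) tvs \<Rightarrow> 'v set set" where
  "lc_open_subspaces K V =
    {U. VectorSpace.subspace K U V \<and> openin (topo V) U \<and> linearly_compact K (sub_tvs V U)}"

definition locally_linearly_compact :: "'k ring \<Rightarrow> ('k, 'v) tvs \<Rightarrow> bool" where
  "locally_linearly_compact K V \<longleftrightarrow>
    topological_vectorspace K V \<and> has_zero_nhds_basis V (\<lambda>U. U \<in> lc_open_subspaces K V)"

definition continuous_linear ::
    "'k ring \<Rightarrow> ('k, 'v) tvs \<Rightarrow> ('k, 'w) tvs \<Rightarrow> ('v \<Rightarrow> 'w) \<Rightarrow> bool" where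
  "continuous_linear K V W f \<longleftrightarrow>
    f \<in> module_hom K V W \<and> continuous_map (topo V) (topo W) f"

definition topological_isomorphism ::
    "'k ring \<Rightarrow> ('k, 'v) tvs \<Rightarrow> ('k, 'w) tvs \<Rightarrow> ('v \<Rightarrow> 'w) \<Rightarrow> bool" where
  "topological_isomorphism K V W f \<longleftrightarrow>
    f \<in> module_hom K V W \<and> homeomorphic_map (topo V) (topo W) f"

text \<open>The final (coinduced) topology on the image of a map.\<close>

definition quotient_topology :: "'v topology \<Rightarrow> ('v \<Rightarrow> 'w) \<Rightarrow> 'w topology" where
  "quotient_topology X f =
    topology (\<lambda>S. S \<subseteq> f ` topspace X \<and> openin X {x \<in> topspace X. f x \<in> S})"

lemma openin_quotient_topology:
  "openin (quotient_topology X f) S \<longleftrightarrow>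
    S \<subseteq> f ` topspace X \<and> openin X {x \<in> topspace X. f x \<in> S}"
proof -
  have "istopology (\<lambda>S. S \<subseteq> f ` topspace X \<and> openin X {x \<in> topspace X. f x \<in> S})"
    unfolding istopology_def
  proof (intro conjI allI impI)
    fix S T
    assume S: "S \<subseteq> f ` topspace X \<and> openin X {x \<in> topspace X. f x \<in> S}"
      and T: "T \<subseteq> f ` topspace X \<and> openin X {x \<in> topspace X. f x \<in> T}"
    have "{x \<in> topspace X. f x \<in> S \<inter> T} =
        {x \<in> topspace X. f x \<in> S} \<inter> {x \<in> topspace X. f x \<in> T}" by auto
    then show "openin X {x \<in> topspace X. f x \<in> S \<inter> T}"
      using S T by (simp add: openin_Int)
    show "S \<inter> T \<subseteq> f ` topspace X" using S by auto
  next
    fix \<K>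
    assume *: "\<forall>S \<in> \<K>. S \<subseteq> f ` topspace X \<and> openin X {x \<in> topspace X. f x \<in> S}"
    have "{x \<in> topspace X. f x \<in> \<Union>\<K>} = (\<Union>S \<in> \<K>. {x \<in> topspace X. f x \<in> S})" by auto
    then show "openin X {x \<in> topspace X. f x \<in> \<Union>\<K>}"
      using * by auto
    show "\<Union>\<K> \<subseteq> f ` topspace X" using * by auto
  qed
  then show ?thesis
    by (simp add: quotient_topology_def)
qed

text \<open>
  The elements of the quotient are the cosets of W. In the scalar multiplication (as in the induced
  map below) W is added because the image of a coset v + W under scaling by 0
  (under a linear map) need not be a full coset.
\<close>

definition quot_tvs :: "('k, 'v) tvs \<Rightarrow> 'v set \<Rightarrow> ('k, 'v set) tvs" where
  "quot_tvs V W =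
    \<lparr>carrier = a_rcosets\<^bsub>V\<^esub> W,
     mult = (\<lambda>X Y. W), one = W,
     zero = W,
     add = (\<lambda>X Y. X <+>\<^bsub>V\<^esub> Y),
     smult = (\<lambda>a X. W <+>\<^bsub>V\<^esub> (\<lambda>x. a \<odot>\<^bsub>V\<^esub> x) ` X),
     topo = quotient_topology (topo V) (\<lambda>v. W +>\<^bsub>V\<^esub> v)\<rparr>"

definition induced_map :: "('k, 'v) tvs \<Rightarrow> 'v set \<Rightarrow> ('v \<Rightarrow> 'v) \<Rightarrow> 'v set \<Rightarrow> 'v set" where
  "induced_map V W \<phi> X = W <+>\<^bsub>V\<^esub> \<phi> ` X"

definition prod_tvs :: "('k, 'v) tvs \<Rightarrow> ('k, 'w) tvs \<Rightarrow> ('k, 'v \<times> 'w) tvs" where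
  "prod_tvs V1 V2 =
    module.extend (direct_sum V1 V2) (tvs.fields (prod_topology (topo V1) (topo V2)))"

text \<open>
  The inverse limit of the quotients of V by the subspaces W i. The transition map from
  V / W j to V / W i, for W j contained in W i, sends X to W i + X.
\<close>

definition inv_limit :: "('k, 'v) tvs \<Rightarrow> 'i set \<Rightarrow> ('i \<Rightarrow> 'v set) \<Rightarrow> ('k, 'i \<Rightarrow> 'v set) tvs" where
  "inv_limit V I W =
    (let L = {x \<in> (\<Pi>\<^sub>E i\<in>I. carrier (quot_tvs V (W i))).
               \<forall>i \<in> I. \<forall>j \<in> I. W j \<subseteq> W i \<longrightarrow> x i = W i <+>\<^bsub>V\<^esub> x j}
     in \<lparr>carrier = L,
         mult = (\<lambda>x y. restrict W I), one = restrict W I,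
         zero = (\<lambda>i\<in>I. \<zero>\<^bsub>quot_tvs V (W i)\<^esub>),
         add = (\<lambda>x y. \<lambda>i\<in>I. x i \<oplus>\<^bsub>quot_tvs V (W i)\<^esub> y i),
         smult = (\<lambda>a x. \<lambda>i\<in>I. a \<odot>\<^bsub>quot_tvs V (W i)\<^esub> x i),
         topo = subtopology (product_topology (\<lambda>i. topo (quot_tvs V (W i))) I) L\<rparr>)"

definition canonical_map :: "('k, 'v) tvs \<Rightarrow> 'i set \<Rightarrow> ('i \<Rightarrow> 'v set) \<Rightarrow> 'v \<Rightarrow> 'i \<Rightarrow> 'v set" where
  "canonical_map V I W v = (\<lambda>i\<in>I. W i +>\<^bsub>V\<^esub> v)"

definition cotrajectory :: "('v \<Rightarrow> 'v) \<Rightarrow> 'v set \<Rightarrow> nat \<Rightarrow> 'v set" where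
  "cotrajectory \<phi> U n = U \<inter> (\<Inter>k<n. (\<phi> ^^ k) -` U)"

text \<open>
  For U linearly compact and open, and the map a continuous endomorphism, the cotrajectory is an
  open subspace of U, so U modulo the cotrajectory is finite-dimensional and the dimension below is the
  genuine one; the limit exists in the reals.
\<close>

definition entropy_at :: "'k ring \<Rightarrow> ('k, 'v) tvs \<Rightarrow> ('v \<Rightarrow> 'v) \<Rightarrow> 'v set \<Rightarrow> real" where
  "entropy_at K V \<phi> U =
    lim (\<lambda>n. 1 / real n *
      real (vectorspace.dim K (quot_tvs (sub_tvs V U) (cotrajectory \<phi> U n))))"

definition entropy :: "'k ring \<Rightarrow> ('k, 'v) tvs \<Rightarrow> ('v \<Rightarrow> 'v) \<Rightarrow> ereal" where
  "entropy K V \<phi> = (SUP U \<in> lc_open_subspaces K V. ereal (entropy_at K V \<phi> U))"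

end

theory Submission
  imports Defs
begin

text \<open>The increments of \<open>dim U / C\<^sub>n\<close> decrease, since \<open>\<phi>\<close> embeds \<open>C\<^sub>n\<^sub>+\<^sub>1 / C\<^sub>n\<^sub>+\<^sub>2\<close> into
  \<open>C\<^sub>n / C\<^sub>n\<^sub>+\<^sub>1\<close>; so the entropy at \<open>U\<close> is their eventual value. An open subspace of a linearly compact
  space has finite codimension, hence shrinking \<open>U\<close> only increases the entropy at \<open>U\<close>, and the
  supremum may be taken over any cofinal family of small \<open>U\<close>. Each law then compares cotrajectories along a
  linear map intertwining two endomorphisms: restricting along a preimage or pushing to an image can only
  decrease the codimensions. The logarithmic law follows from \<open>C\<^sub>n(\<phi>\<^sup>k, C\<^sub>k(\<phi>, U)) = C\<^sub>k\<^sub>n(\<phi>, U)\<close>, the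
  addition formula from the linear compactness of \<open>U\<^sub>1 \<times> U\<^sub>2\<close>, and continuity on inverse limits from the fact
  that every \<open>U\<close> contains some \<open>W\<^sub>k\<close>.\<close>

section \<open>Subspaces and quotients\<close>

text \<open>\<phi> is injective on the quotients because an element of \<open>C (n + 1)\<close> that
  \<phi> maps into \<open>C (n + 1)\<close> already lies in \<open>C (n + 2)\<close>. Shrinking U'
  to U works because U' can be descended to \<open>C n\<close> of U in two ways, through U and
  through \<open>C n\<close> of U'. Comparing the two codimension counts,
  \<open>dim U' / C n\<close> exceeds the corresponding dimension for U by at most
  \<open>dim U' / U\<close>. This bound does not depend on n, so division by n removes it; the
  logarithmic law disposes of \<open>dim U / C k\<close> in the same way. Along an intertwining map
  f, a full preimage U of U' has as cotrajectories the full preimages of those of U', so quotients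
  inject. For an image U' = f U, the preimages of the cotrajectories of U' contain those of U, so
  quotients can only get smaller. The main topological obstacle is the product of two linearly
  compact spaces. A common point of a family of varieties is found one coordinate at a time; this
  needs the projections to be closed, which itself rests on the linear compactness of the factor
  projected away.\<close>

lemma subspaceI:
  assumes "vectorspace K V" "N \<subseteq> carrier V" "\<zero>\<^bsub>V\<^esub> \<in> N"
    and "\<And>v w. v \<in> N \<Longrightarrow> w \<in> N \<Longrightarrow> v \<oplus>\<^bsub>V\<^esub> w \<in> N"
    and "\<And>c v. c \<in> carrier K \<Longrightarrow> v \<in> N \<Longrightarrow> c \<odot>\<^bsub>V\<^esub> v \<in> N"
  shows "VectorSpace.subspace K N V"
  using assms by (auto simp: subspace_def submodule_def vectorspace_def)

lemma subspace_vectorspace: "VectorSpace.subspace K W V \<Longrightarrow> vectorspace K V"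
  by (simp add: subspace_def)

lemma subspace_subset: "VectorSpace.subspace K W V \<Longrightarrow> W \<subseteq> carrier V"
  by (simp add: subspace_def submodule_def)

lemma subspace_carrier: "VectorSpace.subspace K W V \<Longrightarrow> v \<in> W \<Longrightarrow> v \<in> carrier V"
  using subspace_subset by blast

lemma subspace_zero: "VectorSpace.subspace K W V \<Longrightarrow> \<zero>\<^bsub>V\<^esub> \<in> W"
  by (simp add: subspace_def submodule_def)

lemma subspace_add:
  "VectorSpace.subspace K W V \<Longrightarrow> v \<in> W \<Longrightarrow> w \<in> W \<Longrightarrow> v \<oplus>\<^bsub>V\<^esub> w \<in> W"
  by (simp add: subspace_def submodule_def)

lemma subspace_smult:
  "VectorSpace.subspace K W V \<Longrightarrow> c \<in> carrier K \<Longrightarrow> v \<in> W \<Longrightarrow> c \<odot>\<^bsub>V\<^esub> v \<in> W"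
  by (simp add: subspace_def submodule_def)

lemma subspace_neg:
  assumes "VectorSpace.subspace K W V" "v \<in> W"
  shows "\<ominus>\<^bsub>V\<^esub> v \<in> W"
proof -
  interpret vectorspace K V using assms(1) by (rule subspace_vectorspace)
  have "\<ominus>\<^bsub>V\<^esub> v = (\<ominus>\<^bsub>K\<^esub> \<one>\<^bsub>K\<^esub>) \<odot>\<^bsub>V\<^esub> v"
    using assms subspace_carrier by (metis smult_minus_1)
  then show ?thesis using assms by (simp add: subspace_smult)
qed

lemma subspace_minus:
  assumes "VectorSpace.subspace K W V" "v \<in> W" "w \<in> W"
  shows "v \<ominus>\<^bsub>V\<^esub> w \<in> W"
  using assms by (simp add: a_minus_def subspace_add subspace_neg)

lemma subspace_carrier_self: "vectorspace K V \<Longrightarrow> VectorSpace.subspace K (carrier V) V"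
proof -
  assume "vectorspace K V"
  then interpret vectorspace K V .
  show ?thesis by (rule subspaceI) (auto intro: vectorspace_axioms)
qed

lemma subspace_Int:
  assumes "VectorSpace.subspace K A V" "VectorSpace.subspace K B V"
  shows "VectorSpace.subspace K (A \<inter> B) V"
  using assms by (intro subspaceI)
    (auto intro: subspace_vectorspace subspace_zero subspace_add subspace_smult
      dest: subspace_carrier)

lemma subspace_abelian_subgroup:
  assumes "VectorSpace.subspace K W V" shows "abelian_subgroup W V"
proof -
  interpret vectorspace K V using assms by (rule subspace_vectorspace)
  have "subgroup W (add_monoid V)"
    using assms subspace_neg[OF assms]
    by unfold_locales (auto dest: subspace_subset subspace_add subspace_zero simp: a_inv_def)
  then have "additive_subgroup W V" by (simp add: additive_subgroup_def)
  then show ?thesis by (rule abelian_subgroupI3) (rule abelian_group_axioms)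
qed

lemma mem_coset: "y \<in> W +>\<^bsub>V\<^esub> x \<longleftrightarrow> (\<exists>w\<in>W. y = w \<oplus>\<^bsub>V\<^esub> x)"
  by (simp add: a_r_coset_def')

lemma mem_set_add: "y \<in> A <+>\<^bsub>V\<^esub> B \<longleftrightarrow> (\<exists>a\<in>A. \<exists>b\<in>B. y = a \<oplus>\<^bsub>V\<^esub> b)"
  by (simp add: set_add_def')

context
  fixes K :: "('k, 'm) ring_scheme" and V :: "('k, 'v, 'n) module_scheme" and W
  assumes W: "VectorSpace.subspace K W V"
begin

interpretation vectorspace K V using W by (rule subspace_vectorspace)
interpretation W: abelian_subgroup W V using W by (rule subspace_abelian_subgroup)

lemma mem_coset_iff:
  assumes "x \<in> carrier V" "y \<in> carrier V"
  shows "y \<in> W +>\<^bsub>V\<^esub> x \<longleftrightarrow> y \<ominus>\<^bsub>V\<^esub> x \<in> W"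
  using W.a_rcos_module[OF assms] by (simp add: a_minus_def)

lemma coset_subset: "x \<in> carrier V \<Longrightarrow> W +>\<^bsub>V\<^esub> x \<subseteq> carrier V"
  using W.a_elemrcos_carrier by blast

lemma coset_self: "x \<in> carrier V \<Longrightarrow> x \<in> W +>\<^bsub>V\<^esub> x"
  by (rule W.a_rcos_self)

lemma coset_eq_iff:
  assumes "x \<in> carrier V" "y \<in> carrier V"
  shows "W +>\<^bsub>V\<^esub> x = W +>\<^bsub>V\<^esub> y \<longleftrightarrow> x \<ominus>\<^bsub>V\<^esub> y \<in> W"
  using assms mem_coset_iff coset_self W.a_repr_independence' by metis

lemma coset_eq_self_iff: "x \<in> carrier V \<Longrightarrow> W +>\<^bsub>V\<^esub> x = W \<longleftrightarrow> x \<in> W"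
  using W.a_rcos_const coset_self by blast

text \<open>The common computation behind scalar multiplication in a quotient, the induced
  endomorphism, and every comparison map between quotients: \<open>f\<close> may map a coset to only
  a part of a coset, and adding \<open>W'\<close> fills it up.\<close>

lemma coset_image:
  assumes f: "f \<in> module_hom K V V'" and W': "VectorSpace.subspace K W' V'"
    and sub: "f ` W \<subseteq> W'" and x: "x \<in> carrier V"
  shows "W' <+>\<^bsub>V'\<^esub> f ` (W +>\<^bsub>V\<^esub> x) = W' +>\<^bsub>V'\<^esub> f x"
proof -
  interpret V': vectorspace K V' using W' by (rule subspace_vectorspace)
  have fx: "f x \<in> carrier V'" using f x by (auto simp: module_hom_def)
  have fw: "f w \<in> W'" "f w \<in> carrier V'" "f (w \<oplus>\<^bsub>V\<^esub> x) = f w \<oplus>\<^bsub>V'\<^esub> f x" if "w \<in> W" for w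
    using that sub subspace_carrier[OF W'] subspace_carrier[OF W] x module_hom_add[OF f] by blast+
  show ?thesis
  proof (intro equalityI subsetI)
    fix y assume "y \<in> W' <+>\<^bsub>V'\<^esub> f ` (W +>\<^bsub>V\<^esub> x)"
    then obtain w' w where w: "w' \<in> W'" "w \<in> W" "y = w' \<oplus>\<^bsub>V'\<^esub> f (w \<oplus>\<^bsub>V\<^esub> x)"
      by (auto simp: mem_set_add mem_coset)
    then have "y = (w' \<oplus>\<^bsub>V'\<^esub> f w) \<oplus>\<^bsub>V'\<^esub> f x"
      using fw fx subspace_carrier[OF W'] by (simp add: V'.M.a_assoc)
    then show "y \<in> W' +>\<^bsub>V'\<^esub> f x"
      using w fw by (auto simp: mem_coset intro!: bexI subspace_add[OF W'])
  next
    fix y assume "y \<in> W' +>\<^bsub>V'\<^esub> f x"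
    then obtain w' where "w' \<in> W'" "y = w' \<oplus>\<^bsub>V'\<^esub> f x" by (auto simp: mem_coset)
    then show "y \<in> W' <+>\<^bsub>V'\<^esub> f ` (W +>\<^bsub>V\<^esub> x)"
      unfolding mem_set_add using coset_self[OF x] by blast
  qed
qed

text \<open>Scaling by a fixed scalar is a linear endomorphism, because the field is commutative, so
  this is an instance of \<open>coset_image\<close>.\<close>

lemma coset_smult:
  assumes "a \<in> carrier K" "x \<in> carrier V"
  shows "W <+>\<^bsub>V\<^esub> (\<lambda>x. a \<odot>\<^bsub>V\<^esub> x) ` (W +>\<^bsub>V\<^esub> x) = W +>\<^bsub>V\<^esub> (a \<odot>\<^bsub>V\<^esub> x)"
proof (rule coset_image)
  have "a \<odot>\<^bsub>V\<^esub> (r \<odot>\<^bsub>V\<^esub> m) = r \<odot>\<^bsub>V\<^esub> (a \<odot>\<^bsub>V\<^esub> m)" if "r \<in> carrier K" "m \<in> carrier V" for r m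
    using that assms by (simp add: smult_assoc1[symmetric] m_comm)
  then show "(\<lambda>x. a \<odot>\<^bsub>V\<^esub> x) \<in> module_hom K V V"
    using assms by (auto simp: module_hom_def smult_r_distr)
qed (use W assms subspace_smult in auto)

lemma coset_add:
  assumes "x \<in> carrier V" "y \<in> carrier V"
  shows "(W +>\<^bsub>V\<^esub> x) <+>\<^bsub>V\<^esub> (W +>\<^bsub>V\<^esub> y) = W +>\<^bsub>V\<^esub> (x \<oplus>\<^bsub>V\<^esub> y)"
  using assms by (rule W.a_rcos_sum)

end

lemma carrier_quot_tvs: "carrier (quot_tvs V W) = (\<lambda>x. W +>\<^bsub>V\<^esub> x) ` carrier V"
  by (auto simp: quot_tvs_def A_RCOSETS_def')

lemma quot_tvs_simps:
  "\<zero>\<^bsub>quot_tvs V W\<^esub> = W" "X \<oplus>\<^bsub>quot_tvs V W\<^esub> Y = X <+>\<^bsub>V\<^esub> Y"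
  "a \<odot>\<^bsub>quot_tvs V W\<^esub> X = W <+>\<^bsub>V\<^esub> (\<lambda>x. a \<odot>\<^bsub>V\<^esub> x) ` X"
  "topo (quot_tvs V W) = quotient_topology (topo V) (\<lambda>v. W +>\<^bsub>V\<^esub> v)"
  by (simp_all add: quot_tvs_def)

lemma sub_tvs_simps [simp]:
  "carrier (sub_tvs V W) = W" "\<zero>\<^bsub>sub_tvs V W\<^esub> = \<zero>\<^bsub>V\<^esub>"
  "x \<oplus>\<^bsub>sub_tvs V W\<^esub> y = x \<oplus>\<^bsub>V\<^esub> y" "a \<odot>\<^bsub>sub_tvs V W\<^esub> x = a \<odot>\<^bsub>V\<^esub> x"
  "topo (sub_tvs V W) = subtopology (topo V) W"
  "B +>\<^bsub>sub_tvs V W\<^esub> v = B +>\<^bsub>V\<^esub> v" "B <+>\<^bsub>sub_tvs V W\<^esub> C = B <+>\<^bsub>V\<^esub> C"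
  by (simp_all add: sub_tvs_def a_r_coset_def' set_add_def')

lemma quot_tvs_vectorspace:
  assumes W: "VectorSpace.subspace K W V"
  shows "vectorspace K (quot_tvs V W)"
proof -
  interpret vectorspace K V using W by (rule subspace_vectorspace)
  \<comment> \<open>With the zero of the quotient written as a coset too, every vector space axiom
    reduces to the same axiom for representatives.\<close>
  have z: "W +>\<^bsub>V\<^esub> \<zero>\<^bsub>V\<^esub> = W" using coset_eq_self_iff[OF W] subspace_zero[OF W] by simp
  note [simp] = coset_add[OF W] coset_smult[OF W]
  have sm: "a \<odot>\<^bsub>quot_tvs V W\<^esub> (W +>\<^bsub>V\<^esub> x) = W +>\<^bsub>V\<^esub> (a \<odot>\<^bsub>V\<^esub> x)"
    if "a \<in> carrier K" "x \<in> carrier V" for a x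
    using that by (simp add: quot_tvs_simps)
  have ad: "(W +>\<^bsub>V\<^esub> x) \<oplus>\<^bsub>quot_tvs V W\<^esub> (W +>\<^bsub>V\<^esub> y) = W +>\<^bsub>V\<^esub> (x \<oplus>\<^bsub>V\<^esub> y)"
    if "x \<in> carrier V" "y \<in> carrier V" for x y
    using that by (simp add: quot_tvs_simps)
  have ze: "\<zero>\<^bsub>quot_tvs V W\<^esub> = W +>\<^bsub>V\<^esub> \<zero>\<^bsub>V\<^esub>" using z by (simp add: quot_tvs_simps)
  show ?thesis
  proof (rule vs_criteria)
    show "field K" ..
    show "\<forall>v\<in>carrier (quot_tvs V W). \<exists>neg_v\<in>carrier (quot_tvs V W). v \<oplus>\<^bsub>quot_tvs V W\<^esub> neg_v = \<zero>\<^bsub>quot_tvs V W\<^esub>"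
    proof
      fix v assume "v \<in> carrier (quot_tvs V W)"
      then obtain x where x: "x \<in> carrier V" "v = W +>\<^bsub>V\<^esub> x" by (auto simp: carrier_quot_tvs)
      then show "\<exists>neg_v\<in>carrier (quot_tvs V W). v \<oplus>\<^bsub>quot_tvs V W\<^esub> neg_v = \<zero>\<^bsub>quot_tvs V W\<^esub>"
        by (intro bexI[of _ "W +>\<^bsub>V\<^esub> (\<ominus>\<^bsub>V\<^esub> x)"]) (auto simp: ad ze M.r_neg carrier_quot_tvs)
    qed
  qed (auto simp: carrier_quot_tvs ze ad sm M.a_ac smult_l_distr smult_r_distr smult_assoc1)
qed

lemma quot_tvs_hom:
  assumes "VectorSpace.subspace K W V"
  shows "(\<lambda>v. W +>\<^bsub>V\<^esub> v) \<in> module_hom K V (quot_tvs V W)"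
  using coset_add[OF assms] coset_smult[OF assms]
  by (auto simp: module_hom_def carrier_quot_tvs quot_tvs_simps)

lemma sub_tvs_vectorspace:
  assumes W: "VectorSpace.subspace K W V"
  shows "vectorspace K (sub_tvs V W)"
proof -
  interpret vectorspace K V using W by (rule subspace_vectorspace)
  show ?thesis
  proof (rule vs_criteria)
    show "field K" ..
    show "\<forall>v\<in>carrier (sub_tvs V W). \<exists>neg_v\<in>carrier (sub_tvs V W). v \<oplus>\<^bsub>sub_tvs V W\<^esub> neg_v = \<zero>\<^bsub>sub_tvs V W\<^esub>"
      using subspace_neg[OF W] subspace_carrier[OF W] by (auto intro!: bexI M.r_neg)
  qed (use subspace_carrier[OF W] in \<open>auto simp: subspace_zero[OF W] subspace_add[OF W] subspace_smult[OF W]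
      M.a_ac smult_l_distr smult_r_distr smult_assoc1\<close>)
qed

lemma subspace_sub_tvs_iff:
  assumes "VectorSpace.subspace K U V"
  shows "VectorSpace.subspace K N (sub_tvs V U) \<longleftrightarrow> VectorSpace.subspace K N V \<and> N \<subseteq> U"
  using assms sub_tvs_vectorspace[OF assms] subspace_subset[OF assms] subspace_vectorspace[OF assms]
  by (auto simp: subspace_def submodule_def vectorspace_def)

lemma subspace_image:
  assumes f: "f \<in> module_hom K V W" and "vectorspace K W" and A: "VectorSpace.subspace K A V"
  shows "VectorSpace.subspace K (f ` A) W"
proof (rule subspaceI)
  interpret V: vectorspace K V using A by (rule subspace_vectorspace)
  interpret W: vectorspace K W by fact
  interpret f: mod_hom K V W f using f by unfold_locales
  show "f ` A \<subseteq> carrier W" using subspace_carrier[OF A] by auto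
  show "\<zero>\<^bsub>W\<^esub> \<in> f ` A" using subspace_zero[OF A] f.f0_is_0 by (metis imageI)
  show "v \<oplus>\<^bsub>W\<^esub> w \<in> f ` A" if "v \<in> f ` A" "w \<in> f ` A" for v w
  proof -
    from that obtain a b where ab: "a \<in> A" "b \<in> A" "v = f a" "w = f b" by blast
    then have "v \<oplus>\<^bsub>W\<^esub> w = f (a \<oplus>\<^bsub>V\<^esub> b)" using subspace_carrier[OF A] by auto
    then show ?thesis using ab subspace_add[OF A] by auto
  qed
  show "c \<odot>\<^bsub>W\<^esub> v \<in> f ` A" if "c \<in> carrier K" "v \<in> f ` A" for c v
  proof -
    from that obtain a where a: "a \<in> A" "v = f a" by blast
    then have "c \<odot>\<^bsub>W\<^esub> v = f (c \<odot>\<^bsub>V\<^esub> a)" using subspace_carrier[OF A] that by auto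
    then show ?thesis using a subspace_smult[OF A] that by auto
  qed
qed (fact assms)

text \<open>Cutting down to a subspace \<open>A\<close> gives the two shapes in which preimages
  occur: one step in the recursion of cotrajectories, and the subspace divided out of
  \<open>A\<close> when codimensions are compared.\<close>

lemma subspace_preimage:
  assumes f: "f \<in> module_hom K V W" and A: "VectorSpace.subspace K A V"
    and B: "VectorSpace.subspace K B W"
  shows "VectorSpace.subspace K {x \<in> A. f x \<in> B} V"
proof (rule subspaceI)
  show "vectorspace K V" using A by (rule subspace_vectorspace)
  then interpret V: vectorspace K V .
  interpret W: vectorspace K W using B by (rule subspace_vectorspace)
  interpret f: mod_hom K V W f using f by unfold_locales
  show "{x \<in> A. f x \<in> B} \<subseteq> carrier V" using subspace_carrier[OF A] by auto
  show "\<zero>\<^bsub>V\<^esub> \<in> {x \<in> A. f x \<in> B}" by (auto simp: subspace_zero[OF A] subspace_zero[OF B])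
qed (use subspace_carrier[OF A] in \<open>auto simp: subspace_add[OF A] subspace_add[OF B]
      subspace_smult[OF A] subspace_smult[OF B] module_hom_add[OF f] module_hom_smult[OF f]\<close>)

section \<open>Finite codimension\<close>

lemma linear_mapI:
  "vectorspace K X \<Longrightarrow> vectorspace K Y \<Longrightarrow> f \<in> module_hom K X Y \<Longrightarrow> linear_map K X Y f"
  by (simp add: linear_map_def mod_hom_def mod_hom_axioms_def vectorspace_def)

text \<open>Independence means the same in the subspace as in the whole space, so independent
  subsets of \<open>W\<close> have at most \<open>dim\<close> elements. A maximal one therefore
  exists, and it is a basis of \<open>W\<close>.\<close>

lemma (in vectorspace) subspace_fin_dim:
  assumes fd: "fin_dim" and W: "VectorSpace.subspace K W V"
  shows "vectorspace.fin_dim K (vs W)" "vectorspace.dim K (vs W) \<le> dim"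
proof -
  interpret S: vectorspace K "vs W" using W by (rule subspace_is_vs)
  have sm: "submodule K W V" using W by simp
  have li: "S.lin_dep A \<longleftrightarrow> lin_dep A" if "A \<subseteq> W" for A
    using span_li_not_depend(2)[OF that sm] by simp
  have "\<exists>A. finite A \<and> maximal A (\<lambda>A. A \<subseteq> carrier (vs W) \<and> S.lin_indpt A)"
  proof (rule maximal_exists[where N = "dim"])
    fix A assume "A \<subseteq> carrier (vs W) \<and> S.lin_indpt A"
    then show "finite A \<and> card A \<le> dim"
      using li[of A] li_le_dim[OF fd, of A] subspace_subset[OF W] by auto
  next
    show "{} \<subseteq> carrier (vs W) \<and> S.lin_indpt {}" by (simp add: S.lin_dep_def)
  qed
  then obtain A where A: "finite A" "maximal A (\<lambda>A. A \<subseteq> carrier (vs W) \<and> S.lin_indpt A)" by blast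
  then have b: "S.basis A" by (intro S.max_li_is_basis)
  then show "S.fin_dim" using A by (auto simp: S.fin_dim_def S.basis_def)
  have "S.dim = card A" using A b by (simp add: S.dim_basis)
  also have "\<dots> \<le> dim"
    using b li[of A] li_le_dim[OF fd, of A] subspace_subset[OF W] by (auto simp: S.basis_def)
  finally show "S.dim \<le> dim" .
qed

lemma linear_surj_dim:
  assumes "vectorspace K X" "vectorspace K Y" "f \<in> module_hom K X Y"
    and "vectorspace.fin_dim K X" "f ` carrier X = carrier Y"
  shows "vectorspace.fin_dim K Y"
    and "inj_on f (carrier X) \<Longrightarrow> vectorspace.dim K Y = vectorspace.dim K X"
proof -
  interpret linear_map K X Y f using assms by (intro linear_mapI)
  show "vectorspace.fin_dim K Y" using assms by (intro surj_fin_dim)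
  show "vectorspace.dim K Y = vectorspace.dim K X" if "inj_on f (carrier X)"
    using assms that by (intro dim_eq[symmetric])
qed

text \<open>The image is a subspace of a finite-dimensional space, and the inverse \<open>g\<close>
  of \<open>f\<close> on it is a linear bijection back onto the source.\<close>

lemma linear_inj_dim:
  assumes X: "vectorspace K X" and Y: "vectorspace K Y" and f: "f \<in> module_hom K X Y"
    and fd: "vectorspace.fin_dim K Y" and inj: "inj_on f (carrier X)"
  shows "vectorspace.fin_dim K X" "vectorspace.dim K X \<le> vectorspace.dim K Y"
proof -
  interpret linear_map K X Y f using assms by (intro linear_mapI)
  have sub: "VectorSpace.subspace K (f ` carrier X) Y"
    using f Y subspace_carrier_self[OF X] by (rule subspace_image)
  interpret S: vectorspace K "W.vs (f ` carrier X)" using sub by (rule W.subspace_is_vs)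
  note S = W.subspace_fin_dim[OF fd sub]
  define g where "g = inv_into (carrier X) f"
  have g: "g (f x) = x" if "x \<in> carrier X" for x using that inj by (simp add: g_def)
  have gh: "g \<in> module_hom K (W.vs (f ` carrier X)) X"
  proof -
    have "g (f a \<oplus>\<^bsub>Y\<^esub> f b) = g (f a) \<oplus>\<^bsub>X\<^esub> g (f b)" if "a \<in> carrier X" "b \<in> carrier X" for a b
      using that g[of "a \<oplus>\<^bsub>X\<^esub> b"] g by simp
    moreover have "g (c \<odot>\<^bsub>Y\<^esub> f a) = c \<odot>\<^bsub>X\<^esub> g (f a)" if "c \<in> carrier K" "a \<in> carrier X" for c a
      using that g[of "c \<odot>\<^bsub>X\<^esub> a"] g by simp
    ultimately show ?thesis using g by (auto simp: module_hom_def)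
  qed
  have gi: "g ` carrier (W.vs (f ` carrier X)) = carrier X" using g by force
  have gj: "inj_on g (carrier (W.vs (f ` carrier X)))" using g by (auto intro!: inj_onI)
  note * = linear_surj_dim[OF S.vectorspace_axioms X gh S(1) gi]
  show "vectorspace.fin_dim K X" by (rule *)
  show "vectorspace.dim K X \<le> vectorspace.dim K Y" using *(2)[OF gj] S(2) by simp
qed

section \<open>Codimensions of nested subspaces\<close>

definition fin_codim :: "('k, 'm) ring_scheme \<Rightarrow> ('k, 'v) tvs \<Rightarrow> 'v set \<Rightarrow> 'v set \<Rightarrow> bool" where
  "fin_codim K V A B \<longleftrightarrow> vectorspace.fin_dim K (quot_tvs (sub_tvs V A) B)"

text \<open>Unfolds to exactly the dimension inside \<open>entropy_at\<close>. It is a genuine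
  dimension when \<open>fin_codim\<close> holds, which is why the two notions travel
  together.\<close>

definition codim :: "('k, 'm) ring_scheme \<Rightarrow> ('k, 'v) tvs \<Rightarrow> 'v set \<Rightarrow> 'v set \<Rightarrow> nat" where
  "codim K V A B = vectorspace.dim K (quot_tvs (sub_tvs V A) B)"


text \<open>The formula for the map agrees with \<open>induced_map\<close>, so the lemma serves both
  for comparing dimensions and for the linearity of the induced endomorphism.\<close>

lemma quot_map_hom:
  assumes f: "f \<in> module_hom K V V'" and W: "VectorSpace.subspace K W V"
    and W': "VectorSpace.subspace K W' V'" and sub: "f ` W \<subseteq> W'"
  shows "(\<lambda>Z. W' <+>\<^bsub>V'\<^esub> f ` Z) \<in> module_hom K (quot_tvs V W) (quot_tvs V' W')"
proof -
  interpret V: vectorspace K V using W by (rule subspace_vectorspace)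
  interpret V': vectorspace K V' using W' by (rule subspace_vectorspace)
  interpret f: mod_hom K V V' f using f by unfold_locales
  note im = coset_image[OF W f W' sub]
  note h = quot_tvs_hom[OF W] note h' = quot_tvs_hom[OF W']
  show ?thesis
    unfolding module_hom_def
  proof (intro CollectI conjI allI impI Pi_I; (elim conjE)?)
    fix Z assume "Z \<in> carrier (quot_tvs V W)"
    then show "W' <+>\<^bsub>V'\<^esub> f ` Z \<in> carrier (quot_tvs V' W')"
      by (auto simp: carrier_quot_tvs im)
  next
    fix Z1 Z2 assume "Z1 \<in> carrier (quot_tvs V W)" "Z2 \<in> carrier (quot_tvs V W)"
    then obtain x y where "x \<in> carrier V" "y \<in> carrier V" "Z1 = W +>\<^bsub>V\<^esub> x" "Z2 = W +>\<^bsub>V\<^esub> y"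
      by (auto simp: carrier_quot_tvs)
    then show "W' <+>\<^bsub>V'\<^esub> f ` (Z1 \<oplus>\<^bsub>quot_tvs V W\<^esub> Z2) =
        (W' <+>\<^bsub>V'\<^esub> f ` Z1) \<oplus>\<^bsub>quot_tvs V' W'\<^esub> (W' <+>\<^bsub>V'\<^esub> f ` Z2)"
      using im by (simp flip: module_hom_add[OF h] module_hom_add[OF h'])
  next
    fix r Z assume r: "r \<in> carrier K" and "Z \<in> carrier (quot_tvs V W)"
    then obtain x where "x \<in> carrier V" "Z = W +>\<^bsub>V\<^esub> x"
      by (auto simp: carrier_quot_tvs)
    then show "W' <+>\<^bsub>V'\<^esub> f ` (r \<odot>\<^bsub>quot_tvs V W\<^esub> Z) = r \<odot>\<^bsub>quot_tvs V' W'\<^esub> (W' <+>\<^bsub>V'\<^esub> f ` Z)"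
      using im r by (simp flip: module_hom_smult[OF h] module_hom_smult[OF h'])
  qed
qed

lemma module_hom_sub_tvs:
  assumes "f \<in> module_hom K V V'" "VectorSpace.subspace K A V" "f ` A \<subseteq> A'"
  shows "f \<in> module_hom K (sub_tvs V A) (sub_tvs V' A')"
  using assms subspace_carrier[OF assms(2)] by (auto simp: module_hom_def)

context
  fixes K :: "('k, 'm) ring_scheme" and V :: "('k, 'v) tvs" and V' :: "('k, 'w) tvs" and f A B A' B'
  assumes f: "f \<in> module_hom K V V'" and A: "VectorSpace.subspace K A V"
    and A': "VectorSpace.subspace K A' V'" and B': "VectorSpace.subspace K B' V'" and BA': "B' \<subseteq> A'"
    and fA: "f ` A \<subseteq> A'" and B: "B = {x \<in> A. f x \<in> B'}" and fin: "fin_codim K V' A' B'"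
begin

text \<open>As \<open>B\<close> is the whole preimage of \<open>B'\<close> in \<open>A\<close>, a
  coset sent to zero is zero: \<open>f\<close> embeds the quotient of \<open>A\<close> by
  \<open>B\<close> into that of \<open>A'\<close> by \<open>B'\<close>.\<close>

lemma codim_map_aux:
  defines "T \<equiv> \<lambda>Z. B' <+>\<^bsub>V'\<^esub> f ` Z"
  shows "T \<in> module_hom K (quot_tvs (sub_tvs V A) B) (quot_tvs (sub_tvs V' A') B')"
    and "inj_on T (carrier (quot_tvs (sub_tvs V A) B))"
    and "\<And>x. x \<in> A \<Longrightarrow> T (B +>\<^bsub>V\<^esub> x) = B' +>\<^bsub>V'\<^esub> f x"
    and "vectorspace K (quot_tvs (sub_tvs V A) B)" "vectorspace K (quot_tvs (sub_tvs V' A') B')"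
proof -
  interpret V: vectorspace K V using A by (rule subspace_vectorspace)
  interpret V': vectorspace K V' using A' by (rule subspace_vectorspace)
  interpret f: mod_hom K V V' f using f by unfold_locales
  have sB: "VectorSpace.subspace K B (sub_tvs V A)"
    using subspace_preimage[OF f A B'] A B by (simp add: subspace_sub_tvs_iff)
  have sB': "VectorSpace.subspace K B' (sub_tvs V' A')"
    using A' B' BA' by (simp add: subspace_sub_tvs_iff)
  have fs: "f \<in> module_hom K (sub_tvs V A) (sub_tvs V' A')"
    using f A fA by (rule module_hom_sub_tvs)
  have sub: "f ` B \<subseteq> B'" using B by auto
  show "T \<in> module_hom K (quot_tvs (sub_tvs V A) B) (quot_tvs (sub_tvs V' A') B')"
    using quot_map_hom[OF fs sB sB' sub] by (simp add: T_def)
  show im: "T (B +>\<^bsub>V\<^esub> x) = B' +>\<^bsub>V'\<^esub> f x" if "x \<in> A" for x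
    using coset_image[OF sB fs sB' sub, of x] that by (simp add: T_def)
  show "inj_on T (carrier (quot_tvs (sub_tvs V A) B))"
  proof (rule inj_onI)
    fix Z1 Z2 assume "Z1 \<in> carrier (quot_tvs (sub_tvs V A) B)" "Z2 \<in> carrier (quot_tvs (sub_tvs V A) B)"
    then obtain x y where xy: "x \<in> A" "y \<in> A" "Z1 = B +>\<^bsub>V\<^esub> x" "Z2 = B +>\<^bsub>V\<^esub> y"
      by (auto simp: carrier_quot_tvs)
    have xy': "x \<in> carrier V" "y \<in> carrier V" using xy subspace_carrier[OF A] by auto
    assume "T Z1 = T Z2"
    then have "B' +>\<^bsub>V'\<^esub> f x = B' +>\<^bsub>V'\<^esub> f y" using xy im by simp
    then have "f x \<ominus>\<^bsub>V'\<^esub> f y \<in> B'" using coset_eq_iff[OF B'] xy' by simp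
    then have "f (x \<ominus>\<^bsub>V\<^esub> y) \<in> B'" using xy' by simp
    then have "x \<ominus>\<^bsub>V\<^esub> y \<in> B" using B subspace_minus[OF A] xy by simp
    then show "Z1 = Z2" using coset_eq_iff[of K B V x y] subspace_preimage[OF f A B'] B xy xy' by simp
  qed
  show "vectorspace K (quot_tvs (sub_tvs V A) B)" using sB by (rule quot_tvs_vectorspace)
  show "vectorspace K (quot_tvs (sub_tvs V' A') B')" using sB' by (rule quot_tvs_vectorspace)
qed

lemma fin_codim_map: "fin_codim K V A B"
  and codim_map_le: "codim K V A B \<le> codim K V' A' B'"
  using linear_inj_dim[OF codim_map_aux(4,5,1) _ codim_map_aux(2)] fin
  by (auto simp: fin_codim_def codim_def)

text \<open>Reaching every element of \<open>A'\<close> up to an error in \<open>B'\<close> makes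
  the embedding of quotients onto.\<close>

lemma codim_map_eq:
  assumes surj: "\<And>y. y \<in> A' \<Longrightarrow> \<exists>x\<in>A. y \<ominus>\<^bsub>V'\<^esub> f x \<in> B'"
  shows "codim K V A B = codim K V' A' B'"
proof -
  let ?T = "\<lambda>Z. B' <+>\<^bsub>V'\<^esub> f ` Z"
  have "?T ` carrier (quot_tvs (sub_tvs V A) B) = carrier (quot_tvs (sub_tvs V' A') B')" (is "?L = ?R")
  proof
    show "?L \<subseteq> ?R" using codim_map_aux(1) by (auto simp: module_hom_def)
    show "?R \<subseteq> ?L"
    proof
      fix Z assume "Z \<in> ?R"
      then obtain y where y: "y \<in> A'" "Z = B' +>\<^bsub>V'\<^esub> y" by (auto simp: carrier_quot_tvs)
      then obtain x where x: "x \<in> A" "y \<ominus>\<^bsub>V'\<^esub> f x \<in> B'" using surj by blast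
      have "Z = B' +>\<^bsub>V'\<^esub> f x"
        using x y coset_eq_iff[OF B'] subspace_carrier[OF A'] fA by blast
      also have "\<dots> = ?T (B +>\<^bsub>V\<^esub> x)" using codim_map_aux(3) x by simp
      finally show "Z \<in> ?L" using x by (auto simp: carrier_quot_tvs)
    qed
  qed
  then show ?thesis
    using linear_surj_dim(2)[OF codim_map_aux(4,5,1) _ _ codim_map_aux(2)] fin_codim_map
    by (auto simp: fin_codim_def codim_def)
qed

end

context
  fixes K :: "('k, 'm) ring_scheme" and V :: "('k, 'v) tvs" and A B C
  assumes A: "VectorSpace.subspace K A V" and B: "VectorSpace.subspace K B V"
    and C: "VectorSpace.subspace K C V" and CB: "C \<subseteq> B" and BA: "B \<subseteq> A"
    and fin: "fin_codim K V A C"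
begin

interpretation V: vectorspace K V using A by (rule subspace_vectorspace)

lemma fin_codim_lower: "fin_codim K V B C"
  by (rule fin_codim_map[of id K V V B A C])
    (use A B C CB BA fin in \<open>auto simp: module_hom_def\<close>)

text \<open>Rank-nullity for the projection from \<open>A\<close> modulo \<open>C\<close> onto
  \<open>A\<close> modulo \<open>B\<close>, whose kernel is \<open>B\<close> modulo
  \<open>C\<close>.\<close>

lemma codim_add: "codim K V A C = codim K V A B + codim K V B C"
proof -
  have sB: "VectorSpace.subspace K B (sub_tvs V A)" and sC: "VectorSpace.subspace K C (sub_tvs V A)"
    and sC': "VectorSpace.subspace K C (sub_tvs V B)"
    using A B C CB BA by (auto simp: subspace_sub_tvs_iff)
  let ?X = "quot_tvs (sub_tvs V A) C" and ?Y = "quot_tvs (sub_tvs V A) B"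
    and ?Z = "quot_tvs (sub_tvs V B) C"
  have X: "vectorspace K ?X" using sC by (rule quot_tvs_vectorspace)
  have Y: "vectorspace K ?Y" using sB by (rule quot_tvs_vectorspace)
  have Z: "vectorspace K ?Z" using sC' by (rule quot_tvs_vectorspace)
  define T where "T = (\<lambda>Z. B <+>\<^bsub>V\<^esub> id ` Z)"
  have id: "id \<in> module_hom K (sub_tvs V A) (sub_tvs V A)" by (auto simp: module_hom_def subspace_add[OF A] subspace_smult[OF A])
  have sub: "id ` C \<subseteq> B" using CB by simp
  have T: "T \<in> module_hom K ?X ?Y"
    using quot_map_hom[OF id sC sB sub] by (simp add: T_def)
  have im: "T (C +>\<^bsub>V\<^esub> x) = B +>\<^bsub>V\<^esub> x" if "x \<in> A" for x
    using coset_image[OF sC id sB sub, of x] that by (simp add: T_def)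
  have surj: "T ` carrier ?X = carrier ?Y" using im by (force simp: carrier_quot_tvs)
  interpret T: linear_map K ?X ?Y T using X Y T by (rule linear_mapI)
  have fX: "vectorspace.fin_dim K ?X" using fin by (simp add: fin_codim_def)
  have ker: "T.ker = carrier ?Z"
  proof -
    have "T (C +>\<^bsub>V\<^esub> x) = B \<longleftrightarrow> x \<in> B" if "x \<in> A" for x
      using im[OF that] coset_eq_self_iff[OF B] that subspace_carrier[OF A] by simp
    then show ?thesis
      unfolding T.ker_def using BA by (auto simp: carrier_quot_tvs quot_tvs_simps)
  qed
  \<comment> \<open>The two spaces have the same vectors and linear operations, but as records they
    may differ in the topology field; the identity serves as an isomorphism.\<close>
  have "vectorspace.dim K (T.V.vs T.ker) = vectorspace.dim K ?Z"
  proof (rule linear_surj_dim(2)[of K ?Z _ id])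
    show "vectorspace.fin_dim K ?Z" using fin_codim_lower by (simp add: fin_codim_def)
    show "vectorspace K (T.V.vs T.ker)" using T.kerT_is_subspace by (rule T.V.subspace_is_vs)
    show "id \<in> module_hom K ?Z (T.V.vs T.ker)"
      by (auto simp: module_hom_def ker quot_tvs_simps)
  qed (use Z ker in auto)
  moreover have "T.im = carrier ?Y" using surj by (rule T.surj_imp_imT_carrier)
  ultimately show "codim K V A C = codim K V A B + codim K V B C"
    using T.rank_nullity[OF fX] by (simp add: codim_def)
qed

end

lemma codim_self:
  assumes A: "VectorSpace.subspace K A V"
  shows "codim K V A A = 0"
proof -
  have sA: "VectorSpace.subspace K A (sub_tvs V A)" using A by (simp add: subspace_sub_tvs_iff)
  interpret Q: vectorspace K "quot_tvs (sub_tvs V A) A" using sA by (rule quot_tvs_vectorspace)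
  have c: "carrier (quot_tvs (sub_tvs V A) A) = {A}"
    using coset_eq_self_iff[OF A] subspace_carrier[OF A] subspace_zero[OF A] by (auto simp: carrier_quot_tvs)
  \<comment> \<open>The quotient has a single element, so the empty set generates it and its
    dimension is at most 0.\<close>
  have g: "Q.gen_set {}" by (simp add: Q.span_empty c quot_tvs_simps)
  show ?thesis using Q.gen_ge_dim[OF _ _ g] by (simp add: codim_def)
qed

section \<open>Cotrajectories\<close>

text \<open>A decreasing sequence of naturals is eventually constant, so \<open>a\<close> is
  eventually affine and its slope is the limit. Monotonicity is asked from index 1 on, because the
  recursion of cotrajectories starts there.\<close>

lemma decreasing_increments_convergent:
  fixes a d :: "nat \<Rightarrow> nat"
  assumes a: "\<And>n. a (Suc n) = a n + d n" and d: "\<And>n. d (Suc (Suc n)) \<le> d (Suc n)"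
  obtains L where "(\<lambda>n. 1 / real n * real (a n)) \<longlonglongrightarrow> L"
proof -
  \<comment> \<open>An index from 1 on at which the increment is least; from there on the increments
    cannot move.\<close>
  define N where "N = (ARG_MIN d n. n \<ge> 1)"
  have N: "N \<ge> 1" "\<And>n. n \<ge> 1 \<Longrightarrow> d N \<le> d n"
    using arg_min_natI[of "\<lambda>n. n \<ge> 1" 1 d] arg_min_nat_le[of "\<lambda>n. n \<ge> 1" _ d]
    unfolding N_def by auto
  \<comment> \<open>Monotonicity bounds the next increment from above by \<open>d N\<close>,
    minimality bounds it from below.\<close>
  have dN: "d (N + k) = d N" for k
  proof (induction k)
    case (Suc k)
    have "d (N + Suc k) \<le> d (N + k)" using d[of "N + k - 1"] N(1) by simp
    then show ?case using N(2)[of "N + Suc k"] Suc.IH by simp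
  qed simp
  have aN: "a (N + k) = a N + k * d N" for k
    by (induction k) (simp_all add: a dN)
  have "(\<lambda>n. (real (a N) - real N * real (d N)) * inverse (real n) + real (d N)) \<longlonglongrightarrow>
      (real (a N) - real N * real (d N)) * 0 + real (d N)"
    by (intro tendsto_intros lim_inverse_n)
  moreover have "\<forall>\<^sub>F n in sequentially. (real (a N) - real N * real (d N)) * inverse (real n) + real (d N)
      = 1 / real n * real (a n)"
  proof (rule eventually_sequentiallyI)
    fix n assume n: "n \<ge> N"
    then have "real (a n) = real (a N) + (real n - real N) * real (d N)"
      using aN[of "n - N"] by (simp add: of_nat_diff)
    then show "(real (a N) - real N * real (d N)) * inverse (real n) + real (d N) = 1 / real n * real (a n)"
      using n N(1) by (simp add: field_simps)
  qed
  ultimately have "(\<lambda>n. 1 / real n * real (a n)) \<longlonglongrightarrow> real (d N)"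
    by (simp add: tendsto_cong)
  then show thesis by (rule that)
qed

lemma cotrajectory_0: "cotrajectory \<phi> U 0 = U"
  by (simp add: cotrajectory_def)

lemma mem_cotrajectory: "x \<in> cotrajectory \<phi> U n \<longleftrightarrow> x \<in> U \<and> (\<forall>k<n. (\<phi> ^^ k) x \<in> U)"
  by (auto simp: cotrajectory_def)

lemma cotrajectory_subset: "cotrajectory \<phi> U n \<subseteq> U"
  by (auto simp: cotrajectory_def)

lemma cotrajectory_antimono: "m \<le> n \<Longrightarrow> cotrajectory \<phi> U n \<subseteq> cotrajectory \<phi> U m"
  by (auto simp: mem_cotrajectory)

lemma cotrajectory_mono: "U \<subseteq> U' \<Longrightarrow> cotrajectory \<phi> U n \<subseteq> cotrajectory \<phi> U' n"
  by (fastforce simp: mem_cotrajectory)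

text \<open>Both \<open>cotrajectory \<phi> U 0\<close> and \<open>cotrajectory \<phi> U 1\<close>
  equal \<open>U\<close>, so this recursion is valid only from index 1 on; for the step from 0 to 1
  it would wrongly demand that \<phi> map \<open>U\<close> into \<open>U\<close>.\<close>

lemma cotrajectory_Suc_Suc:
  "cotrajectory \<phi> U (Suc (Suc n)) =
    {x \<in> cotrajectory \<phi> U (Suc n). \<phi> x \<in> cotrajectory \<phi> U (Suc n)}" (is "?L = ?R")
proof (rule Set.set_eqI)
  fix x
  have "(\<forall>k<Suc (Suc n). (\<phi> ^^ k) x \<in> U) \<longleftrightarrow> x \<in> U \<and> (\<forall>k<Suc n. (\<phi> ^^ k) (\<phi> x) \<in> U)"
    by (simp only: All_less_Suc2 funpow_Suc_right comp_apply funpow_0)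
  moreover have "\<forall>k<Suc (Suc n). (\<phi> ^^ k) x \<in> U \<Longrightarrow> \<forall>k<Suc n. (\<phi> ^^ k) x \<in> U" by auto
  moreover have "\<forall>k<Suc n. (\<phi> ^^ k) (\<phi> x) \<in> U \<Longrightarrow> \<phi> x \<in> U" by (drule spec[of _ 0]) simp
  ultimately show "x \<in> ?L \<longleftrightarrow> x \<in> ?R" by (auto simp only: mem_cotrajectory mem_Collect_eq)
qed

lemma module_hom_funpow:
  assumes "vectorspace K V" "f \<in> module_hom K V V"
  shows "f ^^ k \<in> module_hom K V V"
proof -
  interpret vectorspace K V by fact
  interpret f: mod_hom K V V f using assms by unfold_locales
  show ?thesis
  proof (induction k)
    case 0
    then show ?case by (simp add: module_hom_def)
  next
    case (Suc k)
    then interpret g: mod_hom K V V "f ^^ k" by unfold_locales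
    show ?case by (auto simp: module_hom_def)
  qed
qed

lemma funpow_mem:
  assumes "\<And>x. x \<in> A \<Longrightarrow> f x \<in> A" "x \<in> A"
  shows "(f ^^ k) x \<in> A"
  using assms by (induction k) auto

text \<open>The algebraic content of a pair of an endomorphism and a linearly compact open subspace.
  Topology is represented only by the finiteness of the codimensions, so entropies at subspaces can
  be compared by dimension counts alone.\<close>

locale fin_codim_cotrajectory = vectorspace K V
  for K :: "'k ring" and V :: "('k, 'v) tvs" +
  fixes \<phi> :: "'v \<Rightarrow> 'v" and U
  assumes hom: "\<phi> \<in> module_hom K V V" and U: "VectorSpace.subspace K U V"
    and fin: "\<And>n. fin_codim K V U (cotrajectory \<phi> U n)"
begin

abbreviation "C \<equiv> cotrajectory \<phi> U"

lemma subspace_C: "VectorSpace.subspace K (C n) V"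
proof (induction n)
  case 0
  show ?case using U by (simp add: cotrajectory_0)
next
  case (Suc n)
  have "C (Suc n) = {x \<in> C n. (\<phi> ^^ n) x \<in> U}" by (auto simp: mem_cotrajectory less_Suc_eq)
  then show ?case
    using subspace_preimage[OF module_hom_funpow[OF vectorspace_axioms hom] Suc U] by simp
qed

lemma codim_C:
  assumes "m \<le> n"
  shows "fin_codim K V (C m) (C n)" "codim K V U (C n) = codim K V U (C m) + codim K V (C m) (C n)"
  using fin_codim_lower[OF U subspace_C subspace_C cotrajectory_antimono[OF assms] cotrajectory_subset fin]
    codim_add[OF U subspace_C subspace_C cotrajectory_antimono[OF assms] cotrajectory_subset fin] by auto

text \<open>Turns the \<open>lim\<close> in the definition into actual convergence. By
  \<open>cotrajectory_Suc_Suc\<close>, \<open>C (n + 3)\<close> is the preimage of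
  \<open>C (n + 2)\<close> in \<open>C (n + 2)\<close>, and \<phi> maps \<open>C (n + 2)\<close>
  into \<open>C (n + 1)\<close>; hence the increments decrease.\<close>

lemma entropy_at_lim: "(\<lambda>n. 1 / real n * real (codim K V U (C n))) \<longlonglongrightarrow> entropy_at K V \<phi> U"
proof -
  obtain L where L: "(\<lambda>n. 1 / real n * real (codim K V U (C n))) \<longlonglongrightarrow> L"
  proof (rule decreasing_increments_convergent)
    show "codim K V U (C (Suc n)) = codim K V U (C n) + codim K V (C n) (C (Suc n))" for n
      by (rule codim_C) simp
    show "codim K V (C (Suc (Suc n))) (C (Suc (Suc (Suc n)))) \<le> codim K V (C (Suc n)) (C (Suc (Suc n)))" for n
    proof (rule codim_map_le[OF hom subspace_C subspace_C subspace_C])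
      show "fin_codim K V (C (Suc n)) (C (Suc (Suc n)))" by (rule codim_C) simp
      show "C (Suc (Suc (Suc n))) = {x \<in> C (Suc (Suc n)). \<phi> x \<in> C (Suc (Suc n))}"
        by (rule cotrajectory_Suc_Suc)
    qed (use cotrajectory_Suc_Suc[of \<phi> U n] cotrajectory_Suc_Suc[of \<phi> U "Suc n"] in auto)
  qed blast
  moreover have "L = entropy_at K V \<phi> U"
    using limI[OF L] by (simp add: entropy_at_def codim_def)
  ultimately show ?thesis by simp
qed

end

text \<open>An error \<open>k\<close> independent of \<open>n\<close> disappears after division by
  \<open>n\<close>.\<close>

lemma entropy_at_le:
  assumes "fin_codim_cotrajectory K V \<phi> U" "fin_codim_cotrajectory K V' \<phi>' U'"
    and "\<And>n. codim K V U (cotrajectory \<phi> U n) \<le> k + codim K V' U' (cotrajectory \<phi>' U' n)"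
  shows "entropy_at K V \<phi> U \<le> entropy_at K V' \<phi>' U'"
proof -
  interpret A: fin_codim_cotrajectory K V \<phi> U by fact
  interpret B: fin_codim_cotrajectory K V' \<phi>' U' by fact
  have "(\<lambda>n. real k * inverse (real n) + 1 / real n * real (codim K V' U' (B.C n))) \<longlonglongrightarrow>
      real k * 0 + entropy_at K V' \<phi>' U'"
    by (intro tendsto_intros lim_inverse_n B.entropy_at_lim)
  \<comment> \<open>At \<open>n = 0\<close> all quotients are 0 by the convention on division, so
    the bound needs no case distinction.\<close>
  moreover have "1 / real n * real (codim K V U (A.C n)) \<le>
      real k * inverse (real n) + 1 / real n * real (codim K V' U' (B.C n))" for n
  proof -
    have "real (codim K V U (A.C n)) \<le> real k + real (codim K V' U' (B.C n))"
      using assms(3)[of n] by linarith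
    then have "inverse (real n) * real (codim K V U (A.C n)) \<le> inverse (real n) * (real k + real (codim K V' U' (B.C n)))"
      by (intro mult_left_mono) auto
    then show ?thesis by (simp add: distrib_left divide_inverse mult_ac)
  qed
  ultimately show ?thesis
    using A.entropy_at_lim by (intro LIMSEQ_le[of _ _ _ "entropy_at K V' \<phi>' U'"]) auto
qed

text \<open>The codimension of the cotrajectory of \<open>U\<close> in \<open>U'\<close> is counted
  twice, once through \<open>U\<close> and once through the cotrajectory of \<open>U'\<close>; the
  excess is at most the constant \<open>codim K V U' U\<close>.\<close>

lemma entropy_at_antimono:
  assumes 1: "fin_codim_cotrajectory K V \<phi> U" and 2: "fin_codim_cotrajectory K V \<phi> U'"
    and sub: "U \<subseteq> U'" and fin: "\<And>n. fin_codim K V U' (cotrajectory \<phi> U n)"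
  shows "entropy_at K V \<phi> U' \<le> entropy_at K V \<phi> U"
proof (rule entropy_at_le[OF 2 1])
  interpret A: fin_codim_cotrajectory K V \<phi> U by fact
  interpret B: fin_codim_cotrajectory K V \<phi> U' by fact
  fix n
  have "codim K V U' (A.C n) = codim K V U' U + codim K V U (A.C n)"
    by (intro codim_add B.U A.U A.subspace_C cotrajectory_subset sub fin)
  moreover have "codim K V U' (A.C n) = codim K V U' (B.C n) + codim K V (B.C n) (A.C n)"
    by (intro codim_add B.U B.subspace_C A.subspace_C cotrajectory_subset cotrajectory_mono sub fin)
  ultimately show "codim K V U' (B.C n) \<le> codim K V U' U + codim K V U (A.C n)" by simp
qed

section \<open>Cotrajectories of powers\<close>

lemma cotrajectory_funpow_supset:
  assumes "k \<ge> 1"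
  shows "cotrajectory \<phi> U (k * n) \<subseteq> cotrajectory (\<phi> ^^ k) U n"
  using assms by (auto simp: mem_cotrajectory funpow_mult)

text \<open>Division with remainder: the exponents below \<open>k * n\<close> are exactly the
  \<open>j + k * i\<close> with \<open>j < k\<close> and \<open>i < n\<close>. For
  \<open>n = 0\<close> the left side would be the \<open>k\<close>-th cotrajectory and the right
  side \<open>U\<close>.\<close>

lemma cotrajectory_funpow_cotrajectory:
  assumes "k \<ge> 1" "n \<ge> 1"
  shows "cotrajectory (\<phi> ^^ k) (cotrajectory \<phi> U k) n = cotrajectory \<phi> U (k * n)"
proof (intro equalityI subsetI)
  fix x assume "x \<in> cotrajectory (\<phi> ^^ k) (cotrajectory \<phi> U k) n"
  then have x: "x \<in> U" "\<And>i j. i < n \<Longrightarrow> j < k \<Longrightarrow> (\<phi> ^^ j) ((\<phi> ^^ (k * i)) x) \<in> U"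
    by (auto simp: mem_cotrajectory funpow_mult)
  have "(\<phi> ^^ m) x \<in> U" if "m < k * n" for m
  proof -
    have "m div k < n" using that assms by (simp add: less_mult_imp_div_less mult.commute)
    moreover have "m mod k < k" using assms by simp
    moreover have "(\<phi> ^^ m) x = (\<phi> ^^ (m mod k)) ((\<phi> ^^ (k * (m div k))) x)"
      by (metis comp_apply funpow_add mod_mult_div_eq)
    ultimately show ?thesis using x by simp
  qed
  then show "x \<in> cotrajectory \<phi> U (k * n)" using x by (simp add: mem_cotrajectory)
next
  fix x assume "x \<in> cotrajectory \<phi> U (k * n)"
  then have x: "x \<in> U" "\<And>m. m < k * n \<Longrightarrow> (\<phi> ^^ m) x \<in> U" by (auto simp: mem_cotrajectory)
  have "(\<phi> ^^ j) ((\<phi> ^^ (k * i)) x) \<in> U" if "i < n" "j < k" for i j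
  proof -
    have "j + k * i < k * (i + 1)" using that by simp
    also have "\<dots> \<le> k * n" using that by (intro mult_le_mono2) simp
    finally show ?thesis using x(2)[of "j + k * i"] by (simp add: funpow_add)
  qed
  moreover have "(\<phi> ^^ m) x \<in> U" if "m < k" for m
    using x(2)[of m] that assms by (simp add: less_le_trans)
  moreover have "(\<phi> ^^ (k * i)) x \<in> U" if "i < n" for i
    using x(2)[of "k * i"] that assms by simp
  ultimately show "x \<in> cotrajectory (\<phi> ^^ k) (cotrajectory \<phi> U k) n"
    using x by (auto simp: mem_cotrajectory funpow_mult)
qed

text \<open>Pass to the subsequence of multiples of \<open>k\<close>; normalising by
  \<open>n\<close> instead of \<open>k * n\<close> produces the factor \<open>k\<close>.\<close>

lemma (in fin_codim_cotrajectory) entropy_at_lim_multiples: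
  assumes "k \<ge> 1"
  shows "(\<lambda>n. 1 / real n * real (codim K V U (C (k * n)))) \<longlonglongrightarrow> real k * entropy_at K V \<phi> U"
proof -
  have "strict_mono (\<lambda>n. k * n)" using assms by (simp add: strict_mono_def)
  from LIMSEQ_subseq_LIMSEQ[OF entropy_at_lim this]
  have "(\<lambda>n. real k * (1 / real (k * n) * real (codim K V U (C (k * n))))) \<longlonglongrightarrow> real k * entropy_at K V \<phi> U"
    by (intro tendsto_intros) (simp add: comp_def)
  then show ?thesis using assms by (simp add: field_simps)
qed

lemma entropy_at_funpow_le:
  assumes 1: "fin_codim_cotrajectory K V \<phi> U" and 2: "fin_codim_cotrajectory K V (\<phi> ^^ k) U"
    and k: "k \<ge> 1"
  shows "entropy_at K V (\<phi> ^^ k) U \<le> real k * entropy_at K V \<phi> U"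
proof -
  interpret A: fin_codim_cotrajectory K V \<phi> U by fact
  interpret B: fin_codim_cotrajectory K V "\<phi> ^^ k" U by fact
  have "codim K V U (B.C n) \<le> codim K V U (A.C (k * n))" for n
    using codim_add[OF A.U B.subspace_C A.subspace_C cotrajectory_funpow_supset[OF k] cotrajectory_subset A.fin]
    by simp
  then show ?thesis
    by (intro LIMSEQ_le[OF B.entropy_at_lim A.entropy_at_lim_multiples[OF k]] exI allI impI mult_left_mono) auto
qed

text \<open>For \<open>n\<close> at least 1 the cotrajectories of the power starting from
  \<open>C k\<close> are the \<open>C (k * n)\<close>. Their codimensions in \<open>U\<close> and in
  \<open>C k\<close> differ by the constant \<open>codim K V U (C k)\<close>, which does not affect
  the limit.\<close>

lemma entropy_at_funpow_cotrajectory: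
  assumes 1: "fin_codim_cotrajectory K V \<phi> U"
    and 2: "fin_codim_cotrajectory K V (\<phi> ^^ k) (cotrajectory \<phi> U k)" and k: "k \<ge> 1"
  shows "entropy_at K V (\<phi> ^^ k) (cotrajectory \<phi> U k) = real k * entropy_at K V \<phi> U"
proof -
  interpret A: fin_codim_cotrajectory K V \<phi> U by fact
  interpret B: fin_codim_cotrajectory K V "\<phi> ^^ k" "cotrajectory \<phi> U k" by fact
  have "(\<lambda>n. real (codim K V U (A.C k)) * inverse (real n) + 1 / real n * real (codim K V (A.C k) (B.C n))) \<longlonglongrightarrow>
      real (codim K V U (A.C k)) * 0 + entropy_at K V (\<phi> ^^ k) (cotrajectory \<phi> U k)"
    by (intro tendsto_intros lim_inverse_n B.entropy_at_lim)
  moreover have "\<forall>\<^sub>F n in sequentially. real (codim K V U (A.C k)) * inverse (real n) +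
      1 / real n * real (codim K V (A.C k) (B.C n)) = 1 / real n * real (codim K V U (A.C (k * n)))"
  proof (rule eventually_sequentiallyI[of 1])
    fix n :: nat assume n: "n \<ge> 1"
    then have "k \<le> k * n" by simp
    then show "real (codim K V U (A.C k)) * inverse (real n) +
      1 / real n * real (codim K V (A.C k) (B.C n)) = 1 / real n * real (codim K V U (A.C (k * n)))"
      using A.codim_C(2)[of k "k * n"] cotrajectory_funpow_cotrajectory[OF k n, of \<phi> U]
      by (simp add: field_simps add_divide_distrib)
  qed
  ultimately have "(\<lambda>n. 1 / real n * real (codim K V U (A.C (k * n)))) \<longlonglongrightarrow>
      entropy_at K V (\<phi> ^^ k) (cotrajectory \<phi> U k)"
    by (simp add: tendsto_cong)
  then show ?thesis using A.entropy_at_lim_multiples[OF k] LIMSEQ_unique by blast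
qed

section \<open>Linear topologies\<close>

text \<open>The preimage of an open set is the union over \<open>a\<close> of open slices above the
  open point \<open>a\<close>. Joint continuity of scalar multiplication thus becomes continuity of
  scaling by each scalar.\<close>

lemma continuous_map_prod_discrete:
  "continuous_map (prod_topology (discrete_topology A) X) Y f \<longleftrightarrow>
    (\<forall>a\<in>A. continuous_map X Y (\<lambda>x. f (a, x)))"
proof (intro iffI ballI)
  fix a assume f: "continuous_map (prod_topology (discrete_topology A) X) Y f" and a: "a \<in> A"
  have "continuous_map X (prod_topology (discrete_topology A) X) (\<lambda>x. (a, x))"
    using a by (intro continuous_map_pairedI) auto
  from continuous_map_compose[OF this f] show "continuous_map X Y (\<lambda>x. f (a, x))"
    by (simp add: comp_def)
next
  assume f: "\<forall>a\<in>A. continuous_map X Y (\<lambda>x. f (a, x))"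
  show "continuous_map (prod_topology (discrete_topology A) X) Y f"
    unfolding continuous_map_def
  proof (intro conjI allI impI)
    show "f \<in> topspace (prod_topology (discrete_topology A) X) \<rightarrow> topspace Y"
      using f by (auto simp: continuous_map_def Pi_def)
    fix S assume S: "openin Y S"
    have "{p \<in> topspace (prod_topology (discrete_topology A) X). f p \<in> S} =
        (\<Union>a\<in>A. {a} \<times> {x \<in> topspace X. f (a, x) \<in> S})" by auto
    moreover have "openin (prod_topology (discrete_topology A) X) ({a} \<times> {x \<in> topspace X. f (a, x) \<in> S})"
      if "a \<in> A" for a
      using f S that by (auto simp: openin_prod_Times_iff intro: openin_continuous_map_preimage)
    ultimately show "openin (prod_topology (discrete_topology A) X)
        {p \<in> topspace (prod_topology (discrete_topology A) X). f p \<in> S}"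
      by auto
  qed
qed

lemma module_hom_minus:
  assumes "f \<in> module_hom K V V'" "vectorspace K V" "vectorspace K V'" "x \<in> carrier V" "y \<in> carrier V"
  shows "f (x \<ominus>\<^bsub>V\<^esub> y) = f x \<ominus>\<^bsub>V'\<^esub> f y"
proof -
  interpret linear_map K V V' f using assms by (intro linear_mapI)
  show ?thesis using assms by simp
qed

lemma module_hom_zero:
  assumes "f \<in> module_hom K V V'" "vectorspace K V" "vectorspace K V'"
  shows "f \<zero>\<^bsub>V\<^esub> = \<zero>\<^bsub>V'\<^esub>"
proof -
  interpret linear_map K V V' f using assms by (intro linear_mapI)
  show ?thesis by simp
qed

context topological_vectorspace
begin

lemma minus_self [simp]: "x \<in> carrier V \<Longrightarrow> x \<ominus>\<^bsub>V\<^esub> x = \<zero>\<^bsub>V\<^esub>"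
  by (simp add: a_minus_def M.r_neg)

lemma add_minus_cancel: "x \<in> carrier V \<Longrightarrow> y \<in> carrier V \<Longrightarrow> (x \<oplus>\<^bsub>V\<^esub> y) \<ominus>\<^bsub>V\<^esub> y = x"
  by (simp add: a_minus_def M.a_assoc M.r_neg)

lemma minus_add_cancel: "x \<in> carrier V \<Longrightarrow> y \<in> carrier V \<Longrightarrow> (x \<ominus>\<^bsub>V\<^esub> y) \<oplus>\<^bsub>V\<^esub> y = x"
  by (simp add: a_minus_def M.a_assoc M.l_neg)

lemma minus_swap: "x \<in> carrier V \<Longrightarrow> y \<in> carrier V \<Longrightarrow> \<ominus>\<^bsub>V\<^esub> (x \<ominus>\<^bsub>V\<^esub> y) = y \<ominus>\<^bsub>V\<^esub> x"
  by (simp add: a_minus_def M.minus_add M.a_comm)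

lemma minus_minus_minus:
  assumes "x \<in> carrier V" "y \<in> carrier V" "v \<in> carrier V"
  shows "(x \<ominus>\<^bsub>V\<^esub> v) \<ominus>\<^bsub>V\<^esub> (y \<ominus>\<^bsub>V\<^esub> v) = x \<ominus>\<^bsub>V\<^esub> y"
proof -
  have "(x \<ominus>\<^bsub>V\<^esub> v) \<ominus>\<^bsub>V\<^esub> (y \<ominus>\<^bsub>V\<^esub> v) = (x \<oplus>\<^bsub>V\<^esub> \<ominus>\<^bsub>V\<^esub> v) \<oplus>\<^bsub>V\<^esub> (v \<oplus>\<^bsub>V\<^esub> \<ominus>\<^bsub>V\<^esub> y)"
    using assms minus_swap[of y v] by (simp add: a_minus_def)
  also have "\<dots> = x \<ominus>\<^bsub>V\<^esub> y" using assms by (simp add: a_minus_def M.a_assoc M.r_neg1)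
  finally show ?thesis .
qed

lemma continuous_translate:
  assumes "x \<in> carrier V"
  shows "continuous_map (topo V) (topo V) (\<lambda>y. y \<oplus>\<^bsub>V\<^esub> x)"
proof -
  have "continuous_map (topo V) (prod_topology (topo V) (topo V)) (\<lambda>y. (y, x))"
    using assms topspace_eq by (intro continuous_map_pairedI) auto
  from continuous_map_compose[OF this continuous_add] show ?thesis by (simp add: comp_def)
qed

lemma continuous_scale:
  assumes "a \<in> carrier K"
  shows "continuous_map (topo V) (topo V) (\<lambda>x. a \<odot>\<^bsub>V\<^esub> x)"
  using continuous_smult assms by (simp add: continuous_map_prod_discrete)

lemma openin_translate:
  assumes "openin (topo V) S" "x \<in> carrier V"
  shows "openin (topo V) {y \<in> carrier V. y \<oplus>\<^bsub>V\<^esub> x \<in> S}"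
    "openin (topo V) {y \<in> carrier V. y \<ominus>\<^bsub>V\<^esub> x \<in> S}"
  using openin_continuous_map_preimage[OF continuous_translate assms(1), of x]
    openin_continuous_map_preimage[OF continuous_translate assms(1), of "\<ominus>\<^bsub>V\<^esub> x"] assms(2)
  by (simp_all add: topspace_eq a_minus_def)

lemma closedin_translate:
  assumes "closedin (topo V) S" "x \<in> carrier V"
  shows "closedin (topo V) {y \<in> carrier V. y \<oplus>\<^bsub>V\<^esub> x \<in> S}"
    "closedin (topo V) {y \<in> carrier V. y \<ominus>\<^bsub>V\<^esub> x \<in> S}"
  using closedin_continuous_map_preimage[OF continuous_translate assms(1), of x]
    closedin_continuous_map_preimage[OF continuous_translate assms(1), of "\<ominus>\<^bsub>V\<^esub> x"] assms(2)
  by (simp_all add: topspace_eq a_minus_def)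

lemma openin_subset_carrier: "openin (topo V) S \<Longrightarrow> S \<subseteq> carrier V"
  using openin_subset topspace_eq by blast

text \<open>Around each of its points \<open>w\<close>, the subspace contains the translate of
  \<open>N\<close> by \<open>w\<close>.\<close>

lemma open_subspaceI:
  assumes W: "VectorSpace.subspace K W V" and N: "openin (topo V) N" "\<zero>\<^bsub>V\<^esub> \<in> N" "N \<subseteq> W"
  shows "openin (topo V) W"
proof (subst openin_subopen, intro ballI)
  fix w assume w: "w \<in> W"
  then have wV: "w \<in> carrier V" using subspace_carrier[OF W] by simp
  have "y \<in> W" if "y \<in> carrier V" "y \<ominus>\<^bsub>V\<^esub> w \<in> N" for y
    using subspace_add[OF W, of "y \<ominus>\<^bsub>V\<^esub> w" w] that w N minus_add_cancel[of y w] wV by auto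
  then show "\<exists>T. openin (topo V) T \<and> w \<in> T \<and> T \<subseteq> W"
    using openin_translate(2)[OF N(1) wV] N(2) wV by (intro exI[of _ "{y \<in> carrier V. y \<ominus>\<^bsub>V\<^esub> w \<in> N}"]) auto
qed

lemma open_subspace_mono:
  assumes "VectorSpace.subspace K W V" "VectorSpace.subspace K N V" "openin (topo V) N" "N \<subseteq> W"
  shows "openin (topo V) W"
  using open_subspaceI[OF assms(1,3) subspace_zero[OF assms(2)] assms(4)] .

text \<open>A set stable under translation by \<open>M\<close> is a union of cosets of
  \<open>M\<close>, and so is its complement, which is therefore open. With \<open>A\<close> equal
  to \<open>M\<close> this shows that open subspaces are closed.\<close>

lemma closedin_add_open_subspace:
  assumes M: "VectorSpace.subspace K M V" "openin (topo V) M" and A: "A \<subseteq> carrier V"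
    and add: "\<And>x m. x \<in> A \<Longrightarrow> m \<in> M \<Longrightarrow> x \<oplus>\<^bsub>V\<^esub> m \<in> A"
  shows "closedin (topo V) A"
proof -
  have "openin (topo V) (carrier V - A)"
  proof (subst openin_subopen, intro ballI)
    fix y assume y: "y \<in> carrier V - A"
    have "x \<notin> A" if "x \<in> carrier V" "x \<ominus>\<^bsub>V\<^esub> y \<in> M" for x
    proof
      assume "x \<in> A"
      moreover have "y \<ominus>\<^bsub>V\<^esub> x \<in> M" using subspace_neg[OF M(1)] that y minus_swap[of x y] by fastforce
      ultimately have "x \<oplus>\<^bsub>V\<^esub> (y \<ominus>\<^bsub>V\<^esub> x) \<in> A" by (rule add)
      then show False using y that by (metis DiffD1 DiffD2 M.a_comm minus_add_cancel minus_closed)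
    qed
    then show "\<exists>T. openin (topo V) T \<and> y \<in> T \<and> T \<subseteq> carrier V - A"
      using openin_translate(2)[OF M(2), of y] y subspace_zero[OF M(1)]
      by (intro exI[of _ "{x \<in> carrier V. x \<ominus>\<^bsub>V\<^esub> y \<in> M}"]) auto
  qed
  then show ?thesis using A by (simp add: closedin_def topspace_eq)
qed

lemma open_subspace_closed:
  assumes "VectorSpace.subspace K W V" "openin (topo V) W"
  shows "closedin (topo V) W"
  by (rule closedin_add_open_subspace[OF assms]) (auto intro: subspace_subset[OF assms(1), THEN subsetD] subspace_add[OF assms(1)])

lemma coset_alt:
  assumes "VectorSpace.subspace K W V" "v \<in> carrier V"
  shows "W +>\<^bsub>V\<^esub> v = {y \<in> carrier V. y \<ominus>\<^bsub>V\<^esub> v \<in> W}"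
  using mem_coset_iff[OF assms] coset_subset[OF assms] by blast

text \<open>A description without a chosen direction or base point, convenient for preimages,
  intersections, projections and sections. Three points are involved because closure under
  \<open>c x + (1 - c) y\<close> says nothing over the field with two elements.\<close>

lemma closed_linear_variety_iff:
  "closed_linear_variety K V A \<longleftrightarrow> A \<noteq> {} \<and> closedin (topo V) A \<and>
    (\<forall>x\<in>A. \<forall>y\<in>A. \<forall>z\<in>A. \<forall>c\<in>carrier K. c \<odot>\<^bsub>V\<^esub> (x \<ominus>\<^bsub>V\<^esub> y) \<oplus>\<^bsub>V\<^esub> z \<in> A)" (is "_ \<longleftrightarrow> ?R")
proof
  assume "closed_linear_variety K V A"
  then obtain W v where W: "VectorSpace.subspace K W V" "v \<in> carrier V" "closedin (topo V) W" "A = W +>\<^bsub>V\<^esub> v"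
    by (auto simp: closed_linear_variety_def)
  note A = coset_alt[OF W(1,2), folded W(4)]
  have "c \<odot>\<^bsub>V\<^esub> (x \<ominus>\<^bsub>V\<^esub> y) \<oplus>\<^bsub>V\<^esub> z \<in> A" if "x \<in> A" "y \<in> A" "z \<in> A" "c \<in> carrier K" for x y z c
  proof -
    have c: "x \<in> carrier V" "y \<in> carrier V" "z \<in> carrier V" "x \<ominus>\<^bsub>V\<^esub> v \<in> W" "y \<ominus>\<^bsub>V\<^esub> v \<in> W" "z \<ominus>\<^bsub>V\<^esub> v \<in> W"
      using that A by auto
    have "x \<ominus>\<^bsub>V\<^esub> y = (x \<ominus>\<^bsub>V\<^esub> v) \<ominus>\<^bsub>V\<^esub> (y \<ominus>\<^bsub>V\<^esub> v)"
      using minus_minus_minus[OF c(1,2) W(2)] ..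
    then have "x \<ominus>\<^bsub>V\<^esub> y \<in> W" using subspace_minus[OF W(1)] c by simp
    then have "c \<odot>\<^bsub>V\<^esub> (x \<ominus>\<^bsub>V\<^esub> y) \<oplus>\<^bsub>V\<^esub> (z \<ominus>\<^bsub>V\<^esub> v) \<in> W"
      using W(1) c that by (simp add: subspace_add subspace_smult)
    moreover have "c \<odot>\<^bsub>V\<^esub> (x \<ominus>\<^bsub>V\<^esub> y) \<oplus>\<^bsub>V\<^esub> z \<ominus>\<^bsub>V\<^esub> v = c \<odot>\<^bsub>V\<^esub> (x \<ominus>\<^bsub>V\<^esub> y) \<oplus>\<^bsub>V\<^esub> (z \<ominus>\<^bsub>V\<^esub> v)"
      using c W(2) that by (simp add: a_minus_def M.a_assoc)
    ultimately show ?thesis using A c that by simp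
  qed
  moreover have "closedin (topo V) A" using closedin_translate(2)[OF W(3,2)] A by simp
  moreover have "v \<in> A" using coset_self[OF W(1,2)] W(4) by simp
  ultimately show ?R by blast
next
  assume R: ?R
  then obtain v where v: "v \<in> A" by blast
  have AV: "A \<subseteq> carrier V" using R closedin_subset topspace_eq by blast
  then have vV: "v \<in> carrier V" using v by blast
  define W where "W = {x \<in> carrier V. x \<oplus>\<^bsub>V\<^esub> v \<in> A}"
  \<comment> \<open>Stability of \<open>A\<close> is applied to \<open>x + v\<close>,
    \<open>v\<close> and \<open>y + v\<close>; it yields sums for \<open>c = 1\<close> and multiples
    for \<open>y = 0\<close>.\<close>
  have cl: "c \<odot>\<^bsub>V\<^esub> x \<oplus>\<^bsub>V\<^esub> y \<in> W" if xy: "x \<in> W" "y \<in> W" and c: "c \<in> carrier K" for c x y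
  proof -
    have "c \<odot>\<^bsub>V\<^esub> (x \<oplus>\<^bsub>V\<^esub> v \<ominus>\<^bsub>V\<^esub> v) \<oplus>\<^bsub>V\<^esub> (y \<oplus>\<^bsub>V\<^esub> v) \<in> A"
      using R xy c v by (auto simp: W_def)
    then show ?thesis using xy c vV by (simp add: W_def add_minus_cancel M.a_assoc)
  qed
  have z: "\<zero>\<^bsub>V\<^esub> \<in> W" using v vV by (simp add: W_def)
  have W: "VectorSpace.subspace K W V"
  proof (rule subspaceI)
    show "v \<oplus>\<^bsub>V\<^esub> w \<in> W" if "v \<in> W" "w \<in> W" for v w
      using cl[OF that, of "\<one>\<^bsub>K\<^esub>"] that by (simp add: W_def)
    show "c \<odot>\<^bsub>V\<^esub> v \<in> W" if "c \<in> carrier K" "v \<in> W" for v c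
      using cl[OF that(2) z that(1)] that by (simp add: W_def)
  qed (use z vectorspace_axioms in \<open>auto simp: W_def\<close>)
  moreover have "closedin (topo V) W" using closedin_translate(1)[of A v] R vV by (simp add: W_def)
  moreover have "A = W +>\<^bsub>V\<^esub> v"
    using coset_alt[OF W vV] AV vV by (auto simp: W_def minus_add_cancel)
  ultimately show "closed_linear_variety K V A" using vV unfolding closed_linear_variety_def by blast
qed

section \<open>Subspace and quotient topologies\<close>

lemma sub_tvs_topological_vectorspace:
  assumes W: "VectorSpace.subspace K W V"
  shows "topological_vectorspace K (sub_tvs V W)"
proof (intro topological_vectorspace.intro topological_vectorspace_axioms.intro)
  have WV: "topspace (topo V) \<inter> W = W" using subspace_subset[OF W] topspace_eq by auto
  show "vectorspace K (sub_tvs V W)" using W by (rule sub_tvs_vectorspace)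
  show "topspace (topo (sub_tvs V W)) = carrier (sub_tvs V W)" using WV by simp
  have "continuous_map (subtopology (prod_topology (topo V) (topo V)) (W \<times> W)) (subtopology (topo V) W) (\<lambda>(x, y). x \<oplus>\<^bsub>V\<^esub> y)"
    using continuous_map_from_subtopology[OF continuous_add] subspace_add[OF W]
    by (auto simp: continuous_map_in_subtopology)
  then show "continuous_map (prod_topology (topo (sub_tvs V W)) (topo (sub_tvs V W))) (topo (sub_tvs V W))
      (\<lambda>(x, y). x \<oplus>\<^bsub>sub_tvs V W\<^esub> y)" by (simp add: subtopology_Times)
  show "continuous_map (prod_topology (discrete_topology (carrier K)) (topo (sub_tvs V W))) (topo (sub_tvs V W))
      (\<lambda>(a, x). a \<odot>\<^bsub>sub_tvs V W\<^esub> x)"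
    using continuous_map_from_subtopology[OF continuous_scale] subspace_smult[OF W]
    by (auto simp: continuous_map_prod_discrete continuous_map_in_subtopology)
qed

lemma openin_quot_tvs:
  "openin (topo (quot_tvs V W)) S \<longleftrightarrow>
    S \<subseteq> carrier (quot_tvs V W) \<and> openin (topo V) {x \<in> carrier V. W +>\<^bsub>V\<^esub> x \<in> S}"
  by (simp add: quot_tvs_simps openin_quotient_topology topspace_eq carrier_quot_tvs)

lemma topspace_quot_tvs: "topspace (topo (quot_tvs V W)) = carrier (quot_tvs V W)"
proof (rule antisym)
  show "topspace (topo (quot_tvs V W)) \<subseteq> carrier (quot_tvs V W)"
    using openin_topspace[of "topo (quot_tvs V W)"] unfolding openin_quot_tvs by blast
  have "{x \<in> carrier V. W +>\<^bsub>V\<^esub> x \<in> carrier (quot_tvs V W)} = topspace (topo V)"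
    by (auto simp: carrier_quot_tvs topspace_eq)
  then have "openin (topo (quot_tvs V W)) (carrier (quot_tvs V W))"
    unfolding openin_quot_tvs by simp
  then show "carrier (quot_tvs V W) \<subseteq> topspace (topo (quot_tvs V W))" by (rule openin_subset)
qed

lemma quot_tvs_proj_continuous:
  "continuous_map (topo V) (topo (quot_tvs V W)) (\<lambda>v. W +>\<^bsub>V\<^esub> v)"
  by (auto simp: continuous_map_def topspace_quot_tvs openin_quot_tvs topspace_eq carrier_quot_tvs)

text \<open>The preimage of the image of \<open>S\<close> is the union of the translates of
  \<open>S\<close> by elements of \<open>W\<close>.\<close>

lemma quot_tvs_proj_open:
  assumes W: "VectorSpace.subspace K W V" and S: "openin (topo V) S"
  shows "openin (topo (quot_tvs V W)) ((\<lambda>v. W +>\<^bsub>V\<^esub> v) ` S)"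
proof -
  have SV: "S \<subseteq> carrier V" using S by (rule openin_subset_carrier)
  have "{x \<in> carrier V. W +>\<^bsub>V\<^esub> x \<in> (\<lambda>v. W +>\<^bsub>V\<^esub> v) ` S} = (\<Union>w\<in>W. {x \<in> carrier V. x \<oplus>\<^bsub>V\<^esub> w \<in> S})"
    (is "?L = ?R")
  proof (intro equalityI subsetI)
    fix x assume "x \<in> ?L"
    then obtain s where s: "x \<in> carrier V" "s \<in> S" "W +>\<^bsub>V\<^esub> s = W +>\<^bsub>V\<^esub> x" by fastforce
    then have "s \<ominus>\<^bsub>V\<^esub> x \<in> W" using coset_eq_iff[OF W] SV by blast
    moreover have "x \<oplus>\<^bsub>V\<^esub> (s \<ominus>\<^bsub>V\<^esub> x) = s"
      using s SV minus_add_cancel[of s x] M.a_comm[of x "s \<ominus>\<^bsub>V\<^esub> x"] by auto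
    ultimately show "x \<in> ?R" using s by force
  next
    fix x assume "x \<in> ?R"
    then obtain w where w: "x \<in> carrier V" "w \<in> W" "x \<oplus>\<^bsub>V\<^esub> w \<in> S" by blast
    then have wV: "w \<in> carrier V" using subspace_carrier[OF W] by simp
    have "x \<oplus>\<^bsub>V\<^esub> w \<ominus>\<^bsub>V\<^esub> x = w" using add_minus_cancel[of w x] M.a_comm[of x w] w wV by simp
    then have "W +>\<^bsub>V\<^esub> (x \<oplus>\<^bsub>V\<^esub> w) = W +>\<^bsub>V\<^esub> x" using coset_eq_iff[OF W, of "x \<oplus>\<^bsub>V\<^esub> w" x] w wV by simp
    then show "x \<in> ?L" using w by (metis (mono_tags, lifting) imageI mem_Collect_eq)
  qed
  moreover have "openin (topo V) {x \<in> carrier V. x \<oplus>\<^bsub>V\<^esub> w \<in> S}" if "w \<in> W" for w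
    using openin_translate(1)[OF S] subspace_carrier[OF W that] .
  ultimately show ?thesis using SV by (auto simp: openin_quot_tvs carrier_quot_tvs)
qed

lemma continuous_map_from_quot_tvs:
  assumes "g ` carrier (quot_tvs V W) \<subseteq> topspace Y" "continuous_map (topo V) Y (\<lambda>v. g (W +>\<^bsub>V\<^esub> v))"
  shows "continuous_map (topo (quot_tvs V W)) Y g"
  unfolding continuous_map_def topspace_quot_tvs
proof (intro conjI allI impI)
  fix S assume "openin Y S"
  from openin_continuous_map_preimage[OF assms(2) this]
  have "openin (topo V) {x \<in> carrier V. g (W +>\<^bsub>V\<^esub> x) \<in> S}" by (simp add: topspace_eq)
  moreover have "{x \<in> carrier V. W +>\<^bsub>V\<^esub> x \<in> {x \<in> carrier (quot_tvs V W). g x \<in> S}} = {x \<in> carrier V. g (W +>\<^bsub>V\<^esub> x) \<in> S}"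
    by (auto simp: carrier_quot_tvs)
  ultimately show "openin (topo (quot_tvs V W)) {x \<in> carrier (quot_tvs V W). g x \<in> S}"
    by (simp add: openin_quot_tvs)
qed (use assms in auto)

lemma quot_tvs_topological_vectorspace:
  assumes W: "VectorSpace.subspace K W V"
  shows "topological_vectorspace K (quot_tvs V W)"
proof (intro topological_vectorspace.intro topological_vectorspace_axioms.intro)
  let ?Q = "quot_tvs V W" and ?p = "\<lambda>v. W +>\<^bsub>V\<^esub> v"
  show Q: "vectorspace K ?Q" using W by (rule quot_tvs_vectorspace)
  interpret Q: vectorspace K ?Q by fact
  note h = quot_tvs_hom[OF W]
  show "topspace (topo ?Q) = carrier ?Q" by (rule topspace_quot_tvs)
  \<comment> \<open>Since the projection is open, the image of a box around a pair of
    representatives is a box around the pair of cosets. This lifts the question to continuity of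
    addition in \<open>V\<close>.\<close>
  show "continuous_map (prod_topology (topo ?Q) (topo ?Q)) (topo ?Q) (\<lambda>(x, y). x \<oplus>\<^bsub>?Q\<^esub> y)"
    unfolding continuous_map_def
  proof (intro conjI allI impI)
    show "(\<lambda>(x, y). x \<oplus>\<^bsub>?Q\<^esub> y) \<in> topspace (prod_topology (topo ?Q) (topo ?Q)) \<rightarrow> topspace (topo ?Q)"
      by (auto simp: topspace_quot_tvs)
    fix S assume S: "openin (topo ?Q) S"
    show "openin (prod_topology (topo ?Q) (topo ?Q))
      {x \<in> topspace (prod_topology (topo ?Q) (topo ?Q)). (case x of (x, y) \<Rightarrow> x \<oplus>\<^bsub>?Q\<^esub> y) \<in> S}"
      unfolding openin_prod_topology_alt
    proof (intro allI impI)
      fix X Y assume "(X, Y) \<in> {x \<in> topspace (prod_topology (topo ?Q) (topo ?Q)). (case x of (x, y) \<Rightarrow> x \<oplus>\<^bsub>?Q\<^esub> y) \<in> S}"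
      then obtain x y where xy: "x \<in> carrier V" "y \<in> carrier V" "X = ?p x" "Y = ?p y" "X \<oplus>\<^bsub>?Q\<^esub> Y \<in> S"
        by (auto simp: topspace_quot_tvs carrier_quot_tvs)
      have "openin (topo V) {v \<in> carrier V. ?p v \<in> S}" using S by (simp add: openin_quot_tvs)
      from openin_continuous_map_preimage[OF continuous_add this]
      have "openin (prod_topology (topo V) (topo V))
        {z \<in> topspace (prod_topology (topo V) (topo V)). (case z of (x, y) \<Rightarrow> x \<oplus>\<^bsub>V\<^esub> y) \<in> {v \<in> carrier V. ?p v \<in> S}}" .
      moreover have "(x, y) \<in> {z \<in> topspace (prod_topology (topo V) (topo V)). (case z of (x, y) \<Rightarrow> x \<oplus>\<^bsub>V\<^esub> y) \<in> {v \<in> carrier V. ?p v \<in> S}}"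
        using xy module_hom_add[OF h xy(1,2)] by (simp add: topspace_eq)
      ultimately obtain A B where AB: "openin (topo V) A" "openin (topo V) B" "x \<in> A" "y \<in> B"
        "A \<times> B \<subseteq> {z \<in> topspace (prod_topology (topo V) (topo V)). (case z of (x, y) \<Rightarrow> x \<oplus>\<^bsub>V\<^esub> y) \<in> {v \<in> carrier V. ?p v \<in> S}}"
        unfolding openin_prod_topology_alt by meson
      have "?p a \<oplus>\<^bsub>?Q\<^esub> ?p b \<in> S" if "a \<in> A" "b \<in> B" for a b
      proof -
        have "a \<in> carrier V" "b \<in> carrier V" "?p (a \<oplus>\<^bsub>V\<^esub> b) \<in> S"
          using AB(5) that by (auto simp: topspace_eq subset_iff)
        then show ?thesis using module_hom_add[OF h, of a b] by simp
      qed
      moreover have "A \<subseteq> carrier V" "B \<subseteq> carrier V" using AB openin_subset_carrier by auto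
      ultimately show "\<exists>U V'. openin (topo ?Q) U \<and> openin (topo ?Q) V' \<and> X \<in> U \<and> Y \<in> V' \<and>
          U \<times> V' \<subseteq> {x \<in> topspace (prod_topology (topo ?Q) (topo ?Q)). (case x of (x, y) \<Rightarrow> x \<oplus>\<^bsub>?Q\<^esub> y) \<in> S}"
        using AB quot_tvs_proj_open[OF W] xy
        by (intro exI[of _ "?p ` A"] exI[of _ "?p ` B"]) (auto simp: topspace_quot_tvs carrier_quot_tvs)
    qed
  qed
  have "continuous_map (topo ?Q) (topo ?Q) (\<lambda>x. a \<odot>\<^bsub>?Q\<^esub> x)" if a: "a \<in> carrier K" for a
  proof (rule continuous_map_from_quot_tvs)
    have "continuous_map (topo V) (topo ?Q) (\<lambda>v. ?p (a \<odot>\<^bsub>V\<^esub> v))"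
      using continuous_map_compose[OF continuous_scale[OF a] quot_tvs_proj_continuous] by (simp add: comp_def)
    then show "continuous_map (topo V) (topo ?Q) (\<lambda>v. a \<odot>\<^bsub>?Q\<^esub> ?p v)"
      by (rule continuous_map_eq) (simp add: module_hom_smult[OF h a] topspace_eq)
  qed (use a in \<open>auto simp: topspace_quot_tvs\<close>)
  then show "continuous_map (prod_topology (discrete_topology (carrier K)) (topo ?Q)) (topo ?Q) (\<lambda>(a, x). a \<odot>\<^bsub>?Q\<^esub> x)"
    by (simp add: continuous_map_prod_discrete)
qed

end

lemma (in topological_vectorspace) zero_nhdsI:
  "openin (topo V) S \<Longrightarrow> \<zero>\<^bsub>V\<^esub> \<in> S \<Longrightarrow> S \<in> zero_nhds V"
  using openin_subset_carrier by (auto simp: zero_nhds_def)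

text \<open>Basis members are a priori only neighbourhoods of zero; being subspaces, they are
  open.\<close>

lemma (in topological_vectorspace) zero_nhds_basis_open_subspaces:
  assumes "has_zero_nhds_basis V P" "\<And>B. P B \<Longrightarrow> VectorSpace.subspace K B V"
    and S: "openin (topo V) S" "\<zero>\<^bsub>V\<^esub> \<in> S"
  obtains B where "P B" "VectorSpace.subspace K B V" "openin (topo V) B" "B \<subseteq> S"
proof -
  obtain B where B: "B \<in> zero_nhds V" "P B" "B \<subseteq> S"
    using assms zero_nhdsI[OF S] unfolding has_zero_nhds_basis_def by blast
  then obtain N where "openin (topo V) N" "\<zero>\<^bsub>V\<^esub> \<in> N" "N \<subseteq> B" by (auto simp: zero_nhds_def)
  then have "openin (topo V) B" using open_subspaceI assms(2) B by blast
  then show thesis using that B assms(2) by blast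
qed

lemma linearly_topologized_open_subspace:
  assumes "linearly_topologized K V" "openin (topo V) S" "\<zero>\<^bsub>V\<^esub> \<in> S"
  obtains B where "VectorSpace.subspace K B V" "openin (topo V) B" "B \<subseteq> S"
proof -
  interpret topological_vectorspace K V using assms by (simp add: linearly_topologized_def)
  show thesis
    using assms that zero_nhds_basis_open_subspaces[OF _ _ assms(2,3), of "\<lambda>B. VectorSpace.subspace K B V"]
    by (auto simp: linearly_topologized_def)
qed

text \<open>An open subspace that misses \<open>x - y\<close> has disjoint cosets at
  \<open>x\<close> and at \<open>y\<close>.\<close>

lemma (in topological_vectorspace) Hausdorff_spaceI:
  assumes "\<And>x. x \<in> carrier V \<Longrightarrow> x \<noteq> \<zero>\<^bsub>V\<^esub> \<Longrightarrow>
    \<exists>B. VectorSpace.subspace K B V \<and> openin (topo V) B \<and> x \<notin> B"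
  shows "Hausdorff_space (topo V)"
  unfolding Hausdorff_space_def
proof (intro allI impI, elim conjE)
  fix x y assume xy: "x \<in> topspace (topo V)" "y \<in> topspace (topo V)" "x \<noteq> y"
  then have xy': "x \<in> carrier V" "y \<in> carrier V" by (auto simp: topspace_eq)
  have "x \<ominus>\<^bsub>V\<^esub> y \<noteq> \<zero>\<^bsub>V\<^esub>" using xy' xy(3) minus_add_cancel[of x y] by force
  then obtain B where B: "VectorSpace.subspace K B V" "openin (topo V) B" "x \<ominus>\<^bsub>V\<^esub> y \<notin> B"
    using assms[of "x \<ominus>\<^bsub>V\<^esub> y"] xy' by auto
  let ?S = "\<lambda>x. {z \<in> carrier V. z \<ominus>\<^bsub>V\<^esub> x \<in> B}"
  have "z \<ominus>\<^bsub>V\<^esub> y \<notin> B" if "z \<in> carrier V" "z \<ominus>\<^bsub>V\<^esub> x \<in> B" for z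
  proof
    assume "z \<ominus>\<^bsub>V\<^esub> y \<in> B"
    moreover have "x \<ominus>\<^bsub>V\<^esub> z \<in> B" using subspace_neg[OF B(1) that(2)] minus_swap[of z x] that xy' by simp
    ultimately have "(x \<ominus>\<^bsub>V\<^esub> z) \<oplus>\<^bsub>V\<^esub> (z \<ominus>\<^bsub>V\<^esub> y) \<in> B" by (intro subspace_add[OF B(1)])
    moreover have "(x \<ominus>\<^bsub>V\<^esub> z) \<oplus>\<^bsub>V\<^esub> (z \<ominus>\<^bsub>V\<^esub> y) = x \<ominus>\<^bsub>V\<^esub> y"
      using xy' that by (simp add: a_minus_def M.a_assoc M.r_neg1)
    ultimately show False using B by simp
  qed
  then have "disjnt (?S x) (?S y)" by (auto simp: disjnt_iff)
  then show "\<exists>U Va. openin (topo V) U \<and> openin (topo V) Va \<and> x \<in> U \<and> y \<in> Va \<and> disjnt U Va"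
    using openin_translate(2)[OF B(2)] xy' subspace_zero[OF B(1)]
    by (intro exI[of _ "?S x"] exI[of _ "?S y"]) auto
qed

lemma linearly_topologizedI:
  assumes "topological_vectorspace K V"
    and "\<And>x. x \<in> carrier V \<Longrightarrow> x \<noteq> \<zero>\<^bsub>V\<^esub> \<Longrightarrow>
      \<exists>B. VectorSpace.subspace K B V \<and> openin (topo V) B \<and> x \<notin> B"
    and "\<And>S. openin (topo V) S \<Longrightarrow> \<zero>\<^bsub>V\<^esub> \<in> S \<Longrightarrow>
      \<exists>B. VectorSpace.subspace K B V \<and> openin (topo V) B \<and> B \<subseteq> S"
  shows "linearly_topologized K V"
proof -
  interpret topological_vectorspace K V by fact
  have "\<exists>B\<in>zero_nhds V. VectorSpace.subspace K B V \<and> B \<subseteq> N" if "N \<in> zero_nhds V" for N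
  proof -
    from that obtain S where S: "openin (topo V) S" "\<zero>\<^bsub>V\<^esub> \<in> S" "S \<subseteq> N" by (auto simp: zero_nhds_def)
    then obtain B where "VectorSpace.subspace K B V" "openin (topo V) B" "B \<subseteq> S" using assms(3) by blast
    then show ?thesis using S zero_nhdsI[of B] subspace_zero[of K B V] by blast
  qed
  then show ?thesis
    using assms Hausdorff_spaceI by (auto simp: linearly_topologized_def has_zero_nhds_basis_def)
qed

lemma linearly_topologized_separate:
  assumes "linearly_topologized K V" "x \<in> carrier V" "x \<noteq> \<zero>\<^bsub>V\<^esub>"
  obtains B where "VectorSpace.subspace K B V" "openin (topo V) B" "x \<notin> B"
proof -
  interpret topological_vectorspace K V using assms by (simp add: linearly_topologized_def)
  have "Hausdorff_space (topo V)" using assms by (simp add: linearly_topologized_def)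
  then obtain S T where "openin (topo V) S" "\<zero>\<^bsub>V\<^esub> \<in> S" "x \<in> T" "disjnt S T"
    using assms topspace_eq unfolding Hausdorff_space_def by (metis M.zero_closed)
  moreover obtain B where "VectorSpace.subspace K B V" "openin (topo V) B" "B \<subseteq> S"
    using linearly_topologized_open_subspace[OF assms(1)] calculation by blast
  ultimately show thesis using that by (auto simp: disjnt_iff)
qed

lemma sub_tvs_linearly_topologized:
  assumes V: "linearly_topologized K V" and W: "VectorSpace.subspace K W V"
  shows "linearly_topologized K (sub_tvs V W)"
proof -
  interpret topological_vectorspace K V using V by (simp add: linearly_topologized_def)
  have sub: "VectorSpace.subspace K (B \<inter> W) (sub_tvs V W) \<and> openin (topo (sub_tvs V W)) (B \<inter> W)"
    if "VectorSpace.subspace K B V" "openin (topo V) B" for B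
    using that W by (auto simp: subspace_sub_tvs_iff subspace_Int openin_subtopology_Int)
  show ?thesis
  proof (rule linearly_topologizedI)
    show "topological_vectorspace K (sub_tvs V W)" using W by (rule sub_tvs_topological_vectorspace)
    fix x assume x: "x \<in> carrier (sub_tvs V W)" "x \<noteq> \<zero>\<^bsub>sub_tvs V W\<^esub>"
    then obtain B where "VectorSpace.subspace K B V" "openin (topo V) B" "x \<notin> B"
      using linearly_topologized_separate[OF V, of x] subspace_carrier[OF W] by auto
    then show "\<exists>B. VectorSpace.subspace K B (sub_tvs V W) \<and> openin (topo (sub_tvs V W)) B \<and> x \<notin> B"
      using sub by blast
  next
    fix S assume "openin (topo (sub_tvs V W)) S" "\<zero>\<^bsub>sub_tvs V W\<^esub> \<in> S"
    then obtain T where T: "openin (topo V) T" "S = T \<inter> W" "\<zero>\<^bsub>V\<^esub> \<in> T" by (auto simp: openin_subtopology)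
    then obtain B where "VectorSpace.subspace K B V" "openin (topo V) B" "B \<subseteq> T"
      using linearly_topologized_open_subspace[OF V] by blast
    then show "\<exists>B. VectorSpace.subspace K B (sub_tvs V W) \<and> openin (topo (sub_tvs V W)) B \<and> B \<subseteq> S"
      using sub T by blast
  qed
qed

lemma quot_tvs_linearly_topologized:
  assumes V: "linearly_topologized K V" and W: "VectorSpace.subspace K W V" and cl: "closedin (topo V) W"
  shows "linearly_topologized K (quot_tvs V W)"
proof -
  interpret topological_vectorspace K V using V by (simp add: linearly_topologized_def)
  let ?Q = "quot_tvs V W" and ?p = "\<lambda>v. W +>\<^bsub>V\<^esub> v"
  have sub: "VectorSpace.subspace K (?p ` B) ?Q \<and> openin (topo ?Q) (?p ` B)"
    if "VectorSpace.subspace K B V" "openin (topo V) B" for B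
    using that quot_tvs_proj_open[OF W] subspace_image[OF quot_tvs_hom[OF W] quot_tvs_vectorspace[OF W]] by blast
  show ?thesis
  proof (rule linearly_topologizedI)
    show "topological_vectorspace K ?Q" using W by (rule quot_tvs_topological_vectorspace)
    fix X assume X: "X \<in> carrier ?Q" "X \<noteq> \<zero>\<^bsub>?Q\<^esub>"
    then obtain x where x: "x \<in> carrier V" "X = ?p x" by (auto simp: carrier_quot_tvs)
    then have "x \<notin> W" using X coset_eq_self_iff[OF W] by (simp add: quot_tvs_simps)
    \<comment> \<open>Closedness of \<open>W\<close> yields the Hausdorff property: near zero there
      is an open subspace \<open>B\<close> such that \<open>b + x\<close> avoids \<open>W\<close>
      for all \<open>b\<close> in \<open>B\<close>. As \<open>B\<close> contains negatives,
      \<open>x - b\<close> avoids \<open>W\<close> as well, so the coset of \<open>x\<close> is not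
      in the image of \<open>B\<close>.\<close>
    have "openin (topo V) (carrier V - W)" using cl by (simp add: closedin_def topspace_eq)
    then have "openin (topo V) {y \<in> carrier V. y \<oplus>\<^bsub>V\<^esub> x \<in> carrier V - W}" using x by (intro openin_translate)
    then obtain B where B: "VectorSpace.subspace K B V" "openin (topo V) B" "B \<subseteq> {y \<in> carrier V. y \<oplus>\<^bsub>V\<^esub> x \<in> carrier V - W}"
      using linearly_topologized_open_subspace[OF V] x \<open>x \<notin> W\<close> by force
    have "?p x \<noteq> ?p b" if "b \<in> B" for b
    proof
      have bV: "b \<in> carrier V" using subspace_carrier[OF B(1) that] .
      assume "?p x = ?p b"
      then have "x \<ominus>\<^bsub>V\<^esub> b \<in> W" using coset_eq_iff[OF W x(1) bV] by simp
      moreover have "\<ominus>\<^bsub>V\<^esub> b \<oplus>\<^bsub>V\<^esub> x \<notin> W" using B(3) subspace_neg[OF B(1) that] by blast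
      ultimately show False using bV x by (simp add: a_minus_def M.a_comm)
    qed
    then have "X \<notin> ?p ` B" using x by blast
    then show "\<exists>B. VectorSpace.subspace K B ?Q \<and> openin (topo ?Q) B \<and> X \<notin> B"
      using sub B by blast
  next
    fix S assume S: "openin (topo ?Q) S" "\<zero>\<^bsub>?Q\<^esub> \<in> S"
    then have "openin (topo V) {x \<in> carrier V. ?p x \<in> S}" by (simp add: openin_quot_tvs)
    moreover have "?p \<zero>\<^bsub>V\<^esub> = \<zero>\<^bsub>?Q\<^esub>" using coset_eq_self_iff[OF W] subspace_zero[OF W] by (simp add: quot_tvs_simps)
    ultimately obtain B where "VectorSpace.subspace K B V" "openin (topo V) B" "B \<subseteq> {x \<in> carrier V. ?p x \<in> S}"
      using linearly_topologized_open_subspace[OF V, of "{x \<in> carrier V. ?p x \<in> S}"] S by auto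
    then show "\<exists>B. VectorSpace.subspace K B ?Q \<and> openin (topo ?Q) B \<and> B \<subseteq> S"
      using sub[of B] by (intro exI[of _ "?p ` B"]) auto
  qed
qed

section \<open>Products of linearly topologized spaces\<close>

lemma prod_tvs_simps:
  "carrier (prod_tvs V1 V2) = carrier V1 \<times> carrier V2" "\<zero>\<^bsub>prod_tvs V1 V2\<^esub> = (\<zero>\<^bsub>V1\<^esub>, \<zero>\<^bsub>V2\<^esub>)"
  "v \<oplus>\<^bsub>prod_tvs V1 V2\<^esub> w = (fst v \<oplus>\<^bsub>V1\<^esub> fst w, snd v \<oplus>\<^bsub>V2\<^esub> snd w)"
  "a \<odot>\<^bsub>prod_tvs V1 V2\<^esub> v = (a \<odot>\<^bsub>V1\<^esub> fst v, a \<odot>\<^bsub>V2\<^esub> snd v)"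
  "topo (prod_tvs V1 V2) = prod_topology (topo V1) (topo V2)"
  by (simp_all add: prod_tvs_def direct_sum_def module.defs tvs.defs)

lemma prod_tvs_topological_vectorspace:
  assumes "topological_vectorspace K V1" "topological_vectorspace K V2"
  shows "topological_vectorspace K (prod_tvs V1 V2)"
proof (intro topological_vectorspace.intro topological_vectorspace_axioms.intro)
  let ?P = "prod_tvs V1 V2"
  interpret A: topological_vectorspace K V1 by fact
  interpret B: topological_vectorspace K V2 by fact
  show "vectorspace K ?P"
  proof (rule vs_criteria)
    show "field K" ..
    show "\<forall>v\<in>carrier ?P. \<exists>neg_v\<in>carrier ?P. v \<oplus>\<^bsub>?P\<^esub> neg_v = \<zero>\<^bsub>?P\<^esub>"
    proof
      fix v assume "v \<in> carrier ?P"
      then show "\<exists>neg_v\<in>carrier ?P. v \<oplus>\<^bsub>?P\<^esub> neg_v = \<zero>\<^bsub>?P\<^esub>"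
        by (intro bexI[of _ "(\<ominus>\<^bsub>V1\<^esub> fst v, \<ominus>\<^bsub>V2\<^esub> snd v)"]) (auto simp: prod_tvs_simps A.M.r_neg B.M.r_neg)
    qed
  qed (auto simp: prod_tvs_simps A.M.a_ac B.M.a_ac A.smult_l_distr A.smult_r_distr A.smult_assoc1
      B.smult_l_distr B.smult_r_distr B.smult_assoc1)
  show "topspace (topo ?P) = carrier ?P" by (simp add: prod_tvs_simps A.topspace_eq B.topspace_eq)
  have 1: "continuous_map (prod_topology (topo ?P) (topo ?P)) (topo V1) (\<lambda>p. fst (fst p) \<oplus>\<^bsub>V1\<^esub> fst (snd p))"
  proof -
    have "continuous_map (prod_topology (topo ?P) (topo ?P)) (prod_topology (topo V1) (topo V1)) (\<lambda>p. (fst (fst p), fst (snd p)))"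
      unfolding prod_tvs_simps
      by (intro continuous_map_pairedI continuous_map_compose[OF continuous_map_fst continuous_map_fst, unfolded comp_def]
          continuous_map_compose[OF continuous_map_snd continuous_map_fst, unfolded comp_def])
    from continuous_map_compose[OF this A.continuous_add] show ?thesis by (simp add: comp_def)
  qed
  have 2: "continuous_map (prod_topology (topo ?P) (topo ?P)) (topo V2) (\<lambda>p. snd (fst p) \<oplus>\<^bsub>V2\<^esub> snd (snd p))"
  proof -
    have "continuous_map (prod_topology (topo ?P) (topo ?P)) (prod_topology (topo V2) (topo V2)) (\<lambda>p. (snd (fst p), snd (snd p)))"
      unfolding prod_tvs_simps
      by (intro continuous_map_pairedI continuous_map_compose[OF continuous_map_fst continuous_map_snd, unfolded comp_def]
          continuous_map_compose[OF continuous_map_snd continuous_map_snd, unfolded comp_def])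
    from continuous_map_compose[OF this B.continuous_add] show ?thesis by (simp add: comp_def)
  qed
  show "continuous_map (prod_topology (topo ?P) (topo ?P)) (topo ?P) (\<lambda>(x, y). x \<oplus>\<^bsub>?P\<^esub> y)"
    using continuous_map_pairedI[OF 1 2] by (simp add: prod_tvs_simps case_prod_unfold)
  have "continuous_map (topo ?P) (topo ?P) (\<lambda>x. a \<odot>\<^bsub>?P\<^esub> x)" if a: "a \<in> carrier K" for a
  proof -
    have "continuous_map (prod_topology (topo V1) (topo V2)) (topo V1) (\<lambda>x. a \<odot>\<^bsub>V1\<^esub> fst x)"
      using continuous_map_compose[OF continuous_map_fst A.continuous_scale[OF a]] by (simp add: comp_def)
    moreover have "continuous_map (prod_topology (topo V1) (topo V2)) (topo V2) (\<lambda>x. a \<odot>\<^bsub>V2\<^esub> snd x)"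
      using continuous_map_compose[OF continuous_map_snd B.continuous_scale[OF a]] by (simp add: comp_def)
    ultimately show ?thesis by (simp add: prod_tvs_simps continuous_map_pairedI)
  qed
  then show "continuous_map (prod_topology (discrete_topology (carrier K)) (topo ?P)) (topo ?P) (\<lambda>(a, x). a \<odot>\<^bsub>?P\<^esub> x)"
    by (simp add: continuous_map_prod_discrete)
qed

lemma subspace_Times:
  assumes "topological_vectorspace K V1" "topological_vectorspace K V2"
    and "VectorSpace.subspace K A V1" "VectorSpace.subspace K B V2"
  shows "VectorSpace.subspace K (A \<times> B) (prod_tvs V1 V2)"
proof (rule subspaceI)
  show "vectorspace K (prod_tvs V1 V2)"
    using prod_tvs_topological_vectorspace[OF assms(1,2)] topological_vectorspace.axioms(1) by blast
qed (use assms(3,4) subspace_subset[OF assms(3)] subspace_subset[OF assms(4)] in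
    \<open>auto simp: prod_tvs_simps subspace_zero subspace_add subspace_smult\<close>)

lemma fst_hom: "fst \<in> module_hom K (prod_tvs V1 V2) V1"
  and snd_hom: "snd \<in> module_hom K (prod_tvs V1 V2) V2"
  by (auto simp: module_hom_def prod_tvs_simps)

lemma prod_tvs_open_subspace:
  assumes V1: "linearly_topologized K V1" and V2: "linearly_topologized K V2"
    and S: "openin (topo (prod_tvs V1 V2)) S" "\<zero>\<^bsub>prod_tvs V1 V2\<^esub> \<in> S"
  obtains A B where "VectorSpace.subspace K A V1" "openin (topo V1) A"
    "VectorSpace.subspace K B V2" "openin (topo V2) B" "A \<times> B \<subseteq> S"
proof -
  have "(\<zero>\<^bsub>V1\<^esub>, \<zero>\<^bsub>V2\<^esub>) \<in> S" using S by (simp add: prod_tvs_simps)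
  then have "\<exists>A B. openin (topo V1) A \<and> openin (topo V2) B \<and> \<zero>\<^bsub>V1\<^esub> \<in> A \<and> \<zero>\<^bsub>V2\<^esub> \<in> B \<and> A \<times> B \<subseteq> S"
    using S(1) unfolding prod_tvs_simps openin_prod_topology_alt by simp
  then obtain A B where AB: "openin (topo V1) A" "openin (topo V2) B" "\<zero>\<^bsub>V1\<^esub> \<in> A" "\<zero>\<^bsub>V2\<^esub> \<in> B"
    "A \<times> B \<subseteq> S" by (elim exE conjE)
  obtain A' where A': "VectorSpace.subspace K A' V1" "openin (topo V1) A'" "A' \<subseteq> A"
    using linearly_topologized_open_subspace[OF V1 AB(1,3)] .
  obtain B' where B': "VectorSpace.subspace K B' V2" "openin (topo V2) B'" "B' \<subseteq> B"
    using linearly_topologized_open_subspace[OF V2 AB(2,4)] .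
  have "A' \<times> B' \<subseteq> S" using A'(3) B'(3) AB(5) by auto
  then show thesis by (rule that[OF A'(1,2) B'(1,2)])
qed

lemma prod_tvs_linearly_topologized:
  assumes V1: "linearly_topologized K V1" and V2: "linearly_topologized K V2"
  shows "linearly_topologized K (prod_tvs V1 V2)"
proof -
  let ?P = "prod_tvs V1 V2"
  have t: "topological_vectorspace K V1" "topological_vectorspace K V2"
    using assms by (auto simp: linearly_topologized_def)
  interpret A: topological_vectorspace K V1 by fact
  interpret B: topological_vectorspace K V2 by fact
  have sub: "VectorSpace.subspace K (A \<times> B) ?P \<and> openin (topo ?P) (A \<times> B)"
    if "VectorSpace.subspace K A V1" "openin (topo V1) A" "VectorSpace.subspace K B V2" "openin (topo V2) B" for A B
    using that subspace_Times[OF t] by (simp add: prod_tvs_simps openin_prod_Times_iff)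
  have c1: "VectorSpace.subspace K (carrier V1) V1" "openin (topo V1) (carrier V1)"
    using subspace_carrier_self[OF A.vectorspace_axioms] openin_topspace[of "topo V1"] by (auto simp: A.topspace_eq)
  have c2: "VectorSpace.subspace K (carrier V2) V2" "openin (topo V2) (carrier V2)"
    using subspace_carrier_self[OF B.vectorspace_axioms] openin_topspace[of "topo V2"] by (auto simp: B.topspace_eq)
  show ?thesis
  proof (rule linearly_topologizedI)
    show "topological_vectorspace K ?P" using t by (rule prod_tvs_topological_vectorspace)
    fix p assume p: "p \<in> carrier ?P" "p \<noteq> \<zero>\<^bsub>?P\<^esub>"
    obtain x y where xy: "p = (x, y)" "x \<in> carrier V1" "y \<in> carrier V2" using p by (auto simp: prod_tvs_simps)
    consider "x \<noteq> \<zero>\<^bsub>V1\<^esub>" | "y \<noteq> \<zero>\<^bsub>V2\<^esub>" using p xy by (auto simp: prod_tvs_simps)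
    then show "\<exists>B. VectorSpace.subspace K B ?P \<and> openin (topo ?P) B \<and> p \<notin> B"
    proof cases
      case 1
      then obtain B where "VectorSpace.subspace K B V1" "openin (topo V1) B" "x \<notin> B"
        using linearly_topologized_separate[OF V1 xy(2)] by blast
      then show ?thesis using sub[of B "carrier V2"] c2 xy by (intro exI[of _ "B \<times> carrier V2"]) auto
    next
      case 2
      then obtain B where "VectorSpace.subspace K B V2" "openin (topo V2) B" "y \<notin> B"
        using linearly_topologized_separate[OF V2 xy(3)] by blast
      then show ?thesis using sub[of "carrier V1" B] c1 xy by (intro exI[of _ "carrier V1 \<times> B"]) auto
    qed
  next
    fix S assume "openin (topo ?P) S" "\<zero>\<^bsub>?P\<^esub> \<in> S"
    then obtain A B where "VectorSpace.subspace K A V1" "openin (topo V1) A"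
        "VectorSpace.subspace K B V2" "openin (topo V2) B" "A \<times> B \<subseteq> S"
      using prod_tvs_open_subspace[OF V1 V2] by blast
    then show "\<exists>B. VectorSpace.subspace K B ?P \<and> openin (topo ?P) B \<and> B \<subseteq> S" using sub by blast
  qed
qed

section \<open>Linear compactness\<close>

lemma linearly_compact_topologized: "linearly_compact K V \<Longrightarrow> linearly_topologized K V"
  by (simp add: linearly_compact_def)

lemma linearly_topologized_tvs: "linearly_topologized K V \<Longrightarrow> topological_vectorspace K V"
  by (simp add: linearly_topologized_def)

lemma linearly_compactD:
  assumes "linearly_compact K V" "\<And>A. A \<in> \<F> \<Longrightarrow> closed_linear_variety K V A"
    and "\<And>\<G>. \<G> \<subseteq> \<F> \<Longrightarrow> finite \<G> \<Longrightarrow> \<Inter>\<G> \<noteq> {}"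
  shows "\<exists>x. x \<in> \<Inter>\<F>"
proof -
  have "\<Inter>\<F> \<noteq> {}"
    using assms(1)[unfolded linearly_compact_def, THEN conjunct2, THEN spec, of \<F>] assms(2,3) by simp
  then show ?thesis by blast
qed

lemma linearly_compactI:
  assumes "linearly_topologized K V"
    and "\<And>\<F>. (\<And>A. A \<in> \<F> \<Longrightarrow> closed_linear_variety K V A) \<Longrightarrow>
      (\<And>\<G>. \<G> \<subseteq> \<F> \<Longrightarrow> finite \<G> \<Longrightarrow> \<Inter>\<G> \<noteq> {}) \<Longrightarrow> \<Inter>\<F> \<noteq> {}"
  shows "linearly_compact K V"
  unfolding linearly_compact_def using assms(1)
proof (rule conjI)
  show "\<forall>\<F>. (\<forall>A\<in>\<F>. closed_linear_variety K V A) \<and> (\<forall>\<G>\<subseteq>\<F>. finite \<G> \<longrightarrow> \<Inter>\<G> \<noteq> {}) \<longrightarrow> \<Inter>\<F> \<noteq> {}"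
    by (intro allI impI) (rule assms(2), simp_all)
qed

text \<open>Closedness comes from continuity and affine stability from linearity; the point
  \<open>x\<close> provides non-emptiness.\<close>

lemma closed_linear_variety_preimage:
  assumes X: "topological_vectorspace K X" and Y: "topological_vectorspace K Y"
    and f: "continuous_linear K X Y f" and A: "closed_linear_variety K Y A"
    and x: "x \<in> carrier X" "f x \<in> A"
  shows "closed_linear_variety K X {x \<in> carrier X. f x \<in> A}"
proof -
  interpret X: topological_vectorspace K X by fact
  interpret Y: topological_vectorspace K Y by fact
  have h: "f \<in> module_hom K X Y" and c: "continuous_map (topo X) (topo Y) f"
    using f by (auto simp: continuous_linear_def)
  have A': "closedin (topo Y) A" "\<And>x y z c. x \<in> A \<Longrightarrow> y \<in> A \<Longrightarrow> z \<in> A \<Longrightarrow> c \<in> carrier K \<Longrightarrow>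
      c \<odot>\<^bsub>Y\<^esub> (x \<ominus>\<^bsub>Y\<^esub> y) \<oplus>\<^bsub>Y\<^esub> z \<in> A"
    using A by (auto simp: Y.closed_linear_variety_iff)
  show ?thesis
    unfolding X.closed_linear_variety_iff
  proof (intro conjI ballI)
    show "closedin (topo X) {x \<in> carrier X. f x \<in> A}"
      using closedin_continuous_map_preimage[OF c A'(1)] by (simp add: X.topspace_eq)
  qed (use x A'(2) in \<open>auto simp: module_hom_add[OF h] module_hom_smult[OF h] module_hom_minus[OF h X.vectorspace_axioms Y.vectorspace_axioms]\<close>)
qed

lemma linearly_compact_closed_subspace:
  assumes V: "linearly_compact K V" and N: "VectorSpace.subspace K N V" "closedin (topo V) N"
  shows "linearly_compact K (sub_tvs V N)"
proof (rule linearly_compactI)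
  show "linearly_topologized K (sub_tvs V N)"
    using V N by (intro sub_tvs_linearly_topologized linearly_compact_topologized)
  fix \<F> assume F: "\<And>A. A \<in> \<F> \<Longrightarrow> closed_linear_variety K (sub_tvs V N) A"
    and fip: "\<And>\<G>. \<G> \<subseteq> \<F> \<Longrightarrow> finite \<G> \<Longrightarrow> \<Inter>\<G> \<noteq> {}"
  have "closed_linear_variety K V A" if "A \<in> \<F>" for A
  proof -
    obtain W v where "VectorSpace.subspace K W (sub_tvs V N)" "v \<in> N" "closedin (subtopology (topo V) N) W" "A = W +>\<^bsub>V\<^esub> v"
      using F[OF \<open>A \<in> \<F>\<close>] by (auto simp: closed_linear_variety_def)
    then show ?thesis
      using N subspace_carrier[OF N(1)] closedin_trans_full[of "topo V" N W]
      by (auto simp: closed_linear_variety_def subspace_sub_tvs_iff)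
  qed
  then have "\<exists>x. x \<in> \<Inter>\<F>" using fip by (rule linearly_compactD[OF V])
  then show "\<Inter>\<F> \<noteq> {}" by blast
qed

text \<open>Surjectivity keeps preimages of varieties non-empty and lifts the points of finite
  intersections; the image of a common point of the preimages is a common point.\<close>

lemma linearly_compact_image:
  assumes X: "linearly_compact K X" and Y: "linearly_topologized K Y"
    and f: "continuous_linear K X Y f" and surj: "f ` carrier X = carrier Y"
  shows "linearly_compact K Y"
proof (rule linearly_compactI)
  show "linearly_topologized K Y" by fact
  interpret X: topological_vectorspace K X using X by (intro linearly_topologized_tvs linearly_compact_topologized)
  interpret Y: topological_vectorspace K Y using Y by (intro linearly_topologized_tvs)
  fix \<F> assume F: "\<And>A. A \<in> \<F> \<Longrightarrow> closed_linear_variety K Y A"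
    and fip: "\<And>\<G>. \<G> \<subseteq> \<F> \<Longrightarrow> finite \<G> \<Longrightarrow> \<Inter>\<G> \<noteq> {}"
  have AY: "A \<noteq> {}" "A \<subseteq> carrier Y" if "A \<in> \<F>" for A
    using F[OF that] closedin_subset[of "topo Y"] by (auto simp: Y.closed_linear_variety_iff Y.topspace_eq)
  let ?p = "\<lambda>A. {x \<in> carrier X. f x \<in> A}"
  have "\<exists>x. x \<in> \<Inter>(?p ` \<F>)"
  proof (rule linearly_compactD[OF X, of "?p ` \<F>"])
    fix B assume "B \<in> ?p ` \<F>"
    then obtain A where A: "A \<in> \<F>" "B = ?p A" by blast
    from AY[OF A(1)] obtain y where "y \<in> A" "y \<in> f ` carrier X" unfolding surj by blast
    then obtain x where "x \<in> carrier X" "f x \<in> A" by blast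
    then show "closed_linear_variety K X B"
      unfolding A(2)
      by (rule closed_linear_variety_preimage[OF X.topological_vectorspace_axioms Y.topological_vectorspace_axioms f F[OF A(1)]])
  next
    fix \<G> assume "\<G> \<subseteq> ?p ` \<F>" "finite \<G>"
    from finite_subset_image[OF this(2,1)]
    obtain \<G>' where G: "\<G>' \<subseteq> \<F>" "finite \<G>'" "\<G> = ?p ` \<G>'" by blast
    obtain y where y: "y \<in> \<Inter>\<G>'" using fip[OF G(1,2)] by blast
    show "\<Inter>\<G> \<noteq> {}"
    proof (cases "\<G>' = {}")
      case False
      then obtain A where "A \<in> \<G>'" by blast
      then have "y \<in> f ` carrier X" unfolding surj using y G(1) AY(2)[of A] by blast
      then obtain x where "x \<in> carrier X" "y = f x" by blast
      then have "x \<in> \<Inter>\<G>" using y by (simp add: G(3))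
      then show ?thesis by blast
    qed (use G in simp)
  qed
  then obtain x where x: "x \<in> \<Inter>(?p ` \<F>)" ..
  show "\<Inter>\<F> \<noteq> {}"
  proof (cases "\<F> = {}")
    case False
    then have "f x \<in> \<Inter>\<F>" using x by auto
    then show ?thesis by blast
  qed simp
qed

section \<open>Finite codimension of open subspaces\<close>

lemma (in vectorspace) infinite_independent_sequence:
  assumes "\<not> fin_dim"
  obtains e :: "nat \<Rightarrow> _" where "\<And>n. e n \<in> carrier V" "inj e" "\<And>n. lin_indpt (e ` {..<n})"
proof -
  \<comment> \<open>No finite set generates the space, so a vector outside the current span can be
    picked at every stage.\<close>
  have step: "\<exists>x. x \<in> carrier V \<and> x \<notin> span A" if "finite A" "A \<subseteq> carrier V" for A
  proof -
    have "span A \<subseteq> carrier V" using span_is_subspace[OF that(2)] by (rule subspace_subset)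
    then show ?thesis using assms that unfolding fin_dim_def by blast
  qed
  define pick where "pick A = (SOME x. x \<in> carrier V \<and> x \<notin> span A)" for A
  have pick: "pick A \<in> carrier V" "pick A \<notin> span A" if "finite A" "A \<subseteq> carrier V" for A
    using someI_ex[OF step[OF that]] unfolding pick_def by auto
  define S where "S = rec_nat {} (\<lambda>_ A. insert (pick A) A)"
  have S: "S 0 = {}" "S (Suc n) = insert (pick (S n)) (S n)" for n by (simp_all add: S_def)
  have fS: "finite (S n) \<and> S n \<subseteq> carrier V" for n
    by (induction n) (auto simp: S pick)
  define e where "e n = pick (S n)" for n
  have Se: "S n = e ` {..<n}" for n
    by (induction n) (auto simp: S e_def lessThan_Suc)
  have eV: "e n \<in> carrier V" for n using pick fS by (simp add: e_def)
  have "e n \<notin> span (S n)" for n using pick(2) fS by (simp add: e_def)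
  then have en: "e n \<notin> span (e ` {..<n})" for n unfolding Se .
  have new: "e n \<notin> e ` {..<n}" for n
  proof -
    have "e ` {..<n} \<subseteq> carrier V" using eV by blast
    then have "e ` {..<n} \<subseteq> span (e ` {..<n})" by (rule in_own_span)
    then show ?thesis using en by blast
  qed
  have "inj e"
  proof (rule linorder_injI)
    fix m n :: nat assume "m < n"
    then show "e m \<noteq> e n" using new[of n] by (metis imageI lessThan_iff)
  qed
  moreover have "lin_indpt (e ` {..<n})" for n
  proof (induction n)
    case 0
    show ?case by (simp add: lin_dep_def)
  next
    case (Suc n)
    have "e ` {..<Suc n} = e ` {..<n} \<union> {e n}" by (simp add: lessThan_Suc)
    moreover have "e ` {..<n} \<subseteq> carrier V" using eV by blast
    ultimately show ?case using lin_dep_iff_in_span[of "e ` {..<n}" "e n"] Suc en new eV by auto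
  qed
  ultimately show thesis using that eV by blast
qed

text \<open>If the quotient were infinite-dimensional, take an independent sequence \<open>e\<close>. The varieties
  \<open>e 0 + \<dots> + e (n - 1) + span {e i | i \<ge> n}\<close> form a decreasing chain; a common point would lie in
  the span of finitely many \<open>e i\<close>, contradicting independence.\<close>

lemma linearly_compact_open_subspace_fin_dim:
  assumes V: "linearly_compact K V" and N: "VectorSpace.subspace K N V" "openin (topo V) N"
  shows "vectorspace.fin_dim K (quot_tvs V N)"
proof (rule ccontr)
  interpret V: topological_vectorspace K V using V by (intro linearly_topologized_tvs linearly_compact_topologized)
  let ?Q = "quot_tvs V N" and ?p = "\<lambda>v. N +>\<^bsub>V\<^esub> v"
  note h = quot_tvs_hom[OF N(1)]
  interpret Q: topological_vectorspace K ?Q using N(1) by (rule V.quot_tvs_topological_vectorspace)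
  interpret p: mod_hom K V ?Q ?p using h by unfold_locales
  assume "\<not> Q.fin_dim"
  then obtain e :: "nat \<Rightarrow> _" where e: "\<And>n. e n \<in> carrier ?Q" "inj e" "\<And>n. Q.lin_indpt (e ` {..<n})"
    using Q.infinite_independent_sequence by blast
  have "\<exists>v. v \<in> carrier V \<and> ?p v = e n" for n using e(1)[of n] by (auto simp: carrier_quot_tvs)
  then obtain v where v: "\<And>n. v n \<in> carrier V" "\<And>n. ?p (v n) = e n" by metis
  have eQ: "e ` A \<subseteq> carrier ?Q" for A using e(1) by blast
  define S where "S n = Q.span (e ` {n..})" for n
  have S: "VectorSpace.subspace K (S n) ?Q" for n
    unfolding S_def using eQ by (rule Q.span_is_subspace)
  have e_mem: "e n \<in> S m" if "m \<le> n" for m n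
    using Q.in_own_span[OF eQ, of "{m..}"] that by (auto simp: S_def)
  have S_mono: "S n \<subseteq> S m" if "m \<le> n" for m n
    unfolding S_def using that by (intro Q.span_is_monotone) auto
  define x where "x = rec_nat \<zero>\<^bsub>V\<^esub> (\<lambda>n y. y \<oplus>\<^bsub>V\<^esub> v n)"
  have x: "x 0 = \<zero>\<^bsub>V\<^esub>" "x (Suc n) = x n \<oplus>\<^bsub>V\<^esub> v n" for n by (simp_all add: x_def)
  have xV: "x n \<in> carrier V" for n by (induction n) (auto simp: x v)
  define W where "W n = {u \<in> carrier V. ?p u \<in> S n}" for n
  have W: "VectorSpace.subspace K (W n) V" for n
    unfolding W_def using subspace_preimage[OF h subspace_carrier_self[OF V.vectorspace_axioms] S] by simp
  have NW: "N \<subseteq> W n" for n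
  proof
    fix u assume u: "u \<in> N"
    then have "?p u = \<zero>\<^bsub>?Q\<^esub>" using coset_eq_self_iff[OF N(1)] subspace_carrier[OF N(1)] by (simp add: quot_tvs_simps)
    then show "u \<in> W n" using subspace_zero[OF S] subspace_carrier[OF N(1) u] by (simp add: W_def)
  qed
  \<comment> \<open>A subspace containing the open subspace \<open>N\<close> is open, hence closed:
    no closure of the span in \<open>V\<close> has to be taken.\<close>
  have Wcl: "closedin (topo V) (W n)" for n
    using V.open_subspace_closed[OF W V.open_subspace_mono[OF W N(1,2) NW]] .
  define A where "A n = W n +>\<^bsub>V\<^esub> x n" for n
  have A: "A n = {y \<in> carrier V. y \<ominus>\<^bsub>V\<^esub> x n \<in> W n}" for n
    unfolding A_def using V.coset_alt[OF W xV] .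
  have xA: "x n \<in> A m" if "m \<le> n" for m n
    using that
  proof (induction rule: dec_induct)
    case base
    show ?case using coset_self[OF W xV] by (simp add: A_def)
  next
    case (step n)
    have "v n \<in> W m" using v step e_mem by (simp add: W_def)
    then have "(x n \<ominus>\<^bsub>V\<^esub> x m) \<oplus>\<^bsub>V\<^esub> v n \<in> W m" using step subspace_add[OF W] by (simp add: A)
    moreover have "(x n \<ominus>\<^bsub>V\<^esub> x m) \<oplus>\<^bsub>V\<^esub> v n = x n \<oplus>\<^bsub>V\<^esub> v n \<ominus>\<^bsub>V\<^esub> x m"
      using xV v by (simp add: a_minus_def V.M.a_ac)
    ultimately show ?case using xV v by (simp add: A x)
  qed
  have "\<exists>y. y \<in> \<Inter>(range A)"
  proof (rule linearly_compactD[OF V, of "range A"])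
    fix B assume "B \<in> range A"
    then obtain n where "B = A n" by blast
    then show "closed_linear_variety K V B"
      unfolding closed_linear_variety_def using W[of n] Wcl[of n] xV[of n] A_def by blast
  next
    fix \<G> assume "\<G> \<subseteq> range A" "finite \<G>"
    from finite_subset_image[OF this(2,1)] obtain I where I: "finite I" "\<G> = A ` I" by blast
    \<comment> \<open>The chain decreases, so the partial sum at the largest index lies in all
      finitely many members; the inserted 0 covers an empty \<open>I\<close>.\<close>
    have "x (Max (insert 0 I)) \<in> A i" if "i \<in> I" for i using that I(1) by (intro xA) simp
    then have "x (Max (insert 0 I)) \<in> \<Inter>\<G>" using I by simp
    then show "\<Inter>\<G> \<noteq> {}" by blast
  qed
  then obtain y where y: "y \<in> \<Inter>(range A)" ..
  then have yV: "y \<in> carrier V" by (auto simp: A)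
  have "?p y \<in> Q.span (range e)"
  proof -
    have "y \<ominus>\<^bsub>V\<^esub> x 0 = y" using yV by (simp add: a_minus_def x)
    moreover have "y \<in> A 0" using y by blast
    ultimately have "y \<in> W 0" by (simp add: A)
    then show ?thesis by (simp add: W_def S_def atLeast_0)
  qed
  then obtain a E where E: "finite E" "E \<subseteq> range e" "a \<in> E \<rightarrow> carrier K" "?p y = Q.lincomb a E"
    by (auto simp: Q.span_def)
  obtain I where I: "finite I" "E = e ` I" using finite_subset_image[OF E(1,2)] by blast
  \<comment> \<open>Beyond every index used to express the image of \<open>y\<close>. The
    contradiction comes from the coefficient of \<open>e m\<close>, which this expression gives as
    0, whereas membership of \<open>y\<close> in \<open>A (Suc m)\<close> forces it to be 1.\<close>
  define m where "m = Suc (Max (insert 0 I))"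
  have Im: "I \<subseteq> {..<m}" using I by (auto simp: m_def less_Suc_eq_le)
  have px: "?p (x n) \<in> Q.span (e ` {..<n})" for n
  proof (induction n)
    case 0
    then show ?case using subspace_zero[OF Q.span_is_subspace[OF eQ, of "{}"]] by (simp add: x)
  next
    case (Suc n)
    note ss = Q.span_is_subspace[OF eQ, of "{..<Suc n}"]
    have "?p (x n) \<in> Q.span (e ` {..<Suc n})"
      using Suc Q.span_is_monotone[of "e ` {..<n}" "e ` {..<Suc n}"] image_mono[of "{..<n}" "{..<Suc n}" e] by auto
    moreover have "e n \<in> Q.span (e ` {..<Suc n})" using Q.in_own_span[OF eQ, of "{..<Suc n}"] by auto
    ultimately show ?case using subspace_add[OF ss] xV v by (simp add: x)
  qed
  have py: "?p y \<in> Q.span (e ` {..<m})"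
  proof -
    have "?p y \<in> Q.span E" using E by (auto simp: Q.span_def)
    then show ?thesis using Q.span_is_monotone[of E "e ` {..<m}"] I Im by blast
  qed
  have "y \<ominus>\<^bsub>V\<^esub> x (Suc m) \<in> W (Suc m)" using y A by blast
  then have "?p (y \<ominus>\<^bsub>V\<^esub> x (Suc m)) \<in> S (Suc m)" by (simp add: W_def)
  then have d: "?p y \<ominus>\<^bsub>?Q\<^esub> (?p (x m) \<oplus>\<^bsub>?Q\<^esub> e m) \<in> S (Suc m)"
    using yV xV v by (simp add: x)
  let ?T = "Q.span (e ` (- {m}))"
  have T: "VectorSpace.subspace K ?T ?Q" using eQ by (rule Q.span_is_subspace)
  have t1: "?p y \<ominus>\<^bsub>?Q\<^esub> (?p (x m) \<oplus>\<^bsub>?Q\<^esub> e m) \<in> ?T"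
  proof -
    have "e ` {Suc m..} \<subseteq> e ` (- {m})" by (rule image_mono) auto
    then have "S (Suc m) \<subseteq> ?T" unfolding S_def by (rule Q.span_is_monotone)
    then show ?thesis using d by blast
  qed
  have t2: "?p y \<ominus>\<^bsub>?Q\<^esub> ?p (x m) \<in> ?T"
  proof (rule subspace_minus[OF T])
    have "Q.span (e ` {..<m}) \<subseteq> ?T" by (intro Q.span_is_monotone image_mono) auto
    then show "?p y \<in> ?T" "?p (x m) \<in> ?T" using py px by auto
  qed
  \<comment> \<open>The difference of \<open>t2\<close> and \<open>t1\<close> is exactly
    \<open>e m\<close>, which is thereby a combination of the other members of the sequence.\<close>
  have t3: "(?p y \<ominus>\<^bsub>?Q\<^esub> ?p (x m)) \<ominus>\<^bsub>?Q\<^esub> (?p y \<ominus>\<^bsub>?Q\<^esub> (?p (x m) \<oplus>\<^bsub>?Q\<^esub> e m)) \<in> ?T"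
    using subspace_minus[OF T t2 t1] .
  have "(b \<ominus>\<^bsub>?Q\<^esub> c) \<ominus>\<^bsub>?Q\<^esub> (b \<ominus>\<^bsub>?Q\<^esub> (c \<oplus>\<^bsub>?Q\<^esub> d)) = d"
    if "b \<in> carrier ?Q" "c \<in> carrier ?Q" "d \<in> carrier ?Q" for b c d
  proof -
    have "c \<oplus>\<^bsub>?Q\<^esub> (d \<oplus>\<^bsub>?Q\<^esub> \<ominus>\<^bsub>?Q\<^esub> c) = d"
      using that Q.M.a_lcomm[of c d "\<ominus>\<^bsub>?Q\<^esub> c"] by (simp add: Q.M.r_neg)
    then show ?thesis
      using that Q.minus_swap[of b "c \<oplus>\<^bsub>?Q\<^esub> d"] by (simp add: a_minus_def Q.M.a_ac Q.M.r_neg1 Q.M.r_neg2)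
  qed
  from this[OF p.f_im[OF yV] p.f_im[OF xV[of m]] e(1)[of m]] t3
   have "e m \<in> ?T" by simp
  then obtain b F where F: "finite F" "F \<subseteq> e ` (- {m})" "b \<in> F \<rightarrow> carrier K" "e m = Q.lincomb b F"
    by (auto simp: Q.span_def)
  obtain J where J: "finite J" "J \<subseteq> - {m}" "F = e ` J" using finite_subset_image[OF F(1,2)] by blast
  \<comment> \<open>Large enough that the first \<open>n\<close> members include \<open>e m\<close>
    and all vectors in the combination, since only initial segments are known to be
    independent.\<close>
  define n where "n = Suc (Max (insert m J))"
  have Jn: "J \<subseteq> {..<n}" "m < n" using J by (auto simp: n_def less_Suc_eq_le)
  have "e m \<in> Q.span (e ` {..<n} - {e m})"
  proof -
    have "F \<subseteq> e ` {..<n} - {e m}" using J Jn e(2) by (auto simp: inj_def)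
    then show ?thesis using F by (auto simp: Q.span_def)
  qed
  then have "Q.lin_dep (e ` {..<n})"
    using Q.lindep_span[OF eQ, of "{..<n}"] Jn by auto
  then show False using e(3) by blast
qed

section \<open>Linear compactness of products\<close>

lemma closed_linear_variety_Int:
  assumes "topological_vectorspace K V" "closed_linear_variety K V A" "closed_linear_variety K V B" "A \<inter> B \<noteq> {}"
  shows "closed_linear_variety K V (A \<inter> B)"
proof -
  interpret topological_vectorspace K V by fact
  show ?thesis using assms(2-4) unfolding closed_linear_variety_iff by auto
qed

lemma closed_linear_variety_Inter:
  assumes V: "topological_vectorspace K V" and "finite \<G>" "\<G> \<noteq> {}"
    and "\<And>A. A \<in> \<G> \<Longrightarrow> closed_linear_variety K V A" "\<Inter>\<G> \<noteq> {}"
  shows "closed_linear_variety K V (\<Inter>\<G>)"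
  using assms(2-)
proof (induction \<G> rule: finite_ne_induct)
  case (insert A \<G>)
  then have "closed_linear_variety K V (\<Inter>\<G>)" by auto
  then show ?case using insert closed_linear_variety_Int[OF V, of A "\<Inter>\<G>"] by simp
qed simp

text \<open>Projection along a linearly compact factor is closed on linear varieties. If \<open>x\<close> were a limit
  point missing from the projection, the varieties \<open>snd (A \<inter> (x + N) \<times> Y) + M\<close> of \<open>Y\<close>, for open subspaces
  \<open>N\<close> and \<open>M\<close>, would have a common point \<open>y\<close>, and \<open>(x, y)\<close> would lie in the closure of \<open>A\<close>.\<close>

lemma closed_linear_variety_fst:
  assumes X: "linearly_topologized K X" and Y: "linearly_compact K Y"
    and A: "closed_linear_variety K (prod_tvs X Y) A"
  shows "closed_linear_variety K X (fst ` A)"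
proof -
  let ?P = "prod_tvs X Y"
  have Yt: "linearly_topologized K Y" using Y by (rule linearly_compact_topologized)
  interpret X: topological_vectorspace K X using X by (rule linearly_topologized_tvs)
  interpret Y: topological_vectorspace K Y using Yt by (rule linearly_topologized_tvs)
  interpret P: topological_vectorspace K ?P
    by (rule prod_tvs_topological_vectorspace) unfold_locales
  have cl: "closedin (topo ?P) A" and ne: "A \<noteq> {}"
    and aff: "\<And>p q r c. p \<in> A \<Longrightarrow> q \<in> A \<Longrightarrow> r \<in> A \<Longrightarrow> c \<in> carrier K \<Longrightarrow> c \<odot>\<^bsub>?P\<^esub> (p \<ominus>\<^bsub>?P\<^esub> q) \<oplus>\<^bsub>?P\<^esub> r \<in> A"
    using A by (auto simp: P.closed_linear_variety_iff)
  have AP: "A \<subseteq> carrier X \<times> carrier Y"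
    using closedin_subset[OF cl] unfolding P.topspace_eq by (simp add: prod_tvs_simps)
  have mi: "p \<ominus>\<^bsub>?P\<^esub> q = (fst p \<ominus>\<^bsub>X\<^esub> fst q, snd p \<ominus>\<^bsub>Y\<^esub> snd q)" if "p \<in> A" "q \<in> A" for p q
  proof -
    have "p \<in> carrier ?P" "q \<in> carrier ?P" using that AP by (auto simp: prod_tvs_simps)
    then show ?thesis
      using module_hom_minus[OF fst_hom P.vectorspace_axioms X.vectorspace_axioms] module_hom_minus[OF snd_hom P.vectorspace_axioms Y.vectorspace_axioms] by (metis prod.collapse)
  qed
  have aff': "(c \<odot>\<^bsub>X\<^esub> (fst p \<ominus>\<^bsub>X\<^esub> fst q) \<oplus>\<^bsub>X\<^esub> fst r, c \<odot>\<^bsub>Y\<^esub> (snd p \<ominus>\<^bsub>Y\<^esub> snd q) \<oplus>\<^bsub>Y\<^esub> snd r) \<in> A"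
    if "p \<in> A" "q \<in> A" "r \<in> A" "c \<in> carrier K" for p q r c
    using aff[OF that] mi[OF that(1,2)] by (simp add: prod_tvs_simps)
  have "openin (topo X) (carrier X - fst ` A)"
  proof (subst openin_subopen, intro ballI, rule ccontr)
    fix x assume x: "x \<in> carrier X - fst ` A"
    then have xX: "x \<in> carrier X" by simp
    assume contra: "\<nexists>T. openin (topo X) T \<and> x \<in> T \<and> T \<subseteq> carrier X - fst ` A"
    define \<N> where "\<N> = {(N, M). VectorSpace.subspace K N X \<and> openin (topo X) N \<and>
      VectorSpace.subspace K M Y \<and> openin (topo Y) M}"
    define D where "D = (\<lambda>(N, M). {y \<in> carrier Y. \<exists>p\<in>A. fst p \<ominus>\<^bsub>X\<^esub> x \<in> N \<and> y \<ominus>\<^bsub>Y\<^esub> snd p \<in> M})"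
    have meet: "\<exists>p\<in>A. fst p \<ominus>\<^bsub>X\<^esub> x \<in> N" if "(N, M) \<in> \<N>" for N M
    proof (rule ccontr)
      assume n: "\<not> ?thesis"
      have N: "VectorSpace.subspace K N X" "openin (topo X) N" using that by (auto simp: \<N>_def)
      have "openin (topo X) {z \<in> carrier X. z \<ominus>\<^bsub>X\<^esub> x \<in> N}" using N xX by (intro X.openin_translate)
      moreover have "x \<in> {z \<in> carrier X. z \<ominus>\<^bsub>X\<^esub> x \<in> N}" using xX subspace_zero[OF N(1)] by simp
      moreover have "{z \<in> carrier X. z \<ominus>\<^bsub>X\<^esub> x \<in> N} \<subseteq> carrier X - fst ` A" using n by auto
      ultimately show False using contra by blast
    qed
    have D_mono: "D (N, M) \<subseteq> D (N', M')" if "N \<subseteq> N'" "M \<subseteq> M'" for N M N' M'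
      using that by (auto simp: D_def)
    have D_self: "D (N, M) \<noteq> {}" if NM: "(N, M) \<in> \<N>" for N M
    proof -
      obtain p where p: "p \<in> A" "fst p \<ominus>\<^bsub>X\<^esub> x \<in> N" using meet[OF NM] by blast
      then have "snd p \<in> carrier Y" using AP by auto
      then have "snd p \<in> D (N, M)" using p NM by (auto simp: D_def \<N>_def subspace_zero intro!: bexI[of _ p])
      then show ?thesis by blast
    qed
    \<comment> \<open>Adding the open subspace \<open>M\<close> makes the set closed. For affine
      stability, the same combination is formed of the points of \<open>A\<close> that witness
      membership.\<close>
    have D_variety: "closed_linear_variety K Y (D (N, M))" if NM: "(N, M) \<in> \<N>" for N M
    proof -
      have N: "VectorSpace.subspace K N X" "openin (topo X) N" "VectorSpace.subspace K M Y" "openin (topo Y) M"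
        using NM by (auto simp: \<N>_def)
      show ?thesis
        unfolding Y.closed_linear_variety_iff
      proof (intro conjI ballI)
        show "D (N, M) \<noteq> {}" using D_self[OF NM] .
        show "closedin (topo Y) (D (N, M))"
        proof (rule Y.closedin_add_open_subspace[OF N(3,4)])
          show "D (N, M) \<subseteq> carrier Y" by (auto simp: D_def)
          fix y m assume y: "y \<in> D (N, M)" and m: "m \<in> M"
          then obtain p where p: "p \<in> A" "fst p \<ominus>\<^bsub>X\<^esub> x \<in> N" "y \<ominus>\<^bsub>Y\<^esub> snd p \<in> M" "y \<in> carrier Y"
            by (auto simp: D_def)
          have c: "m \<in> carrier Y" "snd p \<in> carrier Y" using subspace_carrier[OF N(3) m] p AP by auto
          have "(y \<ominus>\<^bsub>Y\<^esub> snd p) \<oplus>\<^bsub>Y\<^esub> m \<in> M" using subspace_add[OF N(3)] p m by blast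
          moreover have "(y \<ominus>\<^bsub>Y\<^esub> snd p) \<oplus>\<^bsub>Y\<^esub> m = (y \<oplus>\<^bsub>Y\<^esub> m) \<ominus>\<^bsub>Y\<^esub> snd p"
            using c p by (simp add: a_minus_def Y.M.a_ac)
          ultimately show "y \<oplus>\<^bsub>Y\<^esub> m \<in> D (N, M)" using p c by (auto simp: D_def)
        qed
        fix y1 y2 y3 c assume y: "y1 \<in> D (N, M)" "y2 \<in> D (N, M)" "y3 \<in> D (N, M)" and c: "c \<in> carrier K"
        obtain p1 where p1: "p1 \<in> A" "fst p1 \<ominus>\<^bsub>X\<^esub> x \<in> N" "y1 \<ominus>\<^bsub>Y\<^esub> snd p1 \<in> M" "y1 \<in> carrier Y"
          using y(1) by (auto simp: D_def)
        obtain p2 where p2: "p2 \<in> A" "fst p2 \<ominus>\<^bsub>X\<^esub> x \<in> N" "y2 \<ominus>\<^bsub>Y\<^esub> snd p2 \<in> M" "y2 \<in> carrier Y"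
          using y(2) by (auto simp: D_def)
        obtain p3 where p3: "p3 \<in> A" "fst p3 \<ominus>\<^bsub>X\<^esub> x \<in> N" "y3 \<ominus>\<^bsub>Y\<^esub> snd p3 \<in> M" "y3 \<in> carrier Y"
          using y(3) by (auto simp: D_def)
        have pc: "fst p1 \<in> carrier X" "fst p2 \<in> carrier X" "fst p3 \<in> carrier X"
          "snd p1 \<in> carrier Y" "snd p2 \<in> carrier Y" "snd p3 \<in> carrier Y" using p1 p2 p3 AP by auto
        define p where "p = (c \<odot>\<^bsub>X\<^esub> (fst p1 \<ominus>\<^bsub>X\<^esub> fst p2) \<oplus>\<^bsub>X\<^esub> fst p3, c \<odot>\<^bsub>Y\<^esub> (snd p1 \<ominus>\<^bsub>Y\<^esub> snd p2) \<oplus>\<^bsub>Y\<^esub> snd p3)"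
        have pA: "p \<in> A" unfolding p_def using aff' p1 p2 p3 c by blast
        have X1: "fst p \<ominus>\<^bsub>X\<^esub> x = c \<odot>\<^bsub>X\<^esub> ((fst p1 \<ominus>\<^bsub>X\<^esub> x) \<ominus>\<^bsub>X\<^esub> (fst p2 \<ominus>\<^bsub>X\<^esub> x)) \<oplus>\<^bsub>X\<^esub> (fst p3 \<ominus>\<^bsub>X\<^esub> x)"
        proof -
          have "(fst p1 \<ominus>\<^bsub>X\<^esub> x) \<ominus>\<^bsub>X\<^esub> (fst p2 \<ominus>\<^bsub>X\<^esub> x) = fst p1 \<ominus>\<^bsub>X\<^esub> fst p2"
            by (rule X.minus_minus_minus) (use pc xX in auto)
          then show ?thesis using pc xX c by (simp add: p_def a_minus_def X.M.a_assoc)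
        qed
        have X2: "fst p \<ominus>\<^bsub>X\<^esub> x \<in> N"
          unfolding X1
          by (rule subspace_add[OF N(1) subspace_smult[OF N(1) c subspace_minus[OF N(1) p1(2) p2(2)]] p3(2)])
        have Y1: "c \<odot>\<^bsub>Y\<^esub> (y1 \<ominus>\<^bsub>Y\<^esub> y2) \<oplus>\<^bsub>Y\<^esub> y3 \<ominus>\<^bsub>Y\<^esub> snd p =
          c \<odot>\<^bsub>Y\<^esub> ((y1 \<ominus>\<^bsub>Y\<^esub> snd p1) \<ominus>\<^bsub>Y\<^esub> (y2 \<ominus>\<^bsub>Y\<^esub> snd p2)) \<oplus>\<^bsub>Y\<^esub> (y3 \<ominus>\<^bsub>Y\<^esub> snd p3)"
          using pc p1(4) p2(4) p3(4) c
          by (simp add: p_def a_minus_def Y.M.minus_add Y.smult_r_distr Y.smult_r_minus Y.M.a_ac)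
        have Y2: "c \<odot>\<^bsub>Y\<^esub> (y1 \<ominus>\<^bsub>Y\<^esub> y2) \<oplus>\<^bsub>Y\<^esub> y3 \<ominus>\<^bsub>Y\<^esub> snd p \<in> M"
          unfolding Y1
          by (rule subspace_add[OF N(3) subspace_smult[OF N(3) c subspace_minus[OF N(3) p1(3) p2(3)]] p3(3)])
        show "c \<odot>\<^bsub>Y\<^esub> (y1 \<ominus>\<^bsub>Y\<^esub> y2) \<oplus>\<^bsub>Y\<^esub> y3 \<in> D (N, M)"
          using pA X2 Y2 p1(4) p2(4) p3(4) c by (auto simp: D_def)
      qed
    qed
    \<comment> \<open>The sets \<open>D\<close> shrink when the open subspaces do, so any finite
      intersection contains the \<open>D\<close> of the intersected subspaces. Including
      \<open>carrier Y\<close> places the common point in the space directly.\<close>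
    have "\<exists>y. y \<in> \<Inter>(insert (carrier Y) (D ` \<N>))"
    proof (rule linearly_compactD[OF Y])
      fix B assume "B \<in> insert (carrier Y) (D ` \<N>)"
      then show "closed_linear_variety K Y B"
      proof
        assume "B = carrier Y"
        then show ?thesis using closedin_topspace[of "topo Y"] Y.M.zero_closed
          by (auto simp: Y.closed_linear_variety_iff Y.topspace_eq)
      qed (use D_variety in auto)
    next
      fix \<G> assume G: "\<G> \<subseteq> insert (carrier Y) (D ` \<N>)" "finite \<G>"
      have "\<exists>N M. (N, M) \<in> \<N> \<and> D (N, M) \<subseteq> \<Inter>\<G>" using G(2,1)
      proof (induction \<G>)
        case empty
        have "(carrier X, carrier Y) \<in> \<N>"
          using subspace_carrier_self[OF X.vectorspace_axioms] subspace_carrier_self[OF Y.vectorspace_axioms] openin_topspace[of "topo X"]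
            openin_topspace[of "topo Y"] by (simp add: \<N>_def X.topspace_eq Y.topspace_eq)
        then show ?case by blast
      next
        case (insert B \<G>)
        then obtain N M where NM: "(N, M) \<in> \<N>" "D (N, M) \<subseteq> \<Inter>\<G>" by blast
        consider "B = carrier Y" | N' M' where "(N', M') \<in> \<N>" "B = D (N', M')" using insert by auto
        then show ?case
        proof cases
          case 1
          then have "D (N, M) \<subseteq> \<Inter>(insert B \<G>)" using NM(2) by (auto simp: D_def)
          then show ?thesis using NM(1) by blast
        next
          case 2
          have "(N \<inter> N', M \<inter> M') \<in> \<N>" using 2 NM by (auto simp: \<N>_def subspace_Int)
          moreover have "D (N \<inter> N', M \<inter> M') \<subseteq> \<Inter>(insert B \<G>)"
            using 2 NM D_mono[of "N \<inter> N'" N "M \<inter> M'" M] D_mono[of "N \<inter> N'" N' "M \<inter> M'" M'] by auto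
          ultimately show ?thesis by blast
        qed
      qed
      then obtain N M where NM: "(N, M) \<in> \<N>" "D (N, M) \<subseteq> \<Inter>\<G>" by blast
      show "\<Inter>\<G> \<noteq> {}" using D_self[OF NM(1)] NM(2) by blast
    qed
    then obtain y where y: "y \<in> carrier Y" "\<And>N M. (N, M) \<in> \<N> \<Longrightarrow> y \<in> D (N, M)" by auto
    have xy: "(x, y) \<in> carrier ?P - A" using x y by (force simp: prod_tvs_simps)
    have "openin (topo ?P) (carrier ?P - A)" using cl by (simp add: closedin_def P.topspace_eq)
    \<comment> \<open>Openness of the complement at \<open>(x, y)\<close> is moved to zero, where a
      product \<open>N \<times> M\<close> of open subspaces fits inside; membership of
      \<open>y\<close> in \<open>D (N, M)\<close> then gives a point of \<open>A\<close> in the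
      translated product.\<close>
    then have "openin (topo ?P) {p \<in> carrier ?P. p \<oplus>\<^bsub>?P\<^esub> (x, y) \<in> carrier ?P - A}"
      using xy by (intro P.openin_translate) auto
    moreover have "\<zero>\<^bsub>?P\<^esub> \<in> {p \<in> carrier ?P. p \<oplus>\<^bsub>?P\<^esub> (x, y) \<in> carrier ?P - A}"
      using xy by simp
    ultimately obtain N M where N: "VectorSpace.subspace K N X" "openin (topo X) N"
      "VectorSpace.subspace K M Y" "openin (topo Y) M"
      "N \<times> M \<subseteq> {p \<in> carrier ?P. p \<oplus>\<^bsub>?P\<^esub> (x, y) \<in> carrier ?P - A}"
      by (rule prod_tvs_open_subspace[OF X Yt])
    then have "y \<in> D (N, M)" using y(2) by (simp add: \<N>_def)
    then obtain p where p: "p \<in> A" "fst p \<ominus>\<^bsub>X\<^esub> x \<in> N" "y \<ominus>\<^bsub>Y\<^esub> snd p \<in> M" by (auto simp: D_def)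
    have pc: "fst p \<in> carrier X" "snd p \<in> carrier Y" using p AP by auto
    have "snd p \<ominus>\<^bsub>Y\<^esub> y \<in> M" using subspace_neg[OF N(3) p(3)] Y.minus_swap[of y "snd p"] pc y by simp
    then have "(fst p \<ominus>\<^bsub>X\<^esub> x, snd p \<ominus>\<^bsub>Y\<^esub> y) \<in> N \<times> M" using p by simp
    then have "(fst p \<ominus>\<^bsub>X\<^esub> x, snd p \<ominus>\<^bsub>Y\<^esub> y) \<oplus>\<^bsub>?P\<^esub> (x, y) \<notin> A" using N(5) by blast
    then show False using p pc xX y by (simp add: prod_tvs_simps X.minus_add_cancel Y.minus_add_cancel)
  qed
  then have "closedin (topo X) (fst ` A)" using AP by (auto simp: closedin_def X.topspace_eq)
  moreover have "c \<odot>\<^bsub>X\<^esub> (x \<ominus>\<^bsub>X\<^esub> y) \<oplus>\<^bsub>X\<^esub> z \<in> fst ` A"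
    if "x \<in> fst ` A" "y \<in> fst ` A" "z \<in> fst ` A" "c \<in> carrier K" for x y z c
  proof -
    from that obtain p q r where "p \<in> A" "q \<in> A" "r \<in> A" "x = fst p" "y = fst q" "z = fst r" by blast
    then show ?thesis using aff'[of p q r c] that(4) by force
  qed
  ultimately show ?thesis using ne by (simp add: X.closed_linear_variety_iff)
qed

text \<open>A common first coordinate \<open>x\<close> comes from linear compactness of
  \<open>X\<close>, the projections being closed varieties by
  \<open>closed_linear_variety_fst\<close>. The sections above \<open>x\<close> are closed varieties
  of \<open>Y\<close>, and a common point of them is the second coordinate.\<close>

lemma prod_tvs_linearly_compact:
  assumes X: "linearly_compact K X" and Y: "linearly_compact K Y"
  shows "linearly_compact K (prod_tvs X Y)"
proof (rule linearly_compactI)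
  let ?P = "prod_tvs X Y"
  have Xt: "linearly_topologized K X" and Yt: "linearly_topologized K Y"
    using X Y by (auto intro: linearly_compact_topologized)
  show Pt: "linearly_topologized K ?P" using Xt Yt by (rule prod_tvs_linearly_topologized)
  interpret X: topological_vectorspace K X using Xt by (rule linearly_topologized_tvs)
  interpret Y: topological_vectorspace K Y using Yt by (rule linearly_topologized_tvs)
  interpret P: topological_vectorspace K ?P using Pt by (rule linearly_topologized_tvs)
  fix \<F> assume F: "\<And>A. A \<in> \<F> \<Longrightarrow> closed_linear_variety K ?P A"
    and fip: "\<And>\<G>. \<G> \<subseteq> \<F> \<Longrightarrow> finite \<G> \<Longrightarrow> \<Inter>\<G> \<noteq> {}"
  \<comment> \<open>Closing the family under finite intersections places \<open>x\<close> in the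
    projection of every finite intersection, which is what gives the sections above \<open>x\<close>
    the finite intersection property.\<close>
  define \<F>' where "\<F>' = {\<Inter>\<G> |\<G>. \<G> \<subseteq> \<F> \<and> finite \<G> \<and> \<G> \<noteq> {}}"
  have var: "closed_linear_variety K ?P A" if "A \<in> \<F>'" for A
    using that F fip unfolding \<F>'_def
    by (auto intro!: closed_linear_variety_Inter[OF P.topological_vectorspace_axioms])
  have int: "\<exists>A\<in>\<F>'. A \<subseteq> \<Inter>\<H>" if "finite \<H>" "\<H> \<noteq> {}" "\<H> \<subseteq> \<F>'" for \<H>
    using that
  proof (induction \<H> rule: finite_ne_induct)
    case (insert A \<H>)
    then obtain B where B: "B \<in> \<F>'" "B \<subseteq> \<Inter>\<H>" by auto
    obtain \<G>1 where 1: "A = \<Inter>\<G>1" "\<G>1 \<subseteq> \<F>" "finite \<G>1" "\<G>1 \<noteq> {}" using insert by (auto simp: \<F>'_def)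
    obtain \<G>2 where 2: "B = \<Inter>\<G>2" "\<G>2 \<subseteq> \<F>" "finite \<G>2" "\<G>2 \<noteq> {}" using B by (auto simp: \<F>'_def)
    have "\<Inter>(\<G>1 \<union> \<G>2) \<in> \<F>'" unfolding \<F>'_def using 1 2 by blast
    moreover have "\<Inter>(\<G>1 \<union> \<G>2) \<subseteq> \<Inter>(insert A \<H>)" using 1 2 B by auto
    ultimately show ?case by blast
  qed auto
  have ne: "A \<noteq> {}" if "A \<in> \<F>'" for A using var[OF that] by (simp add: P.closed_linear_variety_iff)
  have "\<exists>x. x \<in> \<Inter>((`) fst ` \<F>')"
  proof (rule linearly_compactD[OF X])
    fix B assume "B \<in> (`) fst ` \<F>'"
    then show "closed_linear_variety K X B" using var closed_linear_variety_fst[OF Xt Y] by blast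
  next
    fix \<G> assume "\<G> \<subseteq> (`) fst ` \<F>'" "finite \<G>"
    from finite_subset_image[OF this(2,1)] obtain \<H> where H: "\<H> \<subseteq> \<F>'" "finite \<H>" "\<G> = (`) fst ` \<H>" by blast
    show "\<Inter>\<G> \<noteq> {}"
    proof (cases "\<H> = {}")
      case False
      then obtain A where A: "A \<in> \<F>'" "A \<subseteq> \<Inter>\<H>" using int H by blast
      then obtain p where "p \<in> A" using ne by blast
      then have "fst p \<in> \<Inter>\<G>" using A(2) H(3) by auto
      then show ?thesis by blast
    qed (use H in simp)
  qed
  then obtain x where x: "\<And>A. A \<in> \<F>' \<Longrightarrow> x \<in> fst ` A" by auto
  show "\<Inter>\<F> \<noteq> {}"
  proof (cases "\<F> = {}")
    case False
    have FF': "A \<in> \<F>'" if "A \<in> \<F>" for A unfolding \<F>'_def using that by (auto intro!: exI[of _ "{A}"])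
    have sub: "A \<subseteq> carrier X \<times> carrier Y" if "A \<in> \<F>'" for A
    proof -
      have "closedin (topo ?P) A" using var[OF that] by (simp add: P.closed_linear_variety_iff)
      then have "A \<subseteq> carrier ?P" using closedin_subset unfolding P.topspace_eq[symmetric] by blast
      then show ?thesis by (simp add: prod_tvs_simps)
    qed
    have fs: "\<exists>y. y \<in> carrier Y \<and> (x, y) \<in> A" "x \<in> carrier X" if A: "A \<in> \<F>'" for A
    proof -
      from x[OF A] obtain p where p: "p \<in> A" "x = fst p" by (rule imageE)
      have "p \<in> carrier X \<times> carrier Y" using sub[OF A] p(1) by (rule subsetD)
      then show "\<exists>y. y \<in> carrier Y \<and> (x, y) \<in> A" "x \<in> carrier X"
        using p by (auto intro!: exI[of _ "snd p"])
    qed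
    obtain A where "A \<in> \<F>" using False by auto
    then have xX: "x \<in> carrier X" by (intro fs(2)[OF FF'])
    let ?s = "\<lambda>A. {y \<in> carrier Y. (x, y) \<in> A}"
    have sne: "\<exists>y. y \<in> ?s A" if "A \<in> \<F>'" for A using fs(1)[OF that] by simp
    have "\<exists>y. y \<in> \<Inter>(?s ` \<F>')"
    proof (rule linearly_compactD[OF Y])
      fix B assume "B \<in> ?s ` \<F>'"
      then obtain A where A: "A \<in> \<F>'" "B = ?s A" by blast
      have cl: "closedin (topo ?P) A" and aff: "\<And>p q r c. p \<in> A \<Longrightarrow> q \<in> A \<Longrightarrow> r \<in> A \<Longrightarrow> c \<in> carrier K \<Longrightarrow>
        c \<odot>\<^bsub>?P\<^esub> (p \<ominus>\<^bsub>?P\<^esub> q) \<oplus>\<^bsub>?P\<^esub> r \<in> A"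
        using var[OF A(1)] by (auto simp: P.closed_linear_variety_iff)
      have c: "continuous_map (topo Y) (topo ?P) (\<lambda>y. (x, y))"
        unfolding prod_tvs_simps using xX by (intro continuous_map_pairedI) (auto simp: X.topspace_eq)
      have "closedin (topo Y) B"
        using closedin_continuous_map_preimage[OF c cl] by (simp add: A Y.topspace_eq)
      moreover have "c \<odot>\<^bsub>Y\<^esub> (y1 \<ominus>\<^bsub>Y\<^esub> y2) \<oplus>\<^bsub>Y\<^esub> y3 \<in> B"
        if y: "y1 \<in> B" "y2 \<in> B" "y3 \<in> B" and c: "c \<in> carrier K" for y1 y2 y3 c
      proof -
        have yA: "(x, y1) \<in> A" "(x, y2) \<in> A" "(x, y3) \<in> A" and yY: "y1 \<in> carrier Y" "y2 \<in> carrier Y" "y3 \<in> carrier Y"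
          using y by (auto simp: A)
        have "fst ((x, y1) \<ominus>\<^bsub>?P\<^esub> (x, y2)) = \<zero>\<^bsub>X\<^esub>" "snd ((x, y1) \<ominus>\<^bsub>?P\<^esub> (x, y2)) = y1 \<ominus>\<^bsub>Y\<^esub> y2"
          using module_hom_minus[OF fst_hom P.vectorspace_axioms X.vectorspace_axioms] module_hom_minus[OF snd_hom P.vectorspace_axioms Y.vectorspace_axioms] xX yY
          by (simp_all add: prod_tvs_simps)
        then show ?thesis using aff[OF yA c] xX yY c by (simp add: A prod_tvs_simps)
      qed
      ultimately show "closed_linear_variety K Y B"
        using sne[OF A(1)] A(2) by (auto simp: Y.closed_linear_variety_iff)
    next
      fix \<G> assume "\<G> \<subseteq> ?s ` \<F>'" "finite \<G>"
      from finite_subset_image[OF this(2,1)] obtain \<H> where H: "\<H> \<subseteq> \<F>'" "finite \<H>" "\<G> = ?s ` \<H>" by blast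
      show "\<Inter>\<G> \<noteq> {}"
      proof (cases "\<H> = {}")
        case False
        then obtain A where A: "A \<in> \<F>'" "A \<subseteq> \<Inter>\<H>" using int H by blast
        then obtain y where "y \<in> ?s A" using sne by blast
        then have "y \<in> \<Inter>\<G>" using A(2) H(3) by auto
        then show ?thesis by blast
      qed (use H in simp)
    qed
    then obtain y where "\<And>A. A \<in> \<F>' \<Longrightarrow> (x, y) \<in> A" by auto
    then have "(x, y) \<in> \<Inter>\<F>" using FF' by blast
    then show ?thesis by blast
  qed simp
qed

section \<open>Locally linearly compact spaces\<close>

lemma locally_linearly_compact_tvs: "locally_linearly_compact K V \<Longrightarrow> topological_vectorspace K V"
  by (simp add: locally_linearly_compact_def)

lemma lc_open_subspacesD:
  assumes "U \<in> lc_open_subspaces K V"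
  shows "VectorSpace.subspace K U V" "openin (topo V) U" "linearly_compact K (sub_tvs V U)"
  using assms by (auto simp: lc_open_subspaces_def)

lemma locally_linearly_compact_basis:
  assumes V: "locally_linearly_compact K V" and S: "openin (topo V) S" "\<zero>\<^bsub>V\<^esub> \<in> S"
  obtains U where "U \<in> lc_open_subspaces K V" "U \<subseteq> S"
proof -
  interpret topological_vectorspace K V using V by (rule locally_linearly_compact_tvs)
  have "has_zero_nhds_basis V (\<lambda>U. U \<in> lc_open_subspaces K V)"
    using V by (simp add: locally_linearly_compact_def)
  then show thesis
    by (rule zero_nhds_basis_open_subspaces[OF _ lc_open_subspacesD(1) S]) (assumption | rule that)+
qed

text \<open>The Hausdorff property is inherited from a linearly compact open \<open>U\<close>: a
  point outside \<open>U\<close> is separated from zero by \<open>U\<close>, a point inside by an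
  open subspace of \<open>U\<close>, which is open in \<open>V\<close> too.\<close>

lemma locally_linearly_compact_linearly_topologized:
  assumes V: "locally_linearly_compact K V"
  shows "linearly_topologized K V"
proof -
  interpret topological_vectorspace K V using V by (rule locally_linearly_compact_tvs)
  show ?thesis
  proof (rule linearly_topologizedI[OF topological_vectorspace_axioms])
    fix S assume S: "openin (topo V) S" "\<zero>\<^bsub>V\<^esub> \<in> S"
    obtain U where "U \<in> lc_open_subspaces K V" "U \<subseteq> S" using locally_linearly_compact_basis[OF V S] .
    then show "\<exists>B. VectorSpace.subspace K B V \<and> openin (topo V) B \<and> B \<subseteq> S"
      using lc_open_subspacesD by blast
  next
    fix x assume x: "x \<in> carrier V" "x \<noteq> \<zero>\<^bsub>V\<^esub>"
    have "openin (topo V) (carrier V)" using openin_topspace[of "topo V"] by (simp add: topspace_eq)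
    then obtain U where U: "U \<in> lc_open_subspaces K V"
      using locally_linearly_compact_basis[OF V] by blast
    note UD = lc_open_subspacesD[OF U]
    show "\<exists>B. VectorSpace.subspace K B V \<and> openin (topo V) B \<and> x \<notin> B"
    proof (cases "x \<in> U")
      case True
      then obtain B where B: "VectorSpace.subspace K B (sub_tvs V U)" "openin (topo (sub_tvs V U)) B" "x \<notin> B"
        using linearly_topologized_separate[OF linearly_compact_topologized[OF UD(3)], of x] x by auto
      then have "openin (topo V) B" using UD(2) by (simp add: openin_open_subtopology)
      then show ?thesis using B UD(1) by (auto simp: subspace_sub_tvs_iff)
    qed (use UD in blast)
  qed
qed

lemma sub_tvs_sub_tvs: "N \<subseteq> U \<Longrightarrow> sub_tvs (sub_tvs V U) N = sub_tvs V N"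
  by (simp add: sub_tvs_def subtopology_subtopology Int_absorb1)

text \<open>An open subspace is closed, and closed subspaces inherit linear compactness. This makes
  cofinal families of small subspaces available.\<close>

lemma lc_open_subspaces_smaller:
  assumes V: "topological_vectorspace K V" and U: "U \<in> lc_open_subspaces K V"
    and N: "VectorSpace.subspace K N V" "openin (topo V) N" "N \<subseteq> U"
  shows "N \<in> lc_open_subspaces K V"
proof -
  interpret topological_vectorspace K V by fact
  note UD = lc_open_subspacesD[OF U]
  have "closedin (topo (sub_tvs V U)) N"
    using open_subspace_closed[OF N(1,2)] N(3) by (simp add: closedin_subset_topspace)
  then have "linearly_compact K (sub_tvs (sub_tvs V U) N)"
    using N UD by (intro linearly_compact_closed_subspace[OF UD(3)]) (auto simp: subspace_sub_tvs_iff)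
  then show ?thesis using N by (simp add: lc_open_subspaces_def sub_tvs_sub_tvs)
qed

lemma lc_open_subspaces_fin_codim:
  assumes U: "U \<in> lc_open_subspaces K V"
    and N: "VectorSpace.subspace K N V" "openin (topo V) N" "N \<subseteq> U"
  shows "fin_codim K V U N"
proof -
  note UD = lc_open_subspacesD[OF U]
  have "VectorSpace.subspace K N (sub_tvs V U)" "openin (topo (sub_tvs V U)) N"
    using UD N by (auto simp: subspace_sub_tvs_iff openin_open_subtopology)
  with UD(3) show ?thesis unfolding fin_codim_def by (rule linearly_compact_open_subspace_fin_dim)
qed

section \<open>Comparison of entropies\<close>

lemma continuous_linearD:
  assumes "continuous_linear K V W f"
  shows "f \<in> module_hom K V W" "continuous_map (topo V) (topo W) f"
  using assms by (auto simp: continuous_linear_def)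

lemma continuous_linear_funpow:
  assumes V: "topological_vectorspace K V" and f: "continuous_linear K V V f"
  shows "continuous_linear K V V (f ^^ k)"
proof -
  interpret topological_vectorspace K V by fact
  have "continuous_map (topo V) (topo V) (f ^^ k)"
  proof (induction k)
    case (Suc k)
    then show ?case
      using continuous_map_compose[OF Suc continuous_linearD(2)[OF f]] by (simp add: comp_def)
  qed simp
  then show ?thesis using module_hom_funpow[OF vectorspace_axioms] continuous_linearD(1)[OF f] by (simp add: continuous_linear_def)
qed

lemma lc_open_subspaces_cotrajectory:
  assumes V: "topological_vectorspace K V" and f: "continuous_linear K V V \<phi>" and U: "U \<in> lc_open_subspaces K V"
  shows "cotrajectory \<phi> U n \<in> lc_open_subspaces K V"
proof (rule lc_open_subspaces_smaller[OF V U _ _ cotrajectory_subset])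
  interpret topological_vectorspace K V by fact
  note UD = lc_open_subspacesD[OF U]
  have "VectorSpace.subspace K (cotrajectory \<phi> U n) V \<and> openin (topo V) (cotrajectory \<phi> U n)"
  proof (induction n)
    case 0
    show ?case using UD by (simp add: cotrajectory_0)
  next
    case (Suc n)
    note h = continuous_linearD[OF continuous_linear_funpow[OF V f, of n]]
    have eq0: "cotrajectory \<phi> U (Suc n) = {x \<in> cotrajectory \<phi> U n. (\<phi> ^^ n) x \<in> U}"
      by (auto simp: mem_cotrajectory less_Suc_eq)
    then have eq: "cotrajectory \<phi> U (Suc n) = cotrajectory \<phi> U n \<inter> {x \<in> carrier V. (\<phi> ^^ n) x \<in> U}"
      using cotrajectory_subset[of \<phi> U n] subspace_subset[OF UD(1)] by blast
    have "openin (topo V) {x \<in> carrier V. (\<phi> ^^ n) x \<in> U}"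
      using openin_continuous_map_preimage[OF h(2) UD(2)] by (simp add: topspace_eq)
    then have "openin (topo V) (cotrajectory \<phi> U (Suc n))" unfolding eq using Suc by (intro openin_Int) auto
    moreover have "VectorSpace.subspace K (cotrajectory \<phi> U (Suc n)) V"
      unfolding eq0 using Suc by (intro subspace_preimage[OF h(1) _ UD(1)]) auto
    ultimately show ?case by blast
  qed
  then show "VectorSpace.subspace K (cotrajectory \<phi> U n) V" "openin (topo V) (cotrajectory \<phi> U n)" by auto
qed

text \<open>The passage from topology to the dimension counts: cotrajectories are open, hence of
  finite codimension.\<close>

lemma lc_open_subspaces_fin_codim_cotrajectory:
  assumes V: "topological_vectorspace K V" and f: "continuous_linear K V V \<phi>" and U: "U \<in> lc_open_subspaces K V"
  shows "fin_codim_cotrajectory K V \<phi> U"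
proof -
  interpret topological_vectorspace K V by fact
  note CD = lc_open_subspacesD[OF lc_open_subspaces_cotrajectory[OF assms]]
  show ?thesis
  proof (intro fin_codim_cotrajectory.intro fin_codim_cotrajectory_axioms.intro)
    show "vectorspace K V" by (rule vectorspace_axioms)
    show "\<phi> \<in> module_hom K V V" using f by (rule continuous_linearD)
    show "VectorSpace.subspace K U V" using U by (rule lc_open_subspacesD)
    show "fin_codim K V U (cotrajectory \<phi> U n)" for n
      by (rule lc_open_subspaces_fin_codim[OF U CD(1,2) cotrajectory_subset])
  qed
qed

lemma entropy_at_le_smaller:
  assumes V: "topological_vectorspace K V" and f: "continuous_linear K V V \<phi>"
    and U: "U \<in> lc_open_subspaces K V" and U': "U' \<in> lc_open_subspaces K V" and sub: "U \<subseteq> U'"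
  shows "entropy_at K V \<phi> U' \<le> entropy_at K V \<phi> U"
proof (rule entropy_at_antimono[OF _ _ sub])
  note CD = lc_open_subspacesD[OF lc_open_subspaces_cotrajectory[OF V f U]]
  show "fin_codim K V U' (cotrajectory \<phi> U n)" for n
    using lc_open_subspaces_fin_codim[OF U' CD(1,2)] cotrajectory_subset[of \<phi> U n] sub by blast
qed (use lc_open_subspaces_fin_codim_cotrajectory[OF V f] U U' in auto)

lemma entropy_leI:
  assumes "\<And>U. U \<in> lc_open_subspaces K V \<Longrightarrow>
    \<exists>U'\<in>lc_open_subspaces K V'. entropy_at K V \<phi> U \<le> entropy_at K V' \<phi>' U'"
  shows "entropy K V \<phi> \<le> entropy K V' \<phi>'"
  unfolding entropy_def using assms by (intro SUP_mono) simp

lemma entropy_at_le_entropy: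
  "U \<in> lc_open_subspaces K V \<Longrightarrow> ereal (entropy_at K V \<phi> U) \<le> entropy K V \<phi>"
  unfolding entropy_def by (rule SUP_upper)

lemma semiconjugate_funpow:
  assumes "\<And>x. x \<in> A \<Longrightarrow> f (g x) = g' (f x)" "\<And>x. x \<in> A \<Longrightarrow> g x \<in> A" "x \<in> A"
  shows "f ((g ^^ k) x) = (g' ^^ k) (f x)"
  using assms funpow_mem[of A g x] by (induction k) auto

section \<open>Entropy along an intertwining linear map\<close>

context
  fixes K :: "'k ring" and V :: "('k, 'v) tvs" and V' :: "('k, 'w) tvs" and \<phi> \<phi>' f U U'
  assumes sys: "fin_codim_cotrajectory K V \<phi> U" and sys': "fin_codim_cotrajectory K V' \<phi>' U'"
    and f: "f \<in> module_hom K V V'" and semi: "\<And>x. x \<in> carrier V \<Longrightarrow> f (\<phi> x) = \<phi>' (f x)"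
begin

interpretation A: fin_codim_cotrajectory K V \<phi> U by (rule sys)
interpretation B: fin_codim_cotrajectory K V' \<phi>' U' by (rule sys')

lemma semiconjugate_pow: "x \<in> carrier V \<Longrightarrow> f ((\<phi> ^^ k) x) = (\<phi>' ^^ k) (f x)"
  by (rule semiconjugate_funpow[of "carrier V"]) (use semi A.hom in \<open>auto simp: module_hom_def\<close>)

text \<open>Each cotrajectory of \<open>U\<close> is the full preimage of the corresponding one of
  \<open>U'\<close>, so the quotients of \<open>U\<close> embed into those of
  \<open>U'\<close>.\<close>

lemma entropy_at_preimage_le:
  assumes U: "U = {x \<in> carrier V. f x \<in> U'}"
  shows "entropy_at K V \<phi> U \<le> entropy_at K V' \<phi>' U'"
proof (rule entropy_at_le[OF sys sys', where k = 0])
  fix n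
  have pc: "(\<phi> ^^ k) x \<in> carrier V" if "x \<in> carrier V" for k x
    using funpow_mem[of "carrier V" \<phi> x] A.hom that by (auto simp: module_hom_def)
  have "A.C n = {x \<in> U. f x \<in> B.C n}"
    using semiconjugate_pow pc by (auto simp: U mem_cotrajectory)
  then have "codim K V U (A.C n) \<le> codim K V' U' (B.C n)"
    using U by (intro codim_map_le[OF f A.U B.U B.subspace_C cotrajectory_subset _ _ B.fin]) auto
  then show "codim K V U (A.C n) \<le> 0 + codim K V' U' (B.C n)" by simp
qed

text \<open>\<open>U\<close> modulo the preimage \<open>?B\<close> is isomorphic to
  \<open>U'\<close> modulo its cotrajectory. The cotrajectory of \<open>U\<close> is contained in
  \<open>?B\<close>, so its codimension is at least as large.\<close>

lemma entropy_at_image_le: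
  assumes U': "U' = f ` U"
  shows "entropy_at K V' \<phi>' U' \<le> entropy_at K V \<phi> U"
proof (rule entropy_at_le[OF sys' sys, where k = 0])
  fix n
  let ?B = "{x \<in> U. f x \<in> B.C n}"
  interpret f: linear_map K V V' f using A.vectorspace_axioms B.vectorspace_axioms f by (rule linear_mapI)
  have sub: "A.C n \<subseteq> ?B"
  proof
    fix x assume x: "x \<in> A.C n"
    then have "x \<in> U" and xU: "\<And>k. k < n \<Longrightarrow> (\<phi> ^^ k) x \<in> U" by (simp_all add: mem_cotrajectory)
    moreover have "(\<phi>' ^^ k) (f x) \<in> U'" if "k < n" for k
      using semiconjugate_pow[of x k] subspace_carrier[OF A.U \<open>x \<in> U\<close>] xU[OF that] U' by (metis imageI)
    ultimately show "x \<in> ?B" using U' by (simp add: mem_cotrajectory)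
  qed
  have sB: "VectorSpace.subspace K ?B V" using subspace_preimage[OF f A.U B.subspace_C] .
  have "codim K V U ?B = codim K V' U' (B.C n)"
  proof (rule codim_map_eq[OF f A.U B.U B.subspace_C cotrajectory_subset _ refl B.fin])
    show "f ` U \<subseteq> U'" using U' by simp
    fix y assume "y \<in> U'"
    then obtain x where x: "x \<in> U" "y = f x" using U' by blast
    then have "y \<ominus>\<^bsub>V'\<^esub> f x = \<zero>\<^bsub>V'\<^esub>" using subspace_carrier[OF A.U] by (simp add: a_minus_def B.M.r_neg)
    then have "y \<ominus>\<^bsub>V'\<^esub> f x \<in> B.C n" using subspace_zero[OF B.subspace_C] by simp
    then show "\<exists>x\<in>U. y \<ominus>\<^bsub>V'\<^esub> f x \<in> B.C n" using x by blast
  qed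
  moreover have "codim K V U (A.C n) = codim K V U ?B + codim K V ?B (A.C n)"
    by (rule codim_add[OF A.U sB A.subspace_C sub _ A.fin]) auto
  ultimately show "codim K V' U' (B.C n) \<le> 0 + codim K V U (A.C n)" by simp
qed

end

text \<open>Given \<open>U'\<close>, a small \<open>U\<close> is chosen inside its preimage. Then
  \<open>f U\<close> is open and contained in \<open>U'\<close>, so replacing \<open>U'\<close> by
  \<open>f U\<close> only raises the entropy, and \<open>entropy_at_image_le\<close>
  applies.\<close>

lemma entropy_image_le:
  assumes V: "locally_linearly_compact K V" and W: "topological_vectorspace K W"
    and \<phi>: "continuous_linear K V V \<phi>" and \<psi>: "continuous_linear K W W \<psi>"
    and f: "continuous_linear K V W f" and op: "open_map (topo V) (topo W) f"
    and semi: "\<And>x. x \<in> carrier V \<Longrightarrow> f (\<phi> x) = \<psi> (f x)"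
  shows "entropy K W \<psi> \<le> entropy K V \<phi>"
proof (rule entropy_leI)
  interpret V: topological_vectorspace K V using V by (rule locally_linearly_compact_tvs)
  interpret W: topological_vectorspace K W by fact
  fix U' assume U': "U' \<in> lc_open_subspaces K W"
  note fD = continuous_linearD[OF f]
  have "openin (topo V) {x \<in> carrier V. f x \<in> U'}"
    using openin_continuous_map_preimage[OF fD(2) lc_open_subspacesD(2)[OF U']] by (simp add: V.topspace_eq)
  moreover have "\<zero>\<^bsub>V\<^esub> \<in> {x \<in> carrier V. f x \<in> U'}"
    using module_hom_zero[OF fD(1) V.vectorspace_axioms W.vectorspace_axioms] subspace_zero[OF lc_open_subspacesD(1)[OF U']] by simp
  ultimately obtain U where U: "U \<in> lc_open_subspaces K V" "U \<subseteq> {x \<in> carrier V. f x \<in> U'}"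
    by (rule locally_linearly_compact_basis[OF V])
  note UD = lc_open_subspacesD[OF U(1)]
  have fU: "f ` U \<in> lc_open_subspaces K W"
    using subspace_image[OF fD(1) W.vectorspace_axioms UD(1)] op UD(2) U(2)
    by (intro lc_open_subspaces_smaller[OF W U']) (auto simp: open_map_def)
  have "entropy_at K W \<psi> U' \<le> entropy_at K W \<psi> (f ` U)"
    using U(2) by (intro entropy_at_le_smaller[OF W \<psi> fU U']) auto
  also have "\<dots> \<le> entropy_at K V \<phi> U"
    using lc_open_subspaces_fin_codim_cotrajectory[OF V.topological_vectorspace_axioms \<phi> U(1)]
      lc_open_subspaces_fin_codim_cotrajectory[OF W \<psi> fU] fD(1) semi
    by (rule entropy_at_image_le) simp_all
  finally show "\<exists>U\<in>lc_open_subspaces K V. entropy_at K W \<psi> U' \<le> entropy_at K V \<phi> U" using U by blast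
qed

text \<open>Keeps the supremum defining the entropy away from the empty family, where it would be
  minus infinity.\<close>

lemma lc_open_subspaces_nonempty:
  assumes "locally_linearly_compact K V"
  shows "lc_open_subspaces K V \<noteq> {}"
proof -
  interpret topological_vectorspace K V using assms by (rule locally_linearly_compact_tvs)
  have "openin (topo V) (carrier V)" using openin_topspace[of "topo V"] by (simp add: topspace_eq)
  then obtain U where "U \<in> lc_open_subspaces K V"
    using locally_linearly_compact_basis[OF assms] M.zero_closed by metis
  then show ?thesis by blast
qed

section \<open>Properties of the entropy\<close>

lemma entropy_conjugate:
  assumes V: "locally_linearly_compact K V" and W: "locally_linearly_compact K W"
    and \<phi>: "continuous_linear K V V \<phi>" and \<alpha>: "topological_isomorphism K V W \<alpha>"
  shows "entropy K W (\<alpha> \<circ> \<phi> \<circ> inv_into (carrier V) \<alpha>) = entropy K V \<phi>"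
proof -
  interpret V: topological_vectorspace K V using V by (rule locally_linearly_compact_tvs)
  interpret W: topological_vectorspace K W using W by (rule locally_linearly_compact_tvs)
  define \<beta> where "\<beta> = inv_into (carrier V) \<alpha>"
  have h: "\<alpha> \<in> module_hom K V W" and hm: "homeomorphic_map (topo V) (topo W) \<alpha>"
    using \<alpha> by (auto simp: topological_isomorphism_def)
  have c: "continuous_map (topo V) (topo W) \<alpha>" and op: "open_map (topo V) (topo W) \<alpha>"
    and im: "\<alpha> ` carrier V = carrier W" and inj: "inj_on \<alpha> (carrier V)"
    using hm by (auto simp: homeomorphic_eq_everything_map V.topspace_eq W.topspace_eq)
  have \<beta>V: "\<beta> y \<in> carrier V" "\<alpha> (\<beta> y) = y" if "y \<in> carrier W" for y
    using that im unfolding \<beta>_def by (auto simp: inv_into_into f_inv_into_f)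
  have \<beta>\<alpha>: "\<beta> (\<alpha> x) = x" if "x \<in> carrier V" for x
    using that inj by (simp add: \<beta>_def)
  have \<alpha>W: "\<alpha> x \<in> carrier W" if "x \<in> carrier V" for x using that im by blast
  have \<phi>V: "\<phi> x \<in> carrier V" if "x \<in> carrier V" for x
    using that continuous_linearD(1)[OF \<phi>] by (auto simp: module_hom_def)
  \<comment> \<open>The inverse supplied by the homeomorphism agrees with \<open>inv_into\<close> on
    the carrier, so \<beta> is itself a homeomorphism and the image inequality can be used in both
    directions.\<close>
  have maps: "homeomorphic_map (topo W) (topo V) \<beta>"
  proof -
    obtain g where g: "homeomorphic_maps (topo V) (topo W) \<alpha> g" using hm by (auto simp: homeomorphic_map_maps)
    have "g y = \<beta> y" if "y \<in> carrier W" for y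
      using g that \<beta>V \<beta>\<alpha> by (metis V.topspace_eq homeomorphic_maps_def)
    then have "homeomorphic_maps (topo V) (topo W) \<alpha> \<beta>"
      using homeomorphic_maps_eq[OF g] by (simp add: V.topspace_eq W.topspace_eq)
    then show ?thesis by (meson homeomorphic_map_maps homeomorphic_maps_sym)
  qed
  have h\<beta>: "\<beta> \<in> module_hom K W V"
  proof -
    have "\<beta> (x \<oplus>\<^bsub>W\<^esub> y) = \<beta> x \<oplus>\<^bsub>V\<^esub> \<beta> y" if "x \<in> carrier W" "y \<in> carrier W" for x y
      using \<beta>\<alpha>[of "\<beta> x \<oplus>\<^bsub>V\<^esub> \<beta> y"] that \<beta>V module_hom_add[OF h, of "\<beta> x" "\<beta> y"] by simp
    moreover have "\<beta> (r \<odot>\<^bsub>W\<^esub> x) = r \<odot>\<^bsub>V\<^esub> \<beta> x" if "r \<in> carrier K" "x \<in> carrier W" for r x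
      using \<beta>\<alpha>[of "r \<odot>\<^bsub>V\<^esub> \<beta> x"] that \<beta>V module_hom_smult[OF h, of r "\<beta> x"] by simp
    ultimately show ?thesis using \<beta>V by (auto simp: module_hom_def)
  qed
  have c\<beta>: "continuous_map (topo W) (topo V) \<beta>" and op\<beta>: "open_map (topo W) (topo V) \<beta>"
    using maps by (auto simp: homeomorphic_eq_everything_map)
  let ?\<psi> = "\<alpha> \<circ> \<phi> \<circ> \<beta>"
  have \<psi>: "continuous_linear K W W ?\<psi>"
    unfolding continuous_linear_def
  proof
    show "continuous_map (topo W) (topo W) ?\<psi>"
      using c\<beta> continuous_linearD(2)[OF \<phi>] c by (intro continuous_map_compose)
    show "?\<psi> \<in> module_hom K W W"
      using module_hom_add[OF h\<beta>] module_hom_add[OF continuous_linearD(1)[OF \<phi>]] module_hom_add[OF h]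
        module_hom_smult[OF h\<beta>] module_hom_smult[OF continuous_linearD(1)[OF \<phi>]] module_hom_smult[OF h]
        \<beta>V \<phi>V \<alpha>W by (auto simp: module_hom_def)
  qed
  have "entropy K W ?\<psi> \<le> entropy K V \<phi>"
    by (rule entropy_image_le[OF V W.topological_vectorspace_axioms \<phi> \<psi> _ op])
      (use h c \<beta>\<alpha> in \<open>auto simp: continuous_linear_def\<close>)
  moreover have "entropy K V \<phi> \<le> entropy K W ?\<psi>"
    by (rule entropy_image_le[OF W V.topological_vectorspace_axioms \<psi> \<phi> _ op\<beta>])
      (use h\<beta> c\<beta> \<beta>\<alpha> \<beta>V \<phi>V in \<open>auto simp: continuous_linear_def\<close>)
  ultimately show ?thesis by (simp add: \<beta>_def)
qed

section \<open>Invariant subspaces and their quotients\<close>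

context
  fixes K :: "'k ring" and V :: "('k, 'v) tvs" and \<phi> W
  assumes V: "locally_linearly_compact K V" and \<phi>: "continuous_linear K V V \<phi>"
    and W: "VectorSpace.subspace K W V" and inv: "\<phi> ` W \<subseteq> W"
begin

interpretation V: topological_vectorspace K V using V by (rule locally_linearly_compact_tvs)
interpretation S: topological_vectorspace K "sub_tvs V W" using W by (rule V.sub_tvs_topological_vectorspace)
interpretation Q: topological_vectorspace K "quot_tvs V W" using W by (rule V.quot_tvs_topological_vectorspace)

lemma continuous_linear_restrict: "continuous_linear K (sub_tvs V W) (sub_tvs V W) (restrict \<phi> W)"
proof -
  have "continuous_map (subtopology (topo V) W) (topo V) (restrict \<phi> W)"
    by (rule continuous_map_eq[OF continuous_map_from_subtopology[OF continuous_linearD(2)[OF \<phi>]]]) simp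
  then have "continuous_map (subtopology (topo V) W) (subtopology (topo V) W) (restrict \<phi> W)"
    using inv by (auto simp: continuous_map_in_subtopology)
  moreover have "restrict \<phi> W \<in> module_hom K (sub_tvs V W) (sub_tvs V W)"
    using inv subspace_carrier[OF W] subspace_add[OF W] subspace_smult[OF W]
      module_hom_add[OF continuous_linearD(1)[OF \<phi>]] module_hom_smult[OF continuous_linearD(1)[OF \<phi>]]
    by (auto simp: module_hom_def)
  ultimately show ?thesis by (simp add: continuous_linear_def)
qed

lemma induced_map_coset: "x \<in> carrier V \<Longrightarrow> induced_map V W \<phi> (W +>\<^bsub>V\<^esub> x) = W +>\<^bsub>V\<^esub> \<phi> x"
  unfolding induced_map_def by (rule coset_image[OF W continuous_linearD(1)[OF \<phi>] W inv])

lemma continuous_linear_induced: "continuous_linear K (quot_tvs V W) (quot_tvs V W) (induced_map V W \<phi>)"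
proof -
  have h: "induced_map V W \<phi> \<in> module_hom K (quot_tvs V W) (quot_tvs V W)"
    unfolding induced_map_def by (rule quot_map_hom[OF continuous_linearD(1)[OF \<phi>] W W inv])
  moreover have "continuous_map (topo (quot_tvs V W)) (topo (quot_tvs V W)) (induced_map V W \<phi>)"
  proof (rule V.continuous_map_from_quot_tvs)
    show "continuous_map (topo V) (topo (quot_tvs V W)) (\<lambda>v. induced_map V W \<phi> (W +>\<^bsub>V\<^esub> v))"
      using continuous_map_compose[OF continuous_linearD(2)[OF \<phi>] V.quot_tvs_proj_continuous[of W]]
      by (rule continuous_map_eq) (simp add: induced_map_coset V.topspace_eq)
  qed (use h in \<open>auto simp: module_hom_def Q.topspace_eq\<close>)
  ultimately show ?thesis by (simp add: continuous_linear_def)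
qed

lemma continuous_linear_proj: "continuous_linear K V (quot_tvs V W) (\<lambda>v. W +>\<^bsub>V\<^esub> v)"
  using quot_tvs_hom[OF W] V.quot_tvs_proj_continuous by (simp add: continuous_linear_def)

lemma entropy_quotient_le: "entropy K (quot_tvs V W) (induced_map V W \<phi>) \<le> entropy K V \<phi>"
  by (rule entropy_image_le[OF V Q.topological_vectorspace_axioms \<phi> continuous_linear_induced continuous_linear_proj])
    (use V.quot_tvs_proj_open[OF W] induced_map_coset in \<open>auto simp: open_map_def\<close>)

text \<open>An open subspace of \<open>W\<close> is a trace \<open>T \<inter> W\<close>. After
  shrinking \<open>T\<close> to a linearly compact open \<open>U\<close>, the trace
  \<open>U \<inter> W\<close> is the full preimage of \<open>U\<close> under the inclusion.\<close>

lemma entropy_restrict_le: "entropy K (sub_tvs V W) (restrict \<phi> W) \<le> entropy K V \<phi>"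
proof (rule entropy_leI)
  fix U' assume U': "U' \<in> lc_open_subspaces K (sub_tvs V W)"
  obtain T where T: "openin (topo V) T" "U' = T \<inter> W"
    using lc_open_subspacesD(2)[OF U'] by (auto simp: openin_subtopology)
  have "\<zero>\<^bsub>V\<^esub> \<in> T" using subspace_zero[OF lc_open_subspacesD(1)[OF U']] T by simp
  then obtain U where U: "U \<in> lc_open_subspaces K V" "U \<subseteq> T"
    by (rule locally_linearly_compact_basis[OF V T(1)])
  note UD = lc_open_subspacesD[OF U(1)]
  have UW: "U \<inter> W \<in> lc_open_subspaces K (sub_tvs V W)"
    using UD W T U by (intro lc_open_subspaces_smaller[OF S.topological_vectorspace_axioms U'])
      (auto simp: subspace_sub_tvs_iff subspace_Int openin_subtopology_Int)
  have "entropy_at K (sub_tvs V W) (restrict \<phi> W) U' \<le> entropy_at K (sub_tvs V W) (restrict \<phi> W) (U \<inter> W)"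
    using U T by (intro entropy_at_le_smaller[OF S.topological_vectorspace_axioms continuous_linear_restrict UW U']) auto
  also have "\<dots> \<le> entropy_at K V \<phi> U"
    using lc_open_subspaces_fin_codim_cotrajectory[OF S.topological_vectorspace_axioms continuous_linear_restrict UW]
      lc_open_subspaces_fin_codim_cotrajectory[OF V.topological_vectorspace_axioms \<phi> U(1)]
    by (rule entropy_at_preimage_le[where f = id])
      (use subspace_carrier[OF W] in \<open>auto simp: module_hom_def\<close>)
  finally show "\<exists>U\<in>lc_open_subspaces K V. entropy_at K (sub_tvs V W) (restrict \<phi> W) U' \<le> entropy_at K V \<phi> U"
    using U by blast
qed

text \<open>When \<open>W\<close> is open, \<open>U \<inter> W\<close> is a linearly compact open
  subspace both of \<open>V\<close> and of \<open>W\<close>, and the inclusion maps it onto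
  itself.\<close>

lemma entropy_restrict_open:
  assumes op: "openin (topo V) W"
  shows "entropy K V \<phi> = entropy K (sub_tvs V W) (restrict \<phi> W)"
proof (rule antisym[OF entropy_leI entropy_restrict_le])
  fix U assume U: "U \<in> lc_open_subspaces K V"
  note UD = lc_open_subspacesD[OF U]
  have UW: "U \<inter> W \<in> lc_open_subspaces K V"
    using UD W op by (intro lc_open_subspaces_smaller[OF V.topological_vectorspace_axioms U])
      (auto simp: subspace_Int)
  then have UW': "U \<inter> W \<in> lc_open_subspaces K (sub_tvs V W)"
    using W op by (auto simp: lc_open_subspaces_def subspace_sub_tvs_iff openin_open_subtopology sub_tvs_sub_tvs)
  have "entropy_at K V \<phi> U \<le> entropy_at K V \<phi> (U \<inter> W)"
    by (rule entropy_at_le_smaller[OF V.topological_vectorspace_axioms \<phi> UW U]) simp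
  also have "\<dots> \<le> entropy_at K (sub_tvs V W) (restrict \<phi> W) (U \<inter> W)"
    using lc_open_subspaces_fin_codim_cotrajectory[OF S.topological_vectorspace_axioms continuous_linear_restrict UW']
      lc_open_subspaces_fin_codim_cotrajectory[OF V.topological_vectorspace_axioms \<phi> UW]
    by (rule entropy_at_image_le[where f = id])
      (use subspace_carrier[OF W] in \<open>auto simp: module_hom_def\<close>)
  finally show "\<exists>U'\<in>lc_open_subspaces K (sub_tvs V W).
      entropy_at K V \<phi> U \<le> entropy_at K (sub_tvs V W) (restrict \<phi> W) U'" using UW' by blast
qed

text \<open>Since \<open>W\<close> lies in \<open>U\<close>, the full preimage of the image of
  \<open>U\<close> is \<open>U\<close> itself. Closedness of \<open>W\<close> makes the quotient
  Hausdorff, so that the image is linearly compact and takes part in the supremum.\<close>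

lemma entropy_at_le_quotient:
  assumes cl: "closedin (topo V) W" and U: "U \<in> lc_open_subspaces K V" and WU: "W \<subseteq> U"
  shows "ereal (entropy_at K V \<phi> U) \<le> entropy K (quot_tvs V W) (induced_map V W \<phi>)"
proof -
  let ?Q = "quot_tvs V W" and ?p = "\<lambda>v. W +>\<^bsub>V\<^esub> v"
  note UD = lc_open_subspacesD[OF U] and p = continuous_linearD[OF continuous_linear_proj]
  have sU: "VectorSpace.subspace K (?p ` U) ?Q" using subspace_image[OF p(1) Q.vectorspace_axioms UD(1)] .
  have "linearly_topologized K ?Q"
    using quot_tvs_linearly_topologized[OF locally_linearly_compact_linearly_topologized[OF V] W cl] .
  then have "linearly_topologized K (sub_tvs ?Q (?p ` U))" using sU by (rule sub_tvs_linearly_topologized)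
  moreover have "continuous_linear K (sub_tvs V U) (sub_tvs ?Q (?p ` U)) ?p"
    unfolding continuous_linear_def
    using module_hom_sub_tvs[OF p(1) UD(1), of "?p ` U"] continuous_map_from_subtopology[OF p(2)]
    by (auto simp: continuous_map_in_subtopology)
  ultimately have "linearly_compact K (sub_tvs ?Q (?p ` U))"
    by (rule linearly_compact_image[OF UD(3)]) simp
  then have pU: "?p ` U \<in> lc_open_subspaces K ?Q"
    using sU V.quot_tvs_proj_open[OF W UD(2)] by (simp add: lc_open_subspaces_def)
  have pre: "U = {x \<in> carrier V. ?p x \<in> ?p ` U}"
  proof (intro equalityI subsetI)
    fix x assume "x \<in> {x \<in> carrier V. ?p x \<in> ?p ` U}"
    then obtain u where u: "x \<in> carrier V" "u \<in> U" "?p x = ?p u" by blast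
    then have "x \<ominus>\<^bsub>V\<^esub> u \<in> U" using coset_eq_iff[OF W] subspace_carrier[OF UD(1)] WU by blast
    then have "(x \<ominus>\<^bsub>V\<^esub> u) \<oplus>\<^bsub>V\<^esub> u \<in> U" using u subspace_add[OF UD(1)] by blast
    then show "x \<in> U" using u subspace_carrier[OF UD(1)] by (simp add: V.minus_add_cancel)
  qed (use subspace_carrier[OF UD(1)] in auto)
  have "entropy_at K V \<phi> U \<le> entropy_at K ?Q (induced_map V W \<phi>) (?p ` U)"
    using lc_open_subspaces_fin_codim_cotrajectory[OF V.topological_vectorspace_axioms \<phi> U]
      lc_open_subspaces_fin_codim_cotrajectory[OF Q.topological_vectorspace_axioms continuous_linear_induced pU]
      p(1) induced_map_coset[symmetric]
    by (rule entropy_at_preimage_le) (assumption, rule pre)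
  then show ?thesis using entropy_at_le_entropy[OF pU, of "induced_map V W \<phi>"] by (meson ereal_less_eq(3) order_trans)
qed

end

section \<open>The logarithmic law\<close>

lemma entropy_funpow:
  assumes V: "locally_linearly_compact K V" and \<phi>: "continuous_linear K V V \<phi>"
  shows "entropy K V (\<phi> ^^ k) = ereal (real k) * entropy K V \<phi>"
proof -
  have Vt: "topological_vectorspace K V" using V by (rule locally_linearly_compact_tvs)
  note fc = lc_open_subspaces_fin_codim_cotrajectory[OF Vt]
  note ne = lc_open_subspaces_nonempty[OF V]
  show ?thesis
  proof (cases "k = 0")
    \<comment> \<open>The identity has constant cotrajectories, hence entropy 0 at every
      \<open>U\<close>; the right side is 0 as well, because in \<open>ereal\<close> 0 times
      infinity is 0.\<close>
    case True
    have "entropy_at K V id U = 0" if U: "U \<in> lc_open_subspaces K V" for U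
    proof -
      have "cotrajectory id U n = U" for n by (auto simp: mem_cotrajectory)
      then show ?thesis
        using codim_self[OF lc_open_subspacesD(1)[OF U]]
        by (simp add: entropy_at_def codim_def)
    qed
    then show ?thesis using True ne by (simp add: entropy_def zero_ereal_def[symmetric])
  next
    case False
    then have k: "k \<ge> 1" by simp
    note \<phi>k = continuous_linear_funpow[OF Vt \<phi>, of k]
    \<comment> \<open>A non-negative real factor passes through a non-empty supremum, even an
      infinite one.\<close>
    have mult: "ereal (real k) * entropy K V \<phi> = (SUP U\<in>lc_open_subspaces K V. ereal (real k * entropy_at K V \<phi> U))"
      unfolding entropy_def using ne by (simp add: Sup_ereal_mult_left')
    show ?thesis
    proof (rule antisym)
      show "entropy K V (\<phi> ^^ k) \<le> ereal (real k) * entropy K V \<phi>"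
        unfolding mult unfolding entropy_def
      proof (rule SUP_mono)
        fix U assume U: "U \<in> lc_open_subspaces K V"
        then show "\<exists>U'\<in>lc_open_subspaces K V. ereal (entropy_at K V (\<phi> ^^ k) U) \<le> ereal (real k * entropy_at K V \<phi> U')"
          using entropy_at_funpow_le[OF fc[OF \<phi> U] fc[OF \<phi>k U] k] by auto
      qed
      show "ereal (real k) * entropy K V \<phi> \<le> entropy K V (\<phi> ^^ k)"
        unfolding mult
      proof (rule SUP_least)
        fix U assume U: "U \<in> lc_open_subspaces K V"
        \<comment> \<open>Among linearly compact open subspaces, the \<open>k\<close>-th
          cotrajectory of \<open>U\<close> is the one at which the power has exactly
          \<open>k\<close> times the entropy of \<phi> at \<open>U\<close>.\<close>
        note C = lc_open_subspaces_cotrajectory[OF Vt \<phi> U, of k]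
        show "ereal (real k * entropy_at K V \<phi> U) \<le> entropy K V (\<phi> ^^ k)"
          using entropy_at_le_entropy[OF C, of "\<phi> ^^ k"]
            entropy_at_funpow_cotrajectory[OF fc[OF \<phi> U] fc[OF \<phi>k C] k] by simp
      qed
    qed
  qed
qed

section \<open>The weak addition theorem\<close>

context
  fixes K :: "'k ring" and V1 :: "('k, 'v1) tvs" and V2 :: "('k, 'v2) tvs" and \<phi>1 \<phi>2
  assumes V1: "locally_linearly_compact K V1" and V2: "locally_linearly_compact K V2"
    and \<phi>1: "continuous_linear K V1 V1 \<phi>1" and \<phi>2: "continuous_linear K V2 V2 \<phi>2"
begin

interpretation A: topological_vectorspace K V1 using V1 by (rule locally_linearly_compact_tvs)
interpretation B: topological_vectorspace K V2 using V2 by (rule locally_linearly_compact_tvs)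
interpretation P: topological_vectorspace K "prod_tvs V1 V2"
  by (rule prod_tvs_topological_vectorspace[OF A.topological_vectorspace_axioms B.topological_vectorspace_axioms])

lemma continuous_linear_map_prod: "continuous_linear K (prod_tvs V1 V2) (prod_tvs V1 V2) (map_prod \<phi>1 \<phi>2)"
proof -
  have "continuous_map (prod_topology (topo V1) (topo V2)) (prod_topology (topo V1) (topo V2)) (\<lambda>p. (\<phi>1 (fst p), \<phi>2 (snd p)))"
    using continuous_map_compose[OF continuous_map_fst continuous_linearD(2)[OF \<phi>1]]
      continuous_map_compose[OF continuous_map_snd continuous_linearD(2)[OF \<phi>2]]
    by (intro continuous_map_pairedI) (simp_all add: comp_def)
  moreover have "(\<lambda>p. (\<phi>1 (fst p), \<phi>2 (snd p))) = map_prod \<phi>1 \<phi>2" by auto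
  moreover have "map_prod \<phi>1 \<phi>2 \<in> module_hom K (prod_tvs V1 V2) (prod_tvs V1 V2)"
    using continuous_linearD(1)[OF \<phi>1] continuous_linearD(1)[OF \<phi>2]
    by (auto simp: module_hom_def prod_tvs_simps)
  ultimately show ?thesis by (simp add: continuous_linear_def prod_tvs_simps)
qed

lemma lc_open_subspaces_Times:
  assumes U1: "U1 \<in> lc_open_subspaces K V1" and U2: "U2 \<in> lc_open_subspaces K V2"
  shows "U1 \<times> U2 \<in> lc_open_subspaces K (prod_tvs V1 V2)"
proof -
  note D1 = lc_open_subspacesD[OF U1] and D2 = lc_open_subspacesD[OF U2]
  have "sub_tvs (prod_tvs V1 V2) (U1 \<times> U2) = prod_tvs (sub_tvs V1 U1) (sub_tvs V2 U2)"
    by (simp add: sub_tvs_def prod_tvs_def direct_sum_def module.defs tvs.defs subtopology_Times)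
  then show ?thesis
    using D1 D2 prod_tvs_linearly_compact[OF D1(3) D2(3)]
      subspace_Times[OF A.topological_vectorspace_axioms B.topological_vectorspace_axioms D1(1) D2(1)]
    by (simp add: lc_open_subspaces_def prod_tvs_simps openin_prod_Times_iff)
qed

lemma cotrajectory_map_prod:
  "cotrajectory (map_prod \<phi>1 \<phi>2) (U1 \<times> U2) n = cotrajectory \<phi>1 U1 n \<times> cotrajectory \<phi>2 U2 n"
proof -
  have "(map_prod \<phi>1 \<phi>2 ^^ k) p = ((\<phi>1 ^^ k) (fst p), (\<phi>2 ^^ k) (snd p))" for k p
    by (induction k) (simp_all add: prod_eq_iff)
  then show ?thesis by (auto simp: mem_cotrajectory)
qed

text \<open>Descend from \<open>U1 \<times> U2\<close> through \<open>f1.C n \<times> U2\<close> to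
  the product of the cotrajectories: the first step has the codimension in \<open>V1\<close>, seen
  through \<open>fst\<close>, the second that in \<open>V2\<close>, seen through
  \<open>snd\<close>.\<close>

lemma entropy_at_Times:
  assumes U1: "U1 \<in> lc_open_subspaces K V1" and U2: "U2 \<in> lc_open_subspaces K V2"
  shows "entropy_at K (prod_tvs V1 V2) (map_prod \<phi>1 \<phi>2) (U1 \<times> U2) = entropy_at K V1 \<phi>1 U1 + entropy_at K V2 \<phi>2 U2"
proof -
  let ?P = "prod_tvs V1 V2"
  interpret f1: fin_codim_cotrajectory K V1 \<phi>1 U1
    by (rule lc_open_subspaces_fin_codim_cotrajectory[OF A.topological_vectorspace_axioms \<phi>1 U1])
  interpret f2: fin_codim_cotrajectory K V2 \<phi>2 U2
    by (rule lc_open_subspaces_fin_codim_cotrajectory[OF B.topological_vectorspace_axioms \<phi>2 U2])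
  interpret f: fin_codim_cotrajectory K ?P "map_prod \<phi>1 \<phi>2" "U1 \<times> U2"
    by (rule lc_open_subspaces_fin_codim_cotrajectory[OF P.topological_vectorspace_axioms
          continuous_linear_map_prod lc_open_subspaces_Times[OF U1 U2]])
  note sT = subspace_Times[OF A.topological_vectorspace_axioms B.topological_vectorspace_axioms]
  have "codim K ?P (U1 \<times> U2) (f.C n) = codim K V1 U1 (f1.C n) + codim K V2 U2 (f2.C n)" for n
  proof -
    have z1: "\<zero>\<^bsub>V1\<^esub> \<in> f1.C n" and z2: "\<zero>\<^bsub>V2\<^esub> \<in> U2" "\<zero>\<^bsub>V2\<^esub> \<in> f2.C n"
      using subspace_zero f1.subspace_C f2.subspace_C f2.U by blast+
    have s1: "f1.C n \<subseteq> U1" "f2.C n \<subseteq> U2" by (rule cotrajectory_subset)+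
    have c: "f1.C n \<subseteq> carrier V1" "U2 \<subseteq> carrier V2" "U1 \<subseteq> carrier V1"
      using subspace_subset f1.subspace_C f2.U f1.U by blast+
    have "codim K ?P (U1 \<times> U2) (f.C n) = codim K ?P (U1 \<times> U2) (f1.C n \<times> U2) + codim K ?P (f1.C n \<times> U2) (f.C n)"
    proof (rule codim_add[OF f.U sT[OF f1.subspace_C f2.U] f.subspace_C _ _ f.fin])
      show "f.C n \<subseteq> f1.C n \<times> U2" using s1 by (auto simp: cotrajectory_map_prod)
      show "f1.C n \<times> U2 \<subseteq> U1 \<times> U2" using s1 by auto
    qed
    moreover have "codim K ?P (U1 \<times> U2) (f1.C n \<times> U2) = codim K V1 U1 (f1.C n)"
    proof (rule codim_map_eq[OF fst_hom f.U f1.U f1.subspace_C s1(1) _ _ f1.fin])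
      show "f1.C n \<times> U2 = {x \<in> U1 \<times> U2. fst x \<in> f1.C n}" using s1 by auto
      fix y assume y: "y \<in> U1"
      then have "y \<ominus>\<^bsub>V1\<^esub> y = \<zero>\<^bsub>V1\<^esub>" using c by (intro A.minus_self) auto
      then show "\<exists>x\<in>U1 \<times> U2. y \<ominus>\<^bsub>V1\<^esub> fst x \<in> f1.C n" using y z1 z2 by (intro bexI[of _ "(y, \<zero>\<^bsub>V2\<^esub>)"]) auto
    qed auto
    moreover have "codim K ?P (f1.C n \<times> U2) (f.C n) = codim K V2 U2 (f2.C n)"
    proof (rule codim_map_eq[OF snd_hom sT[OF f1.subspace_C f2.U] f2.U f2.subspace_C s1(2) _ _ f2.fin])
      show "f.C n = {x \<in> f1.C n \<times> U2. snd x \<in> f2.C n}" using s1 by (auto simp: cotrajectory_map_prod)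
      fix y assume y: "y \<in> U2"
      then have "y \<ominus>\<^bsub>V2\<^esub> y = \<zero>\<^bsub>V2\<^esub>" using c by (intro B.minus_self) auto
      then show "\<exists>x\<in>f1.C n \<times> U2. y \<ominus>\<^bsub>V2\<^esub> snd x \<in> f2.C n" using y z1 z2 by (intro bexI[of _ "(\<zero>\<^bsub>V1\<^esub>, y)"]) auto
    qed auto
    ultimately show ?thesis by simp
  qed
  then have "(\<lambda>n. 1 / real n * real (codim K ?P (U1 \<times> U2) (f.C n))) =
      (\<lambda>n. 1 / real n * real (codim K V1 U1 (f1.C n)) + 1 / real n * real (codim K V2 U2 (f2.C n)))"
    by (simp add: distrib_left add_divide_distrib)
  then have "(\<lambda>n. 1 / real n * real (codim K ?P (U1 \<times> U2) (f.C n))) \<longlonglongrightarrow> entropy_at K V1 \<phi>1 U1 + entropy_at K V2 \<phi>2 U2"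
    using tendsto_add[OF f1.entropy_at_lim f2.entropy_at_lim] by simp
  then show ?thesis using f.entropy_at_lim LIMSEQ_unique by blast
qed

lemma entropy_prod: "entropy K (prod_tvs V1 V2) (map_prod \<phi>1 \<phi>2) = entropy K V1 \<phi>1 + entropy K V2 \<phi>2"
proof (rule antisym)
  let ?P = "prod_tvs V1 V2"
  show "entropy K ?P (map_prod \<phi>1 \<phi>2) \<le> entropy K V1 \<phi>1 + entropy K V2 \<phi>2"
    unfolding entropy_def[of K ?P]
  proof (rule SUP_least)
    fix U assume U: "U \<in> lc_open_subspaces K ?P"
    note UD = lc_open_subspacesD[OF U]
    obtain S1 S2 where S: "VectorSpace.subspace K S1 V1" "openin (topo V1) S1"
      "VectorSpace.subspace K S2 V2" "openin (topo V2) S2" "S1 \<times> S2 \<subseteq> U"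
      using prod_tvs_open_subspace[OF V1[THEN locally_linearly_compact_linearly_topologized]
          V2[THEN locally_linearly_compact_linearly_topologized] UD(2) subspace_zero[OF UD(1)]] .
    obtain U1 where U1: "U1 \<in> lc_open_subspaces K V1" "U1 \<subseteq> S1"
      using locally_linearly_compact_basis[OF V1 S(2) subspace_zero[OF S(1)]] .
    obtain U2 where U2: "U2 \<in> lc_open_subspaces K V2" "U2 \<subseteq> S2"
      using locally_linearly_compact_basis[OF V2 S(4) subspace_zero[OF S(3)]] .
    have "U1 \<times> U2 \<subseteq> U" using U1(2) U2(2) S(5) by blast
    then have "entropy_at K ?P (map_prod \<phi>1 \<phi>2) U \<le> entropy_at K V1 \<phi>1 U1 + entropy_at K V2 \<phi>2 U2"
      using entropy_at_le_smaller[OF P.topological_vectorspace_axioms continuous_linear_map_prod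
          lc_open_subspaces_Times[OF U1(1) U2(1)] U] entropy_at_Times[OF U1(1) U2(1)] by simp
    then have "ereal (entropy_at K ?P (map_prod \<phi>1 \<phi>2) U) \<le> ereal (entropy_at K V1 \<phi>1 U1) + ereal (entropy_at K V2 \<phi>2 U2)"
      by simp
    also have "\<dots> \<le> entropy K V1 \<phi>1 + entropy K V2 \<phi>2"
      by (intro add_mono entropy_at_le_entropy U1(1) U2(1))
    finally show "ereal (entropy_at K ?P (map_prod \<phi>1 \<phi>2) U) \<le> entropy K V1 \<phi>1 + entropy K V2 \<phi>2" .
  qed
  note ne1 = lc_open_subspaces_nonempty[OF V1] and ne2 = lc_open_subspaces_nonempty[OF V2]
  \<comment> \<open>Excludes the value minus infinity, for which adding a constant does not commute
    with the supremum.\<close>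
  have n2: "entropy K V2 \<phi>2 \<noteq> -\<infinity>"
  proof -
    obtain U where "U \<in> lc_open_subspaces K V2" using ne2 by blast
    then have "ereal (entropy_at K V2 \<phi>2 U) \<le> entropy K V2 \<phi>2" by (rule entropy_at_le_entropy)
    then show ?thesis by auto
  qed
  have "entropy K V1 \<phi>1 + entropy K V2 \<phi>2 =
      (SUP U1\<in>lc_open_subspaces K V1. ereal (entropy_at K V1 \<phi>1 U1) + entropy K V2 \<phi>2)"
    unfolding entropy_def[of K V1] using ne1 n2 by (rule SUP_ereal_add_left[symmetric])
  also have "\<dots> \<le> entropy K ?P (map_prod \<phi>1 \<phi>2)"
  proof (rule SUP_least)
    fix U1 assume U1: "U1 \<in> lc_open_subspaces K V1"
    have "ereal (entropy_at K V1 \<phi>1 U1) + entropy K V2 \<phi>2 =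
        (SUP U2\<in>lc_open_subspaces K V2. ereal (entropy_at K V1 \<phi>1 U1) + ereal (entropy_at K V2 \<phi>2 U2))"
      unfolding entropy_def[of K V2] by (rule SUP_ereal_add_right[symmetric]) (use ne2 in auto)
    also have "\<dots> \<le> entropy K ?P (map_prod \<phi>1 \<phi>2)"
    proof (rule SUP_least)
      fix U2 assume U2: "U2 \<in> lc_open_subspaces K V2"
      show "ereal (entropy_at K V1 \<phi>1 U1) + ereal (entropy_at K V2 \<phi>2 U2) \<le> entropy K ?P (map_prod \<phi>1 \<phi>2)"
        using entropy_at_le_entropy[OF lc_open_subspaces_Times[OF U1 U2], of "map_prod \<phi>1 \<phi>2"]
        by (simp add: entropy_at_Times[OF U1 U2])
    qed
    finally show "ereal (entropy_at K V1 \<phi>1 U1) + entropy K V2 \<phi>2 \<le> entropy K ?P (map_prod \<phi>1 \<phi>2)" .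
  qed
  finally show "entropy K V1 \<phi>1 + entropy K V2 \<phi>2 \<le> entropy K ?P (map_prod \<phi>1 \<phi>2)" .
qed

end

section \<open>Continuity on inverse limits\<close>

lemma directed_finite_lower_bound:
  assumes "I \<noteq> {}" "\<And>i j. i \<in> I \<Longrightarrow> j \<in> I \<Longrightarrow> \<exists>k\<in>I. W k \<subseteq> W i \<and> W k \<subseteq> W j"
    and "finite J" "J \<subseteq> I"
  shows "\<exists>k\<in>I. \<forall>j\<in>J. W k \<subseteq> W j"
  using assms(3,4)
proof (induction J)
  case (insert j J)
  then obtain k where k: "k \<in> I" "\<forall>j\<in>J. W k \<subseteq> W j" by auto
  then obtain l where "l \<in> I" "W l \<subseteq> W k" "W l \<subseteq> W j" using assms(2)[of k j] insert.prems by auto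
  then show ?case using k by blast
qed (use assms(1) in auto)

text \<open>The canonical map being open onto its image, a neighbourhood \<open>U\<close> of zero contains the preimage of a
  basic open set of the product, which restricts only finitely many coordinates.\<close>

lemma inv_limit_open_subspace:
  assumes V: "topological_vectorspace K V" and I: "I \<noteq> {}"
    and dir: "\<And>i j. i \<in> I \<Longrightarrow> j \<in> I \<Longrightarrow> \<exists>k\<in>I. W k \<subseteq> W i \<and> W k \<subseteq> W j"
    and W: "\<And>i. i \<in> I \<Longrightarrow> VectorSpace.subspace K (W i) V"
    and iso: "topological_isomorphism K V (inv_limit V I W) (canonical_map V I W)"
    and U: "openin (topo V) U" "\<zero>\<^bsub>V\<^esub> \<in> U"
  obtains k where "k \<in> I" "W k \<subseteq> U"
proof -
  interpret topological_vectorspace K V by fact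
  let ?c = "canonical_map V I W" and ?L = "carrier (inv_limit V I W)"
    and ?T = "product_topology (\<lambda>i. topo (quot_tvs V (W i))) I"
  have topoL: "topo (inv_limit V I W) = subtopology ?T ?L" by (simp add: inv_limit_def Let_def)
  have hm: "homeomorphic_map (topo V) (topo (inv_limit V I W)) ?c" and h: "?c \<in> module_hom K V (inv_limit V I W)"
    using iso by (auto simp: topological_isomorphism_def)
  have cL: "?c v \<in> ?L" if "v \<in> carrier V" for v using h that by (auto simp: module_hom_def)
  have inj: "inj_on ?c (carrier V)" using hm by (simp add: homeomorphic_eq_everything_map topspace_eq)
  have "openin (topo (inv_limit V I W)) (?c ` U)"
    using hm U(1) by (auto simp: homeomorphic_eq_everything_map open_map_def)
  then obtain S where S: "openin ?T S" "?c ` U = S \<inter> ?L" unfolding topoL openin_subtopology by blast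
  have "?c \<zero>\<^bsub>V\<^esub> \<in> S" using S U by blast
  then obtain N where N: "finite {i \<in> I. N i \<noteq> topspace (topo (quot_tvs V (W i)))}"
      "?c \<zero>\<^bsub>V\<^esub> \<in> Pi\<^sub>E I N" "Pi\<^sub>E I N \<subseteq> S"
    using S(1) unfolding openin_product_topology_alt by (elim ballE exE conjE) auto
  \<comment> \<open>One \<open>W k\<close> below the finitely many \<open>W j\<close> whose
    coordinates are restricted: its elements have zero coordinate there, and elsewhere every coset
    is admissible.\<close>
  obtain k where k: "k \<in> I" "\<And>j. j \<in> I \<Longrightarrow> N j \<noteq> topspace (topo (quot_tvs V (W j))) \<Longrightarrow> W k \<subseteq> W j"
    using directed_finite_lower_bound[OF I dir N(1)] by blast
  have "w \<in> U" if w: "w \<in> W k" for w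
  proof -
    have wV: "w \<in> carrier V" using subspace_carrier[OF W[OF k(1)] w] .
    have "W j +>\<^bsub>V\<^esub> w \<in> N j" if j: "j \<in> I" for j
    proof (cases "N j = topspace (topo (quot_tvs V (W j)))")
      case True
      then show ?thesis using wV by (simp add: topspace_quot_tvs carrier_quot_tvs)
    next
      case False
      then have "w \<in> W j" using k(2) j w by blast
      then have "W j +>\<^bsub>V\<^esub> w = W j +>\<^bsub>V\<^esub> \<zero>\<^bsub>V\<^esub>"
        using coset_eq_self_iff[OF W[OF j], of w] coset_eq_self_iff[OF W[OF j], of "\<zero>\<^bsub>V\<^esub>"]
          wV subspace_zero[OF W[OF j]] by simp
      then show ?thesis using N(2) j by (auto simp: canonical_map_def PiE_iff)
    qed
    then have "?c w \<in> Pi\<^sub>E I N" by (simp add: canonical_map_def)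
    then have "?c w \<in> ?c ` U" using N(3) S(2) cL[OF wV] by blast
    then show "w \<in> U" using inj wV openin_subset_carrier[OF U(1)] by (meson inj_on_image_mem_iff)
  qed
  then show thesis using that k(1) by blast
qed

text \<open>Each \<open>U\<close> contains some \<open>W k\<close>, and the quotient by that single
  \<open>W k\<close> already has at least the entropy of \<phi> at \<open>U\<close>; the converse
  bound is monotonicity under quotients.\<close>

lemma entropy_inv_limit:
  assumes V: "locally_linearly_compact K V" and \<phi>: "continuous_linear K V V \<phi>" and I: "I \<noteq> {}"
    and dir: "\<And>i j. i \<in> I \<Longrightarrow> j \<in> I \<Longrightarrow> \<exists>k\<in>I. W k \<subseteq> W i \<and> W k \<subseteq> W j"
    and W: "\<And>i. i \<in> I \<Longrightarrow> VectorSpace.subspace K (W i) V" "\<And>i. i \<in> I \<Longrightarrow> closedin (topo V) (W i)"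
      "\<And>i. i \<in> I \<Longrightarrow> \<phi> ` W i \<subseteq> W i"
    and iso: "topological_isomorphism K V (inv_limit V I W) (canonical_map V I W)"
  shows "entropy K V \<phi> = (SUP i\<in>I. entropy K (quot_tvs V (W i)) (induced_map V (W i) \<phi>))"
proof (rule antisym)
  show "(SUP i\<in>I. entropy K (quot_tvs V (W i)) (induced_map V (W i) \<phi>)) \<le> entropy K V \<phi>"
    by (rule SUP_least) (rule entropy_quotient_le[OF V \<phi> W(1,3)])
  show "entropy K V \<phi> \<le> (SUP i\<in>I. entropy K (quot_tvs V (W i)) (induced_map V (W i) \<phi>))"
    unfolding entropy_def[of K V]
  proof (rule SUP_least)
    fix U assume U: "U \<in> lc_open_subspaces K V"
    note UD = lc_open_subspacesD[OF U]
    obtain k where k: "k \<in> I" "W k \<subseteq> U"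
      using inv_limit_open_subspace[OF locally_linearly_compact_tvs[OF V] I dir W(1) iso UD(2) subspace_zero[OF UD(1)]] .
    have "ereal (entropy_at K V \<phi> U) \<le> entropy K (quot_tvs V (W k)) (induced_map V (W k) \<phi>)"
      using entropy_at_le_quotient[OF V \<phi> W(1,3,2)[OF k(1)] U k(2)] .
    also have "\<dots> \<le> (SUP i\<in>I. entropy K (quot_tvs V (W i)) (induced_map V (W i) \<phi>))"
      using k(1) by (rule SUP_upper)
    finally show "ereal (entropy_at K V \<phi> U) \<le> (SUP i\<in>I. entropy K (quot_tvs V (W i)) (induced_map V (W i) \<phi>))" .
  qed
qed

theorem proposition3p11:
  fixes K :: "'k ring" and V :: "('k, 'v) tvs" and \<phi> :: "'v \<Rightarrow> 'v"
  assumes "locally_linearly_compact K V"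
    and "continuous_linear K V V \<phi>"
  shows "(\<forall>(W :: ('k, 'w) tvs) \<alpha>.
            locally_linearly_compact K W \<and> topological_isomorphism K V W \<alpha> \<longrightarrow>
            entropy K W (\<alpha> \<circ> \<phi> \<circ> inv_into (carrier V) \<alpha>) = entropy K V \<phi>)
       \<and> (\<forall>W. VectorSpace.subspace K W V \<and> closedin (topo V) W \<and> \<phi> ` W \<subseteq> W \<longrightarrow>
            entropy K V \<phi> \<ge> max (entropy K (sub_tvs V W) (restrict \<phi> W))
                                (entropy K (quot_tvs V W) (induced_map V W \<phi>)) \<and>
            (openin (topo V) W \<longrightarrow>
              entropy K V \<phi> = entropy K (sub_tvs V W) (restrict \<phi> W)))
       \<and> (\<forall>k :: nat. entropy K V (\<phi> ^^ k) = ereal (real k) * entropy K V \<phi>)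
       \<and> (\<forall>(V1 :: ('k, 'v1) tvs) (V2 :: ('k, 'v2) tvs) \<phi>1 \<phi>2.
            locally_linearly_compact K V1 \<and> locally_linearly_compact K V2 \<and>
            continuous_linear K V1 V1 \<phi>1 \<and> continuous_linear K V2 V2 \<phi>2 \<longrightarrow>
            entropy K (prod_tvs V1 V2) (map_prod \<phi>1 \<phi>2) = entropy K V1 \<phi>1 + entropy K V2 \<phi>2)
       \<and> (\<forall>(I :: 'i set) W.
            I \<noteq> {} \<and>
            (\<forall>i \<in> I. \<forall>j \<in> I. \<exists>k \<in> I. W k \<subseteq> W i \<and> W k \<subseteq> W j) \<and>
            (\<forall>i \<in> I. VectorSpace.subspace K (W i) V \<and> closedin (topo V) (W i) \<and> \<phi> ` W i \<subseteq> W i) \<and>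
            topological_isomorphism K V (inv_limit V I W) (canonical_map V I W) \<longrightarrow>
            entropy K V \<phi> = (SUP i \<in> I. entropy K (quot_tvs V (W i)) (induced_map V (W i) \<phi>)))"
proof (intro conjI allI impI; (elim conjE)?)
  note V = assms(1) and \<phi> = assms(2)
  fix W :: "('k, 'w) tvs" and \<alpha>
  assume "locally_linearly_compact K W" "topological_isomorphism K V W \<alpha>"
  then show "entropy K W (\<alpha> \<circ> \<phi> \<circ> inv_into (carrier V) \<alpha>) = entropy K V \<phi>"
    by (intro entropy_conjugate V \<phi>)
next
  note V = assms(1) and \<phi> = assms(2)
  fix W assume W: "VectorSpace.subspace K W V" "\<phi> ` W \<subseteq> W"
  show "entropy K V \<phi> \<ge> max (entropy K (sub_tvs V W) (restrict \<phi> W))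
                                (entropy K (quot_tvs V W) (induced_map V W \<phi>))"
    using entropy_restrict_le[OF V \<phi> W] entropy_quotient_le[OF V \<phi> W] by simp
  assume "openin (topo V) W"
  then show "entropy K V \<phi> = entropy K (sub_tvs V W) (restrict \<phi> W)"
    by (rule entropy_restrict_open[OF V \<phi> W])
next
  fix k :: nat
  show "entropy K V (\<phi> ^^ k) = ereal (real k) * entropy K V \<phi>"
    by (rule entropy_funpow[OF assms])
next
  fix V1 :: "('k, 'v1) tvs" and V2 :: "('k, 'v2) tvs" and \<phi>1 \<phi>2
  assume "locally_linearly_compact K V1" "locally_linearly_compact K V2"
    "continuous_linear K V1 V1 \<phi>1" "continuous_linear K V2 V2 \<phi>2"
  then show "entropy K (prod_tvs V1 V2) (map_prod \<phi>1 \<phi>2) = entropy K V1 \<phi>1 + entropy K V2 \<phi>2"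
    by (rule entropy_prod)
next
  fix I :: "'i set" and W
  assume I: "I \<noteq> {}" and dir: "\<forall>i \<in> I. \<forall>j \<in> I. \<exists>k \<in> I. W k \<subseteq> W i \<and> W k \<subseteq> W j"
    and W: "\<forall>i \<in> I. VectorSpace.subspace K (W i) V \<and> closedin (topo V) (W i) \<and> \<phi> ` W i \<subseteq> W i"
    and iso: "topological_isomorphism K V (inv_limit V I W) (canonical_map V I W)"
  show "entropy K V \<phi> = (SUP i \<in> I. entropy K (quot_tvs V (W i)) (induced_map V (W i) \<phi>))"
    by (rule entropy_inv_limit[OF assms I _ _ _ _ iso]) (use dir W in blast)+
qed

end
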